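(* Let $D \subset \mathbb{R}^m$, $m \geq 2$, be a bounded domain, let $\mu > 0$, and let $v \in C^0(D)$ be real-valued. If the equality $$m \, I_{m/2}(\mu r) \, \widetilde{M}^\circ(v,x,r) = \mu r \, I_{(m-2)/2}(\mu r) \, \widetilde{M}^\bullet(v,x,r)$$ holds for all $x \in D$ and all $r \in (0, r(x))$, where $r(x) > 0$ is such that the ball $B_{r(x)}(x)$ is admissible, then $v$ is a solution of the modified Helmholtz equation $\nabla^2 v - \mu^2 v = 0$ in $D$.
   Context: A domain is an open connected subset of $\mathbb{R}^m$. $B_r(x) = \{ y : |y-x| < r\}$; the ball is called admissible if $\overline{B_r(x)} \subset D$. The mean values over spheres and balls are $$\widetilde{M}^\circ(v,x,r) = \frac{1}{|\partial B_r|} \int_{\partial B_r(x)} v(y) \, dS_y, \qquad \widetilde{M}^\bullet(v,x,r) = \frac{1}{|B_r|} \int_{B_r(x)} v(y) \, dy,$$ where $|\partial B_r|$ is the area of the sphere of radius $r$ and $|B_r|$ the volume of the ball of radius $r$ in $\mathbb{R}^m$. $I_\nu$ is the modified Bessel function of the first kind of order $\nu$. *)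

theory Defs
  imports "HOL-Analysis.Analysis"
begin

(* Meant for z > 0: the factor powr is 0 at z = 0, also when \<nu> = 0.  The entire function
   rGamma = 1 / Gamma makes the coefficients correct at the poles of Gamma as well. *)
definition bessel_I :: "real \<Rightarrow> real \<Rightarrow> real" where
  "bessel_I \<nu> z = (z / 2) powr \<nu> * (\<Sum>k. (z / 2) ^ (2 * k) * rGamma (\<nu> + real k + 1) / fact k)"

(* The surface measure dS on the sphere of radius r about x, as a Borel measure on the whole
   space: in dimension m, the area of A \<subseteq> sphere x r is m / r times the volume of the cone
   with apex x over A.  The cone is the preimage of A under radial projection from x. *)
definition sphere_measure :: "'a::euclidean_space \<Rightarrow> real \<Rightarrow> 'a measure" where
  "sphere_measure x r =
     scale_measure (ennreal (real DIM('a) / r))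
       (distr (restrict_space lborel (ball x r - {x})) borel
          (\<lambda>y. x + (r / norm (y - x)) *\<^sub>R (y - x)))"

(* Sanity check: the area of the sphere is the derivative of unit_ball_vol m * r ^ m. *)
lemma emeasure_sphere_measure_sphere:
  fixes x :: "'a::euclidean_space"
  assumes r: "r > 0"
  shows "emeasure (sphere_measure x r) (sphere x r) =
           ennreal (real DIM('a) * unit_ball_vol (real DIM('a)) * r ^ (DIM('a) - 1))"
proof -
  let ?p = "\<lambda>y::'a. x + (r / norm (y - x)) *\<^sub>R (y - x)"
  let ?B = "ball x r - {x}"
  have meas: "?p \<in> measurable (restrict_space lborel ?B) borel"
    by (rule measurable_restrict_space1) measurable
  have onto: "?p y \<in> sphere x r" if "y \<in> ?B" for y
    using that r by (auto simp: dist_norm)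
  have "emeasure (distr (restrict_space lborel ?B) borel ?p) (sphere x r)
        = emeasure (restrict_space lborel ?B)
            (?p -` sphere x r \<inter> space (restrict_space lborel ?B))"
    by (intro emeasure_distr meas) auto
  also have "?p -` sphere x r \<inter> space (restrict_space lborel ?B) = ?B"
    using onto by (auto simp: space_restrict_space)
  also have "emeasure (restrict_space lborel ?B) ?B = emeasure lborel ?B"
    by (intro emeasure_restrict_space) auto
  also have "\<dots> = emeasure lborel (ball x r)"
    by (rule emeasure_Diff_null_set) auto
  also have "\<dots> = ennreal (unit_ball_vol (real DIM('a)) * r ^ DIM('a))"
    using r by (simp add: emeasure_ball)
  finally have "emeasure (sphere_measure x r) (sphere x r)
      = ennreal (real DIM('a) / r) * ennreal (unit_ball_vol (real DIM('a)) * r ^ DIM('a))"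
    by (simp add: sphere_measure_def)
  also have "\<dots> = ennreal (real DIM('a) / r * (unit_ball_vol (real DIM('a)) * r ^ DIM('a)))"
    using r by (intro ennreal_mult[symmetric]) auto
  also have "real DIM('a) / r * (unit_ball_vol (real DIM('a)) * r ^ DIM('a))
      = real DIM('a) * unit_ball_vol (real DIM('a)) * r ^ (DIM('a) - 1)"
    using r by (cases "DIM('a)") auto
  finally show ?thesis .
qed

definition sphere_mean :: "('a::euclidean_space \<Rightarrow> real) \<Rightarrow> 'a \<Rightarrow> real \<Rightarrow> real" where
  "sphere_mean v x r =
     1 / measure (sphere_measure x r) (sphere x r) * (LINT y:sphere x r|sphere_measure x r. v y)"

definition ball_mean :: "('a::euclidean_space \<Rightarrow> real) \<Rightarrow> 'a \<Rightarrow> real \<Rightarrow> real" where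
  "ball_mean v x r = 1 / measure lborel (ball x r) * (LINT y:ball x r|lborel. v y)"

definition partial_deriv :: "'a::euclidean_space \<Rightarrow> ('a \<Rightarrow> real) \<Rightarrow> 'a \<Rightarrow> real" where
  "partial_deriv b f x = deriv (\<lambda>t. f (x + t *\<^sub>R b)) 0"

(* deriv has an arbitrary value where the derivative does not exist; hence the
   differentiability requirement.  C1_on and C2_on are intended for open S. *)
definition C1_on :: "'a::euclidean_space set \<Rightarrow> ('a \<Rightarrow> real) \<Rightarrow> bool" where
  "C1_on S f \<longleftrightarrow> continuous_on S f \<and>
     (\<forall>b\<in>Basis. (\<forall>x\<in>S. (\<lambda>t. f (x + t *\<^sub>R b)) differentiable (at 0)) \<and>
                continuous_on S (partial_deriv b f))"

definition C2_on :: "'a::euclidean_space set \<Rightarrow> ('a \<Rightarrow> real) \<Rightarrow> bool" where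
  "C2_on S f \<longleftrightarrow> C1_on S f \<and> (\<forall>b\<in>Basis. C1_on S (partial_deriv b f))"

definition laplacian :: "('a::euclidean_space \<Rightarrow> real) \<Rightarrow> 'a \<Rightarrow> real" where
  "laplacian f x = (\<Sum>b\<in>Basis. partial_deriv b (partial_deriv b f) x)"

end

(* On every sphere the hypothesis, the polar formula d/dr (r^m B(r)) = m r^(m-1) S(r) for the sphere
   and ball means S, B, and the recurrence of the Bessel series give
   (B(r) - v x) / r^2 --> mu^2 v x / (2 (m + 2)): pointwise, v has the "mean Laplacian" mu^2 v.
   The radii are not uniform in x, so this cannot be integrated directly; instead v is compared with
   smooth functions.  On a small ball, polynomials U with U close to v on the sphere and
   Lap U - mu^2 U close to 0 are obtained by a Picard iteration whose steps solve a Dirichlet problem for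
   the Poisson equation in polynomials (Fischer decomposition).  At an interior maximum of
   +-(v - U) the mean Laplacian is nonpositive, so U is uniformly close to v on the ball.
   For such U the averages over B(x, t) with weights (1 - |y|^2)^j are tied together by integration
   by parts, which yields in the limit a reproducing formula
   v x * E = INT v(x + d y) (1 - |y|^2)^3 dy with E > 0.  Differentiating the kernel twice
   shows that v is C^2, and then the mean Laplacian is the Laplacian. *)

theory Submission
  imports Defs
begin

section \<open>Integrals against kernels supported in the unit ball\<close>

text \<open>The comparison needs no uniformity in x because of the sign of the zeroth-order term:
  where +-(U - v) exceeds the tolerance, the equation itself makes its mean Laplacian positive.
  Polynomials stand in for the Poisson kernel: a correction (|x|^2 - R^2) q vanishes on the sphere
  whatever q is, so only its Laplacian has to be prescribed, degree by degree. The iteration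
  contracts the residual by the factor mu^2 R^2 / m, hence the small ball. The constant E is
  obtained without special functions: the plane wave exp (mu (y . c)) with |c| = 1 is an exact
  solution with value 1 at the centre, so U(x + y) - U(x) exp (mu (y . c)) vanishes at y = 0 and its
  weighted averages tend to 0 with the residual. The exponent 3 is what two differentiations cost:
  the first derivative of the kernel still has the factor (1 - |y|^2)^2 and is Lipschitz, the second
  is continuous across the unit sphere. Functions are kept continuous on the whole space, so that
  integrals over translated balls are always defined; an extension from a closed ball brings v into
  this setting.\<close>

definition ball_kernel :: "('a::euclidean_space \<Rightarrow> real) \<Rightarrow> bool" where
  "ball_kernel k \<longleftrightarrow> k \<in> borel_measurable borel \<and> (\<exists>C. \<forall>y. \<bar>k y\<bar> \<le> C) \<and> (\<forall>y. norm y > 1 \<longrightarrow> k y = 0)"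

lemma integrable_bounded_ball:
  fixes f :: "'a::euclidean_space \<Rightarrow> real"
  assumes "f \<in> borel_measurable borel" "\<And>y. norm y \<le> R \<Longrightarrow> \<bar>f y\<bar> \<le> C" "\<And>y. norm y > R \<Longrightarrow> f y = 0"
  shows "integrable lborel f"
proof (rule Bochner_Integration.integrable_bound)
  show "integrable lborel (\<lambda>y. C * indicator (cball 0 R) y :: real)"
    by (intro integrable_mult_right integrable_real_indicator emeasure_lborel_cball_finite) auto
  show "AE y in lborel. norm (f y) \<le> norm (C * indicator (cball 0 R) y :: real)"
    using assms(2,3) by (intro AE_I2) (force simp: indicator_def)
qed (use assms in auto)

lemma kernel_integrable:
  fixes f :: "'a::euclidean_space \<Rightarrow> real"
  assumes f: "continuous_on UNIV f" and k: "ball_kernel k"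
  shows "integrable lborel (\<lambda>y. f y * k y)"
proof -
  obtain C where C: "\<And>y. \<bar>k y\<bar> \<le> C" using k by (auto simp: ball_kernel_def)
  have "bounded (f ` cball 0 1)"
    by (intro compact_imp_bounded compact_continuous_image continuous_on_subset[OF f]) auto
  then obtain M where M: "\<And>y. norm y \<le> 1 \<Longrightarrow> \<bar>f y\<bar> \<le> M"
    by (fastforce simp: bounded_iff)
  have [measurable]: "f \<in> borel_measurable borel"
    using f by (rule borel_measurable_continuous_onI)
  show ?thesis
  proof (rule integrable_bounded_ball[where R=1 and C="M * C"])
    show "(\<lambda>y. f y * k y) \<in> borel_measurable borel" using k by (auto simp: ball_kernel_def)
    show "\<bar>f y * k y\<bar> \<le> M * C" if "norm y \<le> 1" for y
      using M[OF that] C[of y] by (simp add: abs_mult mult_mono')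
  qed (use k in \<open>auto simp: ball_kernel_def\<close>)
qed

lemma continuous_on_section:
  assumes "continuous_on UNIV (\<lambda>(z,y). F z y)"
  shows "continuous_on UNIV (F z)"
proof -
  have "continuous_on UNIV ((\<lambda>(z,y). F z y) \<circ> (\<lambda>y. (z,y)))"
    by (intro continuous_on_compose continuous_on_Pair continuous_on_const continuous_on_id
        continuous_on_subset[OF assms]) auto
  then show ?thesis by (simp add: comp_def)
qed

lemma continuous_kernel_integral:
  fixes F :: "'z::heine_borel \<Rightarrow> 'a::euclidean_space \<Rightarrow> real"
  assumes F: "continuous_on UNIV (\<lambda>(z,y). F z y)" and k: "ball_kernel k"
  shows "continuous_on UNIV (\<lambda>z. LINT y|lborel. F z y * k y)"
proof -
  obtain C where C: "\<And>y. \<bar>k y\<bar> \<le> C" using k by (auto simp: ball_kernel_def)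
  have Fz: "continuous_on UNIV (F z)" for z
    using F by (rule continuous_on_section)
  have Fy: "continuous_on UNIV (\<lambda>z. F z y)" for y
  proof -
    have "continuous_on UNIV ((\<lambda>(z,y). F z y) \<circ> (\<lambda>z. (z,y)))"
      by (intro continuous_on_compose continuous_on_Pair continuous_on_const continuous_on_id
          continuous_on_subset[OF F]) auto
    then show ?thesis by (simp add: comp_def)
  qed
  have "(\<lambda>n. LINT y|lborel. F (s n) y * k y) \<longlonglongrightarrow> (LINT y|lborel. F z y * k y)"
    if s: "s \<longlonglongrightarrow> z" for s z
  proof -
    \<comment> \<open>A convergent sequence together with its limit is compact, so one bound serves
      all \<open>n\<close> and yields the dominating function.\<close>
    have "bounded ((\<lambda>(z,y). F z y) ` (insert z (range s) \<times> cball 0 1))"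
      by (intro compact_imp_bounded compact_continuous_image continuous_on_subset[OF F]
          compact_Times compact_sequence_with_limit[OF s]) auto
    then obtain M where M: "\<And>n y. norm y \<le> 1 \<Longrightarrow> \<bar>F (s n) y\<bar> \<le> M"
      by (fastforce simp: bounded_iff)
    show ?thesis
    proof (rule integral_dominated_convergence[where w="\<lambda>y. (M * C) * indicator (cball 0 1) y"])
      show "integrable lborel (\<lambda>y. (M * C) * indicator (cball 0 1) y :: real)"
        by (intro integrable_mult_right integrable_real_indicator emeasure_lborel_cball_finite) auto
      show "AE y in lborel. norm (F (s n) y * k y) \<le> M * C * indicator (cball 0 1) y" for n
        using M[of _ n] C k by (intro AE_I2) (auto simp: indicator_def abs_mult mult_mono' ball_kernel_def)
      show "AE y in lborel. (\<lambda>n. F (s n) y * k y) \<longlonglongrightarrow> F z y * k y"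
        using continuous_on_tendsto_compose[OF Fy s] by (intro AE_I2 tendsto_intros) auto
    qed (use kernel_integrable[OF Fz k] in \<open>auto dest: borel_measurable_integrable\<close>)
  qed
  then show ?thesis
    by (auto simp: continuous_on_sequentially comp_def)
qed

lemma has_derivative_kernel_integral:
  fixes F :: "real \<Rightarrow> 'a::euclidean_space \<Rightarrow> real"
  assumes F: "\<And>s. continuous_on UNIV (F s)" and F': "continuous_on UNIV (\<lambda>(s,y). F' s y)"
    and D: "\<And>s y. ((\<lambda>s. F s y) has_real_derivative F' s y) (at s)" and k: "ball_kernel k"
  shows "((\<lambda>s. LINT y|lborel. F s y * k y) has_real_derivative (LINT y|lborel. F' s0 y * k y)) (at s0)"
proof -
  obtain C where C: "\<And>y. \<bar>k y\<bar> \<le> C" using k by (auto simp: ball_kernel_def)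
  have F'y: "continuous_on UNIV (F' s)" for s
    using F' by (rule continuous_on_section)
  have "bounded ((\<lambda>(s,y). F' s y) ` (cball s0 1 \<times> cball 0 1))"
    by (intro compact_imp_bounded compact_continuous_image continuous_on_subset[OF F'] compact_Times) auto
  then obtain M where M: "\<And>s y. s \<in> cball s0 1 \<Longrightarrow> norm y \<le> 1 \<Longrightarrow> \<bar>F' s y\<bar> \<le> M"
    by (fastforce simp: bounded_iff)
  \<comment> \<open>The mean value inequality turns the bound on \<open>F'\<close> into a bound on
    the difference quotients. At \<open>s = s0\<close> the quotient is a division by zero with value
    0, so \<open>M \<ge> 0\<close> settles that case.\<close>
  have bnd: "\<bar>(F s y - F s0 y) / (s - s0)\<bar> \<le> M" if s: "s \<in> ball s0 1" and y: "norm y \<le> 1" for s y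
  proof -
    have "norm (F s y - F s0 y) \<le> M * norm (s - s0)"
      by (rule field_differentiable_bound[where S="cball s0 1" and f'="\<lambda>s. F' s y"])
        (use M y s in \<open>auto intro: has_field_derivative_at_within D\<close>)
    moreover have "M \<ge> 0" using M[of s0 y] y by auto
    ultimately show ?thesis by (cases "s = s0") (auto simp: field_simps abs_mult)
  qed
  have "((\<lambda>s. ((LINT y|lborel. F s y * k y) - (LINT y|lborel. F s0 y * k y)) / (s - s0))
      \<longlongrightarrow> (LINT y|lborel. F' s0 y * k y)) (at s0 within ball s0 1)"
    unfolding tendsto_at_iff_sequentially comp_def
  proof safe
    fix s :: "nat \<Rightarrow> real"
    assume s: "\<forall>i. s i \<in> ball s0 1 - {s0}" "s \<longlonglongrightarrow> s0"
    have eq: "((LINT y|lborel. F (s n) y * k y) - (LINT y|lborel. F s0 y * k y)) / (s n - s0)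
      = (LINT y|lborel. (F (s n) y - F s0 y) / (s n - s0) * k y)" for n
    proof -
      have "(F (s n) y - F s0 y) / (s n - s0) * k y = (F (s n) y * k y - F s0 y * k y) / (s n - s0)" for y
        by (simp add: left_diff_distrib)
      then show ?thesis
        by (simp only: integral_divide_zero Bochner_Integration.integral_diff kernel_integrable[OF F k])
    qed
    show "(\<lambda>n. ((LINT y|lborel. F (s n) y * k y) - (LINT y|lborel. F s0 y * k y)) / (s n - s0))
      \<longlonglongrightarrow> (LINT y|lborel. F' s0 y * k y)"
      unfolding eq
    proof (rule integral_dominated_convergence[where w="\<lambda>y. (M * C) * indicator (cball 0 1) y"])
      show "integrable lborel (\<lambda>y. (M * C) * indicator (cball 0 1) y :: real)"
        by (intro integrable_mult_right integrable_real_indicator emeasure_lborel_cball_finite) auto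
      show "AE y in lborel. norm ((F (s n) y - F s0 y) / (s n - s0) * k y) \<le> M * C * indicator (cball 0 1) y" for n
      proof (rule AE_I2)
        fix y show "norm ((F (s n) y - F s0 y) / (s n - s0) * k y) \<le> M * C * indicator (cball 0 1) y"
        proof (cases "norm y \<le> 1")
          case True
          then have "\<bar>(F (s n) y - F s0 y) / (s n - s0)\<bar> * \<bar>k y\<bar> \<le> M * C"
            using bnd[of "s n" y] s C[of y] by (intro mult_mono') auto
          with True show ?thesis by (simp add: abs_mult)
        next
          case False
          then show ?thesis using k by (simp add: ball_kernel_def)
        qed
      qed
      show "AE y in lborel. (\<lambda>n. (F (s n) y - F s0 y) / (s n - s0) * k y) \<longlonglongrightarrow> F' s0 y * k y"
      proof (intro AE_I2 tendsto_mult tendsto_const)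
        fix y
        have "((\<lambda>s. (F s y - F s0 y) / (s - s0)) \<longlongrightarrow> F' s0 y) (at s0)"
          using D[of y s0] by (simp add: has_field_derivative_iff)
        then show "(\<lambda>n. (F (s n) y - F s0 y) / (s n - s0)) \<longlonglongrightarrow> F' s0 y"
          using s unfolding tendsto_at_iff_sequentially comp_def by auto
      qed
      show "(\<lambda>y. (F (s n) y - F s0 y) / (s n - s0) * k y) \<in> borel_measurable lborel" for n
        using k F[THEN borel_measurable_continuous_onI] by (auto simp: ball_kernel_def)
    qed (use kernel_integrable[OF F'y k] in \<open>auto dest: borel_measurable_integrable\<close>)
  qed
  then show ?thesis
    by (simp add: has_field_derivative_iff at_within_open[of s0 "ball s0 1"])
qed

lemma lborel_integral_translate:
  fixes f :: "'a::euclidean_space \<Rightarrow> real"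
  assumes [measurable]: "f \<in> borel_measurable borel"
  shows "(LINT y|lborel. f (c + y)) = (LINT y|lborel. f y)"
proof -
  have "(LINT y|lborel. f y) = (LINT y|distr lborel borel ((+) c). f y)"
    by (simp add: lborel_distr_plus)
  also have "\<dots> = (LINT y|lborel. f (c + y))"
    by (rule integral_distr) auto
  finally show ?thesis by simp
qed

text \<open>The difference quotient is moved from the merely continuous \<open>v\<close> onto the Lipschitz kernel
  by a translation.\<close>

lemma kernel_convolution_derivative:
  fixes v k k' :: "'a::euclidean_space \<Rightarrow> real"
  assumes v: "continuous_on UNIV v" and t: "t > 0"
    and lip: "\<And>y z. \<bar>k y - k z\<bar> \<le> L * norm (y - z)"
    and supp: "\<And>y. norm y \<ge> 1 \<Longrightarrow> k y = 0"
    and k': "k' \<in> borel_measurable borel"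
    and D: "\<And>y. norm y \<noteq> 1 \<Longrightarrow> ((\<lambda>s. k (y + s *\<^sub>R e)) has_real_derivative k' y) (at 0)"
  shows "((\<lambda>s. LINT y|lborel. v (x + s *\<^sub>R e + t *\<^sub>R y) * k y) has_real_derivative
     - (1 / t) * (LINT y|lborel. v (x + t *\<^sub>R y) * k' y)) (at 0)"
proof -
  have vm[measurable]: "v \<in> borel_measurable borel"
    using v by (rule borel_measurable_continuous_onI)
  have L: "L \<ge> 0"
  proof -
    obtain b :: 'a where "b \<in> Basis" using nonempty_Basis by blast
    then show ?thesis using lip[of b 0] by auto
  qed
  have "L-lipschitz_on UNIV k" using lip L by (auto simp: lipschitz_on_def dist_norm)
  then have kc: "continuous_on UNIV k" by (rule lipschitz_on_continuous_on)
  then have km[measurable]: "k \<in> borel_measurable borel" by (rule borel_measurable_continuous_onI)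
  \<comment> \<open>For \<open>\<bar>s\<bar> < d\<close> the shift
    \<open>(s / t) *\<^sub>R e\<close> has norm at most 1, so all shifted kernels live in the ball
    of radius 2. The summand 1 in the denominator covers \<open>e = 0\<close>.\<close>
  define d where "d = t / (norm e + 1)"
  have d: "d > 0" using t by (simp add: d_def add_nonneg_pos)
  have small: "\<bar>s / t\<bar> * norm e \<le> 1" if "s \<in> ball 0 d" for s
  proof -
    have "\<bar>s\<bar> * norm e \<le> d * norm e" using that by (intro mult_right_mono) auto
    also have "\<dots> \<le> t" using t by (simp add: d_def divide_simps add_nonneg_pos)
    finally show ?thesis using t by (simp add: field_simps)
  qed
  have bk: "ball_kernel k"
  proof -
    have "bounded (k ` cball 0 1)"
      by (intro compact_imp_bounded compact_continuous_image continuous_on_subset[OF kc]) auto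
    then obtain M where M: "\<And>y. norm y \<le> 1 \<Longrightarrow> \<bar>k y\<bar> \<le> M" by (fastforce simp: bounded_iff)
    have "\<bar>k y\<bar> \<le> M" for y
      using M[of y] M[of 0] supp[of y] by (cases "norm y \<le> 1") auto
    then show ?thesis using supp by (auto simp: ball_kernel_def)
  qed
  have "bounded ((\<lambda>y. v (x + t *\<^sub>R y)) ` cball 0 2)"
    by (intro compact_imp_bounded compact_continuous_image continuous_on_compose2[OF v])
      (auto intro!: continuous_intros)
  then obtain M where M: "\<And>y. norm y \<le> 2 \<Longrightarrow> \<bar>v (x + t *\<^sub>R y)\<bar> \<le> M"
    by (fastforce simp: bounded_iff)
  have shift: "(LINT y|lborel. v (x + s *\<^sub>R e + t *\<^sub>R y) * k y)
      = (LINT y|lborel. v (x + t *\<^sub>R y) * k (y - (s / t) *\<^sub>R e))" for s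
  proof -
    have "(LINT y|lborel. v (x + t *\<^sub>R y) * k (y - (s / t) *\<^sub>R e)) =
        (LINT y|lborel. v (x + t *\<^sub>R ((s / t) *\<^sub>R e + y)) * k ((s / t) *\<^sub>R e + y - (s / t) *\<^sub>R e))"
      by (rule lborel_integral_translate[symmetric]) measurable
    then show ?thesis using t by (simp add: algebra_simps)
  qed
  obtain C where C: "\<And>y. \<bar>k y\<bar> \<le> C" using bk by (auto simp: ball_kernel_def)
  have int: "integrable lborel (\<lambda>y. v (x + t *\<^sub>R y) * k (y - (s / t) *\<^sub>R e))" if "s \<in> ball 0 d" for s
  proof (rule integrable_bounded_ball[where R=2])
    show "\<bar>v (x + t *\<^sub>R y) * k (y - (s / t) *\<^sub>R e)\<bar> \<le> M * C" if "norm y \<le> 2" for y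
      using M[OF that] C[of "y - (s / t) *\<^sub>R e"] by (simp add: abs_mult mult_mono')
    show "v (x + t *\<^sub>R y) * k (y - (s / t) *\<^sub>R e) = 0" if y: "2 < norm y" for y
    proof -
      have "norm y \<le> norm (y - (s / t) *\<^sub>R e) + norm ((s / t) *\<^sub>R e)"
        by (metis add.commute diff_add_cancel norm_triangle_ineq)
      then have "norm (y - (s / t) *\<^sub>R e) \<ge> 1" using y small[OF \<open>s \<in> ball 0 d\<close>] by auto
      then show ?thesis using supp by simp
    qed
  qed measurable
  \<comment> \<open>The kernel may have a kink on the unit sphere. The sphere is a null set, so the
    difference quotients still converge almost everywhere, and the Lipschitz bound dominates
    them.\<close>
  have AE1: "AE y in lborel. norm (y::'a) \<noteq> 1"
  proof (rule AE_I'[where N="sphere 0 1"])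
    show "sphere (0::'a) 1 \<in> null_sets lborel"
      using negligible_sphere[of "0::'a" 1]
      by (auto simp: negligible_iff_null_sets null_sets_completion_iff)
  qed auto
  have "((\<lambda>s. ((LINT y|lborel. v (x + s *\<^sub>R e + t *\<^sub>R y) * k y) - (LINT y|lborel. v (x + 0 *\<^sub>R e + t *\<^sub>R y) * k y)) / (s - 0))
      \<longlongrightarrow> (LINT y|lborel. v (x + t *\<^sub>R y) * (- (1 / t) * k' y))) (at 0 within ball 0 d)"
    unfolding tendsto_at_iff_sequentially comp_def
  proof safe
    fix s :: "nat \<Rightarrow> real"
    assume s: "\<forall>i. s i \<in> ball 0 d - {0}" "s \<longlonglongrightarrow> 0"
    have eq: "((LINT y|lborel. v (x + s n *\<^sub>R e + t *\<^sub>R y) * k y) - (LINT y|lborel. v (x + 0 *\<^sub>R e + t *\<^sub>R y) * k y)) / (s n - 0)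
      = (LINT y|lborel. v (x + t *\<^sub>R y) * ((k (y - (s n / t) *\<^sub>R e) - k y) / s n))" for n
    proof -
      have "v (x + t *\<^sub>R y) * ((k (y - (s n / t) *\<^sub>R e) - k y) / s n)
          = (v (x + t *\<^sub>R y) * k (y - (s n / t) *\<^sub>R e) - v (x + t *\<^sub>R y) * k (y - (0 / t) *\<^sub>R e)) / s n" for y
        by (simp add: right_diff_distrib)
      moreover have *: "s n \<in> ball 0 d" "0 \<in> ball 0 d" using s d by auto
      ultimately show ?thesis
        by (simp only: integral_divide_zero Bochner_Integration.integral_diff[OF int[OF *(1)] int[OF *(2)]]
            shift diff_zero)
    qed
    show "(\<lambda>n. ((LINT y|lborel. v (x + s n *\<^sub>R e + t *\<^sub>R y) * k y) - (LINT y|lborel. v (x + 0 *\<^sub>R e + t *\<^sub>R y) * k y)) / (s n - 0))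
      \<longlonglongrightarrow> (LINT y|lborel. v (x + t *\<^sub>R y) * (- (1 / t) * k' y))"
      unfolding eq
    proof (rule integral_dominated_convergence[where w="\<lambda>y. (M * (L * norm e / t)) * indicator (cball 0 2) y"])
      show "integrable lborel (\<lambda>y. (M * (L * norm e / t)) * indicator (cball 0 2) y :: real)"
        by (intro integrable_mult_right integrable_real_indicator emeasure_lborel_cball_finite) auto
      show "AE y in lborel. norm (v (x + t *\<^sub>R y) * ((k (y - (s n / t) *\<^sub>R e) - k y) / s n))
          \<le> M * (L * norm e / t) * indicator (cball 0 2) y" for n
      proof (rule AE_I2)
        fix y :: 'a
        have sn: "s n \<in> ball 0 d" "s n \<noteq> 0" using s by auto
        show "norm (v (x + t *\<^sub>R y) * ((k (y - (s n / t) *\<^sub>R e) - k y) / s n))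
          \<le> M * (L * norm e / t) * indicator (cball 0 2) y"
        proof (cases "norm y \<le> 2")
          case True
          have "\<bar>k (y - (s n / t) *\<^sub>R e) - k y\<bar> \<le> L * norm ((s n / t) *\<^sub>R e)"
            using lip[of "y - (s n / t) *\<^sub>R e" y] by simp
          then have "\<bar>(k (y - (s n / t) *\<^sub>R e) - k y) / s n\<bar> \<le> L * norm e / t"
            using sn t by (simp add: field_simps)
          then have "\<bar>v (x + t *\<^sub>R y)\<bar> * \<bar>(k (y - (s n / t) *\<^sub>R e) - k y) / s n\<bar> \<le> M * (L * norm e / t)"
            using M[OF True] by (intro mult_mono') auto
          with True show ?thesis by (simp add: abs_mult)
        next
          case False
          have "norm y \<le> norm (y - (s n / t) *\<^sub>R e) + norm ((s n / t) *\<^sub>R e)"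
            by (metis add.commute diff_add_cancel norm_triangle_ineq)
          then have "norm (y - (s n / t) *\<^sub>R e) \<ge> 1" using False small[OF sn(1)] by auto
          then show ?thesis using supp[of y] supp[of "y - (s n / t) *\<^sub>R e"] False by simp
        qed
      qed
      show "AE y in lborel. (\<lambda>n. v (x + t *\<^sub>R y) * ((k (y - (s n / t) *\<^sub>R e) - k y) / s n))
          \<longlonglongrightarrow> v (x + t *\<^sub>R y) * (- (1 / t) * k' y)"
        using AE1
      proof eventually_elim
        fix y :: 'a assume "norm y \<noteq> 1"
        from D[OF this] have "((\<lambda>s. k (y + (- (s / t)) *\<^sub>R e)) has_real_derivative k' y * (- (1 / t))) (at 0)"
          by (intro DERIV_chain2[where f="\<lambda>s. k (y + s *\<^sub>R e)"]) (use t in \<open>auto intro!: derivative_eq_intros\<close>)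
        then have "((\<lambda>s. (k (y - (s / t) *\<^sub>R e) - k y) / s) \<longlongrightarrow> - (1 / t) * k' y) (at 0)"
          by (simp add: has_field_derivative_iff)
        then have "(\<lambda>n. (k (y - (s n / t) *\<^sub>R e) - k y) / s n) \<longlonglongrightarrow> - (1 / t) * k' y"
          using s unfolding tendsto_at_iff_sequentially comp_def by auto
        then show "(\<lambda>n. v (x + t *\<^sub>R y) * ((k (y - (s n / t) *\<^sub>R e) - k y) / s n))
          \<longlonglongrightarrow> v (x + t *\<^sub>R y) * (- (1 / t) * k' y)"
          by (intro tendsto_intros)
      qed
      show "(\<lambda>y. v (x + t *\<^sub>R y) * ((k (y - (s n / t) *\<^sub>R e) - k y) / s n)) \<in> borel_measurable lborel" for n
        by measurable
      show "(\<lambda>y. v (x + t *\<^sub>R y) * (- (1 / t) * k' y)) \<in> borel_measurable lborel"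
        using k' by measurable
    qed
  qed
  also have "(LINT y|lborel. v (x + t *\<^sub>R y) * (- (1 / t) * k' y)) = - (1 / t) * (LINT y|lborel. v (x + t *\<^sub>R y) * k' y)"
    by (simp add: mult.left_commute)
  finally show ?thesis
    using d by (simp add: has_field_derivative_iff at_within_open[of 0 "ball 0 d"])
qed

section \<open>Moments of the ball and the mean Laplacian\<close>

definition bump :: "'a::euclidean_space \<Rightarrow> real" where
  "bump y = max 0 (1 - (norm y)\<^sup>2)"

text \<open>As 1 - u^2 with u in [0, 1], differences of \<open>bump\<close> become differences of
  squares whose factors are both controlled; this gives the Lipschitz bound.\<close>

lemma bump_eq_min: "bump y = 1 - (min 1 (norm y))\<^sup>2"
  by (auto simp: bump_def min_def max_def abs_square_le_1 power_le_one_iff)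

lemma bump_bounds: "0 \<le> bump y" "bump y \<le> 1"
  by (auto simp: bump_def)

lemma bump_eq_0: "norm y \<ge> 1 \<Longrightarrow> bump y = 0"
  by (simp add: bump_eq_min)

lemma bump_lipschitz: "\<bar>bump y - bump z\<bar> \<le> 2 * norm (y - z)"
proof -
  let ?a = "min 1 (norm y)" and ?b = "min 1 (norm z)"
  have "bump y - bump z = - ((?a + ?b) * (?a - ?b))"
    unfolding bump_eq_min by (simp only: power2_eq_square) argo
  then have "\<bar>bump y - bump z\<bar> = \<bar>?a + ?b\<bar> * \<bar>?a - ?b\<bar>"
    by (simp only: abs_minus_cancel abs_mult)
  also have "\<dots> \<le> 2 * norm (y - z)"
  proof (intro mult_mono)
    show "\<bar>?a - ?b\<bar> \<le> norm (y - z)"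
      using norm_triangle_ineq3[of y z] by linarith
  qed (auto simp: min_def)
  finally show ?thesis .
qed

lemma bump_power_lipschitz: "\<bar>bump y ^ j - bump z ^ j\<bar> \<le> (2 * real j) * norm (y - z)"
proof -
  have "\<bar>bump y ^ j - bump z ^ j\<bar> \<le> real j * \<bar>bump y - bump z\<bar>"
    using norm_power_diff[of "bump y" "bump z" j] bump_bounds[of y] bump_bounds[of z] by simp
  also have "\<dots> \<le> real j * (2 * norm (y - z))"
    by (intro mult_left_mono bump_lipschitz) auto
  finally show ?thesis by simp
qed

lemma continuous_on_bump [continuous_intros]:
  "continuous_on S f \<Longrightarrow> continuous_on S (\<lambda>x. bump (f x))"
  unfolding bump_def by (intro continuous_intros)

lemma bump_measurable [measurable]: "bump \<in> borel_measurable borel"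
  by (intro borel_measurable_continuous_onI continuous_intros)

text \<open>The indicator is there for \<open>j = 0\<close>, where \<open>bump y ^ 0 = 1\<close>
  even outside the ball. In that case \<open>bump\<close> also has a kink on the unit sphere, hence
  the exclusion of norm 1.\<close>

lemma bump_power_deriv:
  fixes y e :: "'a::euclidean_space"
  assumes "norm y \<noteq> 1"
  shows "((\<lambda>s. bump (y + s *\<^sub>R e) ^ Suc j) has_real_derivative
     - 2 * real (Suc j) * (y \<bullet> e) * (bump y ^ j * indicator (ball 0 1) y)) (at 0)"
proof (cases "norm y < 1")
  case True
  have k: "bump y = 1 - y \<bullet> y"
    using True by (simp add: bump_eq_min power2_norm_eq_inner)
  have "((\<lambda>s. 1 - (y + s *\<^sub>R e) \<bullet> (y + s *\<^sub>R e)) has_real_derivative - 2 * (y \<bullet> e)) (at 0)"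
    by (auto intro!: derivative_eq_intros simp: has_field_derivative_def inner_commute fun_eq_iff)
  from DERIV_power[OF this, of "Suc j"]
  have "((\<lambda>s. (1 - (y + s *\<^sub>R e) \<bullet> (y + s *\<^sub>R e)) ^ Suc j) has_real_derivative
     - 2 * real (Suc j) * (y \<bullet> e) * (bump y ^ j * indicator (ball 0 1) y)) (at 0)"
    by (rule DERIV_cong) (use True in \<open>simp add: k algebra_simps\<close>)
  moreover have "\<forall>\<^sub>F s in nhds 0. bump (y + s *\<^sub>R e) ^ Suc j = (1 - (y + s *\<^sub>R e) \<bullet> (y + s *\<^sub>R e)) ^ Suc j"
  proof -
    have "((\<lambda>s. norm (y + s *\<^sub>R e)) \<longlongrightarrow> norm (y + 0 *\<^sub>R e)) (nhds 0)"
      by (intro tendsto_intros) (auto simp: filterlim_ident)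
    then have "\<forall>\<^sub>F s in nhds 0. norm (y + s *\<^sub>R e) < 1"
      using True by (intro order_tendstoD(2)) auto
    then show ?thesis
      by eventually_elim (simp add: bump_eq_min power2_norm_eq_inner)
  qed
  ultimately show ?thesis
    by (subst DERIV_cong_ev[OF refl _ refl]) auto
next
  case False
  have "((\<lambda>s. norm (y + s *\<^sub>R e)) \<longlongrightarrow> norm (y + 0 *\<^sub>R e)) (nhds 0)"
    by (intro tendsto_intros) (auto simp: filterlim_ident)
  then have "\<forall>\<^sub>F s in nhds 0. norm (y + s *\<^sub>R e) > 1"
    using False assms by (intro order_tendstoD(1)) auto
  then have "\<forall>\<^sub>F s in nhds 0. bump (y + s *\<^sub>R e) ^ Suc j = 0"
    by eventually_elim (simp add: bump_eq_min)
  then have "((\<lambda>s. bump (y + s *\<^sub>R e) ^ Suc j) has_real_derivative 0) (at 0)"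
    by (subst DERIV_cong_ev[OF refl _ refl, where g="\<lambda>_. 0"]) (auto elim: eventually_mono)
  with False show ?thesis by simp
qed

lemma ball_kernel_indicator: "ball_kernel (indicator (ball 0 1))"
  unfolding ball_kernel_def
  by (intro conjI borel_measurable_indicator exI[of _ 1]) (auto simp: indicator_def)

lemma ball_kernel_bump_power:
  assumes "j > 0"
  shows "ball_kernel (\<lambda>y. bump y ^ j)"
  unfolding ball_kernel_def
proof (intro conjI exI[of _ 1] allI impI)
  show "\<bar>bump y ^ j\<bar> \<le> 1" for y
    using bump_bounds[of y] by (simp add: power_le_one)
qed (use assms in \<open>auto simp: bump_eq_0\<close>)

definition unit_vol :: "'a::euclidean_space itself \<Rightarrow> real" where
  "unit_vol _ = measure lborel (ball (0::'a) 1)"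

lemma unit_vol_pos: "unit_vol TYPE('a::euclidean_space) > 0"
  unfolding unit_vol_def by (simp add: content_ball_pos)

lemma integral_indicator_unit_ball:
  "(LINT y|lborel. indicator (ball (0::'a::euclidean_space) 1) y) = unit_vol TYPE('a)"
  by (simp add: unit_vol_def)

text \<open>Integration by parts on the ball: since \<open>bump\<close> vanishes on the sphere there
  is no surface term. For an explicit \<open>v\<close> the left side is known, and the formula
  computes moments; for a smooth \<open>v\<close> it relates the weights \<open>Suc j\<close> and
  \<open>j\<close>.\<close>

lemma bump_kernel_derivative:
  fixes v :: "'a::euclidean_space \<Rightarrow> real"
  assumes v: "continuous_on UNIV v" and t: "t > 0"
  shows "((\<lambda>s. LINT y|lborel. v (x + s *\<^sub>R e + t *\<^sub>R y) * bump y ^ Suc j) has_real_derivative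
     (2 * real (Suc j) / t) * (LINT y|lborel. v (x + t *\<^sub>R y) * ((y \<bullet> e) * (bump y ^ j * indicator (ball 0 1) y)))) (at 0)"
proof -
  let ?k' = "\<lambda>y. - 2 * real (Suc j) * (y \<bullet> e) * (bump y ^ j * indicator (ball 0 1) y)"
  have "((\<lambda>s. LINT y|lborel. v (x + s *\<^sub>R e + t *\<^sub>R y) * bump y ^ Suc j) has_real_derivative
     - (1 / t) * (LINT y|lborel. v (x + t *\<^sub>R y) * ?k' y)) (at 0)"
    by (rule kernel_convolution_derivative[OF v t bump_power_lipschitz _ _ bump_power_deriv])
      (auto simp: bump_eq_0 intro!: borel_measurable_times borel_measurable_indicator)
  also have "(LINT y|lborel. v (x + t *\<^sub>R y) * ?k' y) =
      (LINT y|lborel. (- 2 * real (Suc j)) * (v (x + t *\<^sub>R y) * ((y \<bullet> e) * (bump y ^ j * indicator (ball 0 1) y))))"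
    by (simp add: algebra_simps)
  also have "\<dots> = - 2 * real (Suc j) * (LINT y|lborel. v (x + t *\<^sub>R y) * ((y \<bullet> e) * (bump y ^ j * indicator (ball 0 1) y)))"
    by (rule integral_mult_right_zero)
  finally have "((\<lambda>s. LINT y|lborel. v (x + s *\<^sub>R e + t *\<^sub>R y) * bump y ^ Suc j) has_real_derivative
     - (1 / t) * (- 2 * real (Suc j) * (LINT y|lborel. v (x + t *\<^sub>R y) * ((y \<bullet> e) * (bump y ^ j * indicator (ball 0 1) y))))) (at 0)" .
  moreover have "- (1 / t) * (- 2 * a * c) = (2 * a / t) * c" for a c :: real by simp
  ultimately show ?thesis by (simp only:)
qed

text \<open>Translating the constant 1 does not change its average with weight \<open>bump\<close>,
  so the derivative, which is a multiple of the first moment, is 0.\<close>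

lemma ball_first_moment:
  fixes e :: "'a::euclidean_space"
  shows "(LINT y|lborel. (y \<bullet> e) * indicator (ball 0 1) y) = 0"
  using DERIV_unique[OF bump_kernel_derivative[of "\<lambda>_. 1" 1 0 e 0] DERIV_const] by simp

text \<open>The translated average of a linear function is affine in the shift. Comparing its slope
  with the kernel formula for weight \<open>bump\<close> gives the second moments without any
  integration in coordinates.\<close>

lemma ball_second_moment_aux:
  fixes a e :: "'a::euclidean_space"
  shows "(LINT y|lborel. (y \<bullet> a) * (y \<bullet> e) * indicator (ball 0 1) y) = (e \<bullet> a) / 2 * (LINT y|lborel. bump (y::'a))"
proof -
  have i: "integrable lborel (\<lambda>y::'a. f y * bump y)" if "continuous_on UNIV f" for f
    using kernel_integrable[OF that ball_kernel_bump_power[of 1]] by simp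
  have "(LINT y|lborel. ((0 + s *\<^sub>R e + 1 *\<^sub>R y) \<bullet> a) * bump y ^ Suc 0)
      = s * ((e \<bullet> a) * (LINT y|lborel. bump (y::'a))) + (LINT y|lborel. (y \<bullet> a) * bump y)" for s
  proof -
    have "(LINT y|lborel. ((0 + s *\<^sub>R e + 1 *\<^sub>R y) \<bullet> a) * bump y ^ Suc 0)
      = (LINT y|lborel. (s * (e \<bullet> a)) * bump y + (y \<bullet> a) * bump y)"
      by (simp add: algebra_simps inner_add_left)
    also have "\<dots> = (LINT y|lborel. (s * (e \<bullet> a)) * bump (y::'a)) + (LINT y|lborel. (y \<bullet> a) * bump y)"
      by (intro Bochner_Integration.integral_add i continuous_intros)
    finally show ?thesis by simp
  qed
  then have "((\<lambda>s. LINT y|lborel. ((0 + s *\<^sub>R e + 1 *\<^sub>R y) \<bullet> a) * bump y ^ Suc 0) has_real_derivative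
      (e \<bullet> a) * (LINT y|lborel. bump (y::'a))) (at 0)"
    by (auto intro!: derivative_eq_intros)
  from DERIV_unique[OF this bump_kernel_derivative[of "\<lambda>y. y \<bullet> a" 1 0 e 0]]
  show ?thesis by (auto simp: continuous_intros algebra_simps)
qed

text \<open>On the unit ball \<open>bump\<close> is 1 minus the sum of the squared coordinates, and
  each second moment is half of the integral K sought. Hence K = w - (m / 2) K, with w the volume of
  the unit ball, and this determines K.\<close>

lemma integral_bump:
  "(LINT y|lborel. bump (y::'a::euclidean_space)) = 2 * unit_vol TYPE('a) / (DIM('a) + 2)"
proof -
  have i: "integrable lborel (\<lambda>y::'a. f y * indicator (ball 0 1) y)" if "continuous_on UNIV f" for f :: "'a \<Rightarrow> real"
    using kernel_integrable[OF that ball_kernel_indicator] .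
  have "bump y = 1 * indicator (ball 0 1) y - (\<Sum>b\<in>Basis. (y \<bullet> b) * (y \<bullet> b) * indicator (ball 0 1) y)" for y :: 'a
    using euclidean_inner[of y y] by (auto simp: indicator_def bump_eq_min power2_norm_eq_inner)
  then have "(LINT y|lborel. bump (y::'a)) = (LINT y|lborel. 1 * indicator (ball 0 1) y - (\<Sum>b\<in>Basis. (y \<bullet> b) * (y \<bullet> b) * indicator (ball 0 1) (y::'a)))"
    by (simp only:)
  also have "\<dots> = (LINT y|lborel. 1 * indicator (ball (0::'a) 1) y)
      - (LINT y|lborel. (\<Sum>b\<in>Basis. (y \<bullet> b) * (y \<bullet> b) * indicator (ball (0::'a) 1) y))"
    by (intro Bochner_Integration.integral_diff Bochner_Integration.integrable_sum i continuous_intros)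
  also have "\<dots> = unit_vol TYPE('a)
      - (\<Sum>b\<in>Basis. LINT y|lborel. (y \<bullet> b) * (y \<bullet> b) * indicator (ball (0::'a) 1) y)"
    by (subst Bochner_Integration.integral_sum)
      (intro i continuous_intros, simp only: mult_1 integral_indicator_unit_ball)
  also have "(\<Sum>b\<in>Basis. LINT y|lborel. (y \<bullet> b) * (y \<bullet> b) * indicator (ball (0::'a) 1) y)
      = (\<Sum>b\<in>(Basis::'a set). 1 / 2 * (LINT y|lborel. bump (y::'a)))"
    by (intro sum.cong) (auto simp: ball_second_moment_aux)
  finally show ?thesis by (simp add: field_simps)
qed

lemma ball_second_moment:
  fixes a e :: "'a::euclidean_space"
  shows "(LINT y|lborel. (y \<bullet> a) * (y \<bullet> e) * indicator (ball 0 1) y) = (e \<bullet> a) * unit_vol TYPE('a) / (DIM('a) + 2)"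
  by (simp add: ball_second_moment_aux integral_bump)

text \<open>The domain of integration is fixed and \<open>r\<close> enters only through the argument
  of \<open>f\<close>. This makes continuity in \<open>r\<close> an instance of the kernel lemmas
  and gives the value \<open>f x\<close> at \<open>r = 0\<close>.\<close>

definition ball_avg :: "('a::euclidean_space \<Rightarrow> real) \<Rightarrow> 'a \<Rightarrow> real \<Rightarrow> real" where
  "ball_avg f x r = (LINT y|lborel. f (x + r *\<^sub>R y) * indicator (ball 0 1) y) / unit_vol TYPE('a)"

text \<open>A generalized Laplacian of Blaschke-Privalov type. The normalisation comes from the
  second moments of the ball: for smooth f the average is f x + r^2 Lap f x / (2 (m + 2)) + o(r^2).
  It is a relation because existence of the limit is part of the claim.\<close>

definition has_mean_laplacian :: "('a::euclidean_space \<Rightarrow> real) \<Rightarrow> 'a \<Rightarrow> real \<Rightarrow> bool" where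
  "has_mean_laplacian f x l \<longleftrightarrow>
     ((\<lambda>r. (ball_avg f x r - f x) / r\<^sup>2) \<longlongrightarrow> l / (2 * (DIM('a) + 2))) (at_right 0)"

lemma ball_avg_integrable:
  fixes f :: "'a::euclidean_space \<Rightarrow> real"
  assumes "continuous_on UNIV f"
  shows "integrable lborel (\<lambda>y. f (x + r *\<^sub>R y) * indicator (ball 0 1) y)"
  by (intro kernel_integrable ball_kernel_indicator continuous_on_compose2[OF assms] continuous_intros) auto

lemma has_mean_laplacian_add:
  assumes "has_mean_laplacian f x l" "has_mean_laplacian g x m"
    and "continuous_on UNIV f" "continuous_on UNIV g"
  shows "has_mean_laplacian (\<lambda>x. f x + g x) x (l + m)"
proof -
  have "ball_avg (\<lambda>x. f x + g x) x r = ball_avg f x r + ball_avg g x r" for r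
    using assms(3,4) by (simp add: ball_avg_def distrib_right ball_avg_integrable add_divide_distrib)
  then show ?thesis
    using tendsto_add[OF assms(1,2)[unfolded has_mean_laplacian_def]]
    unfolding has_mean_laplacian_def by (simp flip: add_divide_distrib add: algebra_simps)
qed

lemma has_mean_laplacian_cmult:
  assumes "has_mean_laplacian f x l"
  shows "has_mean_laplacian (\<lambda>x. c * f x) x (c * l)"
proof -
  have "ball_avg (\<lambda>x. c * f x) x r = c * ball_avg f x r" for r
    by (simp add: ball_avg_def mult.assoc)
  then show ?thesis
    using tendsto_mult_left[OF assms[unfolded has_mean_laplacian_def], of c]
    unfolding has_mean_laplacian_def by (simp add: right_diff_distrib)
qed

lemma has_mean_laplacian_unique:
  assumes "has_mean_laplacian f x l" "has_mean_laplacian f x m"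
  shows "l = m"
  using tendsto_unique[OF _ assms[unfolded has_mean_laplacian_def]] by simp

lemma ball_avg_mono:
  assumes "continuous_on UNIV f" "continuous_on UNIV g" "r \<ge> 0"
    and "\<And>y. norm (y - x) \<le> r \<Longrightarrow> f y \<le> g y"
  shows "ball_avg f x r \<le> ball_avg g x r"
  unfolding ball_avg_def
proof (intro divide_right_mono integral_mono ball_avg_integrable assms)
  fix y
  show "f (x + r *\<^sub>R y) * indicator (ball 0 1) y \<le> g (x + r *\<^sub>R y) * indicator (ball 0 1) y"
  proof (cases "y \<in> ball 0 1")
    case True
    then have "r * norm y \<le> r * 1" using assms(3) by (intro mult_left_mono) auto
    with True assms(3,4) show ?thesis by simp
  qed auto
qed (use unit_vol_pos in \<open>auto intro: less_imp_le\<close>)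

lemma ball_avg_const [simp]: "ball_avg (\<lambda>_. c) x r = c"
  using unit_vol_pos[where ?'a='a] by (simp add: ball_avg_def unit_vol_def)

lemma has_mean_laplacian_local_max:
  assumes f: "continuous_on UNIV f" and l: "has_mean_laplacian f x l"
    and d: "d > 0" "\<And>y. dist y x < d \<Longrightarrow> f y \<le> f x"
  shows "l \<le> 0"
proof -
  have "\<forall>\<^sub>F r in at_right 0. (ball_avg f x r - f x) / r\<^sup>2 \<le> 0"
  proof (rule eventually_at_rightI[of 0 d])
    fix r assume r: "r \<in> {0<..<d}"
    have "ball_avg f x r \<le> ball_avg (\<lambda>_. f x) x r"
      using r d by (intro ball_avg_mono f) (auto simp: dist_norm)
    then show "(ball_avg f x r - f x) / r\<^sup>2 \<le> 0"
      using r by (simp add: divide_le_0_iff)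
  qed fact
  with l have "l / (2 * (DIM('a) + 2)) \<le> 0"
    unfolding has_mean_laplacian_def by (intro tendsto_upperbound) auto
  then show ?thesis by (simp add: divide_le_0_iff)
qed

text \<open>A maximum over the closed ball exists by compactness; if it exceeded \<open>M\<close> it
  would be interior, where \<open>l\<close> is both positive and nonpositive. Positivity is asked
  only where \<open>f\<close> exceeds \<open>M\<close>, so that a term mu^2 f can supply it.\<close>

lemma mean_laplacian_comparison:
  fixes f :: "'a::euclidean_space \<Rightarrow> real"
  assumes f: "continuous_on UNIV f"
    and l: "\<And>x. x \<in> ball z R \<Longrightarrow> has_mean_laplacian f x (l x)"
    and pos: "\<And>x. x \<in> ball z R \<Longrightarrow> f x > M \<Longrightarrow> l x > 0"
    and bd: "\<And>x. x \<in> sphere z R \<Longrightarrow> f x \<le> M"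
    and x: "x \<in> cball z R"
  shows "f x \<le> M"
proof -
  obtain p where p: "p \<in> cball z R" "\<And>y. y \<in> cball z R \<Longrightarrow> f y \<le> f p"
    using continuous_attains_sup[of "cball z R" f] x continuous_on_subset[OF f]
    by (metis compact_cball empty_iff subset_UNIV)
  have "f p \<le> M"
  proof (rule ccontr)
    assume "\<not> f p \<le> M"
    with bd p(1) have pb: "p \<in> ball z R" by force
    then obtain d where d: "d > 0" "ball p d \<subseteq> ball z R"
      using open_ball[of z R] by (meson openE)
    have "l p \<le> 0"
    proof (rule has_mean_laplacian_local_max[OF f l[OF pb] d(1)])
      fix y assume "dist y p < d"
      then have "y \<in> ball z R" using d(2) by (auto simp: dist_commute)
      then show "f y \<le> f p" by (intro p(2)) auto
    qed
    with pos[OF pb] \<open>\<not> f p \<le> M\<close> show False by auto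
  qed
  with p(2)[OF x] show ?thesis by simp
qed

text \<open>Taylor's formula with Peano remainder, the gradient being differentiable at
  \<open>x\<close> alone. Subtracting the quadratic polynomial along the segment leaves a function
  whose derivative pairs \<open>y\<close> with the first-order error of the gradient; the mean value
  inequality bounds the remainder.\<close>

lemma second_order_taylor:
  fixes f :: "'a::euclidean_space \<Rightarrow> real"
  assumes S: "open S" "x \<in> S"
    and f: "\<And>z. z \<in> S \<Longrightarrow> (f has_derivative (\<lambda>h. \<Sum>b\<in>Basis. (h \<bullet> b) * G b z)) (at z)"
    and G: "\<And>b. b \<in> Basis \<Longrightarrow> (G b has_derivative H b) (at x)"
    and e: "e > 0"
  obtains d where "d > 0" "\<And>y. norm y < d \<Longrightarrow>
    \<bar>f (x + y) - f x - (\<Sum>b\<in>Basis. (y \<bullet> b) * G b x) - (\<Sum>b\<in>Basis. (y \<bullet> b) * H b y) / 2\<bar> \<le> e * (norm y)\<^sup>2"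
proof -
  \<comment> \<open>The error is shared equally among the coordinates of the gradient.\<close>
  define e' where "e' = e / DIM('a)"
  have e': "e' > 0" using e by (simp add: e'_def)
  obtain d0 where d0: "d0 > 0" "ball x d0 \<subseteq> S" using S by (meson openE)
  have "\<exists>d>0. \<forall>z. norm z < d \<longrightarrow> \<bar>G b (x + z) - G b x - H b z\<bar> \<le> e' * norm z" if "b \<in> Basis" for b
    using G[OF that] e' unfolding has_derivative_at_alt
    by (metis add_diff_cancel_left' real_norm_def)
  then obtain D where D: "\<And>b. b \<in> Basis \<Longrightarrow> D b > 0"
    "\<And>b z. b \<in> Basis \<Longrightarrow> norm z < D b \<Longrightarrow> \<bar>G b (x + z) - G b x - H b z\<bar> \<le> e' * norm z"
    by metis
  define d where "d = Min (insert d0 (D ` Basis))"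
  have d: "d > 0" "d \<le> d0" "\<And>b. b \<in> Basis \<Longrightarrow> d \<le> D b"
    using d0 D(1) unfolding d_def by (simp_all add: Min_gr_iff min.coboundedI2)
  show ?thesis
  proof
    fix y :: 'a assume y: "norm y < d"
    let ?\<phi> = "\<lambda>s. f (x + s *\<^sub>R y) - s * (\<Sum>b\<in>Basis. (y \<bullet> b) * G b x) - s\<^sup>2 * ((\<Sum>b\<in>Basis. (y \<bullet> b) * H b y) / 2)"
    let ?\<phi>' = "\<lambda>s. \<Sum>b\<in>Basis. (y \<bullet> b) * (G b (x + s *\<^sub>R y) - G b x - H b (s *\<^sub>R y))"
    have sy: "norm (s *\<^sub>R y) \<le> norm y" if "s \<in> {0..1}" for s
      using that by (simp add: mult_left_le_one_le)
    have der: "(?\<phi> has_real_derivative ?\<phi>' s) (at s)" if "s \<in> {0..1}" for s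
    proof -
      have "x + s *\<^sub>R y \<in> S" using sy[OF that] y d d0 by (auto simp: dist_norm subset_eq)
      from f[OF this] have 1: "(f has_derivative (\<lambda>h. \<Sum>b\<in>Basis. (h \<bullet> b) * G b (x + s *\<^sub>R y)))
         (at (x + s *\<^sub>R y) within (\<lambda>s. x + s *\<^sub>R y) ` UNIV)"
        by (rule has_derivative_at_withinI)
      have "((f \<circ> (\<lambda>s. x + s *\<^sub>R y)) has_derivative
         ((\<lambda>h. \<Sum>b\<in>Basis. (h \<bullet> b) * G b (x + s *\<^sub>R y)) \<circ> (\<lambda>h. h *\<^sub>R y))) (at s)"
        by (rule diff_chain_within[OF _ 1]) (auto intro!: derivative_eq_intros)
      then have "((\<lambda>s. f (x + s *\<^sub>R y)) has_real_derivative (\<Sum>b\<in>Basis. (y \<bullet> b) * G b (x + s *\<^sub>R y))) (at s)"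
        unfolding comp_def
        by (rule has_derivative_imp_has_field_derivative) (simp add: sum_distrib_left mult_ac)
      then have "(?\<phi> has_real_derivative (\<Sum>b\<in>Basis. (y \<bullet> b) * G b (x + s *\<^sub>R y))
          - (\<Sum>b\<in>Basis. (y \<bullet> b) * G b x) - s * (\<Sum>b\<in>Basis. (y \<bullet> b) * H b y)) (at s)"
        by (auto intro!: derivative_eq_intros)
      also have "(\<Sum>b\<in>Basis. (y \<bullet> b) * G b (x + s *\<^sub>R y))
          - (\<Sum>b\<in>Basis. (y \<bullet> b) * G b x) - s * (\<Sum>b\<in>Basis. (y \<bullet> b) * H b y) = ?\<phi>' s"
        using has_derivative_linear[OF G] 
        by (simp add: linear_cmul sum_distrib_left right_diff_distrib sum_subtractf mult_ac)
      finally show ?thesis .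
    qed
    have bnd: "norm (?\<phi>' s) \<le> e * (norm y)\<^sup>2" if s: "s \<in> {0..1}" for s
    proof -
      have "norm (?\<phi>' s) \<le> (\<Sum>b\<in>(Basis::'a set). norm y * (e' * norm y))"
        unfolding real_norm_def
      proof (rule order_trans[OF sum_abs sum_mono])
        fix b :: 'a assume b: "b \<in> Basis"
        have "\<bar>G b (x + s *\<^sub>R y) - G b x - H b (s *\<^sub>R y)\<bar> \<le> e' * norm (s *\<^sub>R y)"
          using sy[OF s] y d(3)[OF b] by (intro D(2) b) auto
        also have "\<dots> \<le> e' * norm y" using sy[OF s] e' by (intro mult_left_mono) auto
        finally show "\<bar>(y \<bullet> b) * (G b (x + s *\<^sub>R y) - G b x - H b (s *\<^sub>R y))\<bar> \<le> norm y * (e' * norm y)"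
          unfolding abs_mult using b by (intro mult_mono' Basis_le_norm) auto
      qed
      then show ?thesis by (simp add: e'_def power2_eq_square mult_ac)
    qed
    have "norm (?\<phi> 1 - ?\<phi> 0) \<le> e * (norm y)\<^sup>2 * norm (1 - 0 :: real)"
    proof (rule field_differentiable_bound[where S="{0..1}" and f'="?\<phi>'"])
      show "(?\<phi> has_real_derivative ?\<phi>' s) (at s within {0..1})" if "s \<in> {0..1}" for s
        using der[OF that] by (rule has_field_derivative_at_within)
      show "norm (?\<phi>' s) \<le> e * (norm y)\<^sup>2" if "s \<in> {0..1}" for s
        using that by (rule bnd)
    qed auto
    then show "\<bar>f (x + y) - f x - (\<Sum>b\<in>Basis. (y \<bullet> b) * G b x) - (\<Sum>b\<in>Basis. (y \<bullet> b) * H b y) / 2\<bar> \<le> e * (norm y)\<^sup>2"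
      by simp
  qed (use d in auto)
qed

text \<open>Average the Taylor expansion over the ball: the linear term vanishes with the first
  moments, the second moments keep the diagonal of \<open>H\<close>, and the remainder is at most
  \<open>e / 2\<close> times r^2.\<close>

lemma has_mean_laplacian_smooth:
  fixes f :: "'a::euclidean_space \<Rightarrow> real"
  assumes cf: "continuous_on UNIV f" and S: "open S" "x \<in> S"
    and f: "\<And>z. z \<in> S \<Longrightarrow> (f has_derivative (\<lambda>h. \<Sum>b\<in>Basis. (h \<bullet> b) * G b z)) (at z)"
    and G: "\<And>b. b \<in> Basis \<Longrightarrow> (G b has_derivative (\<lambda>h. \<Sum>a\<in>Basis. (h \<bullet> a) * H b a)) (at x)"
  shows "has_mean_laplacian f x (\<Sum>b\<in>Basis. H b b)"
proof -
  let ?w = "unit_vol TYPE('a)" and ?L = "(\<Sum>b\<in>Basis. H b b) / (2 * (DIM('a) + 2))"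
  let ?i = "indicator (ball (0::'a) 1) :: 'a \<Rightarrow> real"
  let ?Q = "\<lambda>y. \<Sum>b\<in>Basis. (y \<bullet> b) * (\<Sum>a\<in>Basis. (y \<bullet> a) * H b a)"
  have i: "integrable lborel (\<lambda>y. g y * ?i y)" if "continuous_on UNIV g" for g :: "'a \<Rightarrow> real"
    using kernel_integrable[OF that ball_kernel_indicator] .
  have Q: "(LINT y|lborel. ?Q y * ?i y) = ?w / (DIM('a) + 2) * (\<Sum>b\<in>Basis. H b b)"
  proof -
    have "(LINT y|lborel. ?Q y * ?i y) = (LINT y|lborel. (\<Sum>b\<in>Basis. \<Sum>a\<in>Basis. H b a * ((y \<bullet> a) * (y \<bullet> b) * ?i y)))"
      by (simp add: sum_distrib_left sum_distrib_right mult_ac)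
    also have "\<dots> = (\<Sum>b\<in>Basis. \<Sum>a\<in>Basis. H b a * (LINT y|lborel. (y \<bullet> a) * (y \<bullet> b) * ?i y))"
      by (intro Bochner_Integration.integral_sum[THEN trans] sum.cong refl integral_mult_right_zero
          Bochner_Integration.integrable_sum integrable_mult_right i continuous_intros)
    also have "\<dots> = (\<Sum>b\<in>(Basis::'a set). \<Sum>a\<in>(Basis::'a set). if a = b then H b b * ?w / (DIM('a) + 2) else 0)"
      by (intro sum.cong refl) (auto simp: ball_second_moment inner_Basis)
    finally show ?thesis by (simp add: sum_distrib_left sum_divide_distrib mult_ac)
  qed
  have L1: "(LINT y|lborel. (\<Sum>b\<in>Basis. (y \<bullet> b) * G b x) * ?i y) = 0"
  proof -
    have "(LINT y|lborel. (\<Sum>b\<in>Basis. (y \<bullet> b) * G b x) * ?i y) = (LINT y|lborel. (\<Sum>b\<in>Basis. G b x * ((y \<bullet> b) * ?i y)))"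
      by (simp add: sum_distrib_left sum_distrib_right mult_ac)
    also have "\<dots> = (\<Sum>b\<in>Basis. G b x * (LINT y|lborel. (y \<bullet> b) * ?i y))"
      by (subst Bochner_Integration.integral_sum)
        (auto intro!: i integrable_mult_right continuous_intros)
    finally show ?thesis by (simp add: ball_first_moment)
  qed
  have "((\<lambda>r. (ball_avg f x r - f x) / r\<^sup>2) \<longlongrightarrow> ?L) (at_right 0)"
    unfolding tendsto_iff
  proof safe
    fix e :: real assume e: "e > 0"
    obtain d where d: "d > 0" "\<And>y. norm y < d \<Longrightarrow>
      \<bar>f (x + y) - f x - (\<Sum>b\<in>Basis. (y \<bullet> b) * G b x) - ?Q y / 2\<bar> \<le> (e/2) * (norm y)\<^sup>2"
      using second_order_taylor[OF S f G, of "e/2"] e by (auto simp: half_gt_zero)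
    show "\<forall>\<^sub>F r in at_right 0. dist ((ball_avg f x r - f x) / r\<^sup>2) ?L < e"
    proof (rule eventually_at_rightI[of 0 d])
      fix r assume "r \<in> {0<..<d}"
      then have r: "r > 0" "r < d" by auto
      have "(LINT y|lborel. (f (x + r *\<^sub>R y) - f x - r * (\<Sum>b\<in>Basis. (y \<bullet> b) * G b x) - r\<^sup>2 / 2 * ?Q y) * ?i y)
        = (LINT y|lborel. f (x + r *\<^sub>R y) * ?i y - f x * ?i y - r * ((\<Sum>b\<in>Basis. (y \<bullet> b) * G b x) * ?i y) - r\<^sup>2 / 2 * (?Q y * ?i y))"
        by (simp add: left_diff_distrib mult.assoc)
      also have "\<dots> = (LINT y|lborel. f (x + r *\<^sub>R y) * ?i y) - (LINT y|lborel. f x * ?i y)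
         - (LINT y|lborel. r * ((\<Sum>b\<in>Basis. (y \<bullet> b) * G b x) * ?i y)) - (LINT y|lborel. r\<^sup>2 / 2 * (?Q y * ?i y))"
        by (intro Bochner_Integration.integral_diff[THEN trans] arg_cong2[where f="(-)"] refl
             Bochner_Integration.integrable_diff integrable_mult_right i continuous_intros ball_avg_integrable cf)
      also have "\<dots> = ?w * ball_avg f x r - f x * ?w - r\<^sup>2 * ?w * ?L"
        using unit_vol_pos[where ?'a='a]
        by (simp only: integral_mult_right_zero L1 Q integral_indicator_unit_ball) (simp add: ball_avg_def field_simps)
      finally have eq: "?w * (ball_avg f x r - f x - r\<^sup>2 * ?L) =
        (LINT y|lborel. (f (x + r *\<^sub>R y) - f x - r * (\<Sum>b\<in>Basis. (y \<bullet> b) * G b x) - r\<^sup>2 / 2 * ?Q y) * ?i y)"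
        by (simp add: algebra_simps)
      have "\<bar>?w * (ball_avg f x r - f x - r\<^sup>2 * ?L)\<bar> \<le> (LINT y|lborel. (e / 2 * r\<^sup>2) * ?i y)"
        unfolding eq real_norm_def[symmetric]
      proof (rule Bochner_Integration.integral_norm_bound_integral)
        show "integrable lborel (\<lambda>y. (f (x + r *\<^sub>R y) - f x - r * (\<Sum>b\<in>Basis. (y \<bullet> b) * G b x) - r\<^sup>2 / 2 * ?Q y) * ?i y)"
          by (intro i continuous_intros continuous_on_compose2[OF cf]) auto
        show "integrable lborel (\<lambda>y. (e / 2 * r\<^sup>2) * ?i y)"
          by (intro i continuous_intros)
        fix y :: 'a
        show "norm ((f (x + r *\<^sub>R y) - f x - r * (\<Sum>b\<in>Basis. (y \<bullet> b) * G b x) - r\<^sup>2 / 2 * ?Q y) * ?i y) \<le> (e / 2 * r\<^sup>2) * ?i y"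
        proof (cases "norm y < 1")
          case True
          have ny: "norm (r *\<^sub>R y) \<le> r" using True r by (simp add: mult_left_le)
          have "\<bar>f (x + r *\<^sub>R y) - f x - (\<Sum>b\<in>Basis. ((r *\<^sub>R y) \<bullet> b) * G b x) - ?Q (r *\<^sub>R y) / 2\<bar> \<le> (e/2) * (norm (r *\<^sub>R y))\<^sup>2"
            by (intro d(2) le_less_trans[OF ny r(2)])
          also have "\<dots> \<le> (e / 2) * r\<^sup>2"
            using ny e by (intro mult_left_mono power_mono) auto
          also have "(\<Sum>b\<in>Basis. ((r *\<^sub>R y) \<bullet> b) * G b x) = r * (\<Sum>b\<in>Basis. (y \<bullet> b) * G b x)"
            by (simp add: sum_distrib_left mult_ac)
          also have "?Q (r *\<^sub>R y) = r\<^sup>2 * ?Q y"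
            by (simp add: sum_distrib_left mult_ac power2_eq_square)
          finally show ?thesis using True by simp
        qed auto
      qed
      then have "?w * \<bar>ball_avg f x r - f x - r\<^sup>2 * ?L\<bar> \<le> ?w * (e / 2 * r\<^sup>2)"
        unfolding integral_mult_right_zero integral_indicator_unit_ball abs_mult abs_of_pos[OF unit_vol_pos]
        by (simp only: mult.commute)
      then have "\<bar>ball_avg f x r - f x - r\<^sup>2 * ?L\<bar> \<le> e / 2 * r\<^sup>2"
        using unit_vol_pos[where ?'a='a] by (simp only: mult_le_cancel_left_pos)
      moreover have "(ball_avg f x r - f x) / r\<^sup>2 - ?L = (ball_avg f x r - f x - r\<^sup>2 * ?L) / r\<^sup>2"
        using r by (simp add: diff_divide_distrib)
      ultimately have "\<bar>(ball_avg f x r - f x) / r\<^sup>2 - ?L\<bar> \<le> e / 2"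
        using r by (simp add: pos_divide_le_eq)
      with e show "dist ((ball_avg f x r - f x) / r\<^sup>2) ?L < e" by (simp add: dist_real_def)
    qed fact
  qed
  then show ?thesis by (simp add: has_mean_laplacian_def)
qed

section \<open>Polynomials and the Poisson equation\<close>

lemma partial_deriv_eq:
  assumes "(f has_derivative f') (at x)"
  shows "partial_deriv b f x = f' b"
proof -
  have "((f \<circ> (\<lambda>t. x + t *\<^sub>R b)) has_derivative (f' \<circ> (\<lambda>h. h *\<^sub>R b))) (at 0)"
    by (rule diff_chain_within[where s=UNIV, OF _ has_derivative_at_withinI])
      (use assms in \<open>auto intro!: derivative_eq_intros\<close>)
  then have "((\<lambda>t. f (x + t *\<^sub>R b)) has_real_derivative f' b) (at 0)"
    unfolding comp_def
    by (rule has_derivative_imp_has_field_derivative)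
      (simp add: linear_cmul[OF has_derivative_linear[OF assms]])
  then show ?thesis
    unfolding partial_deriv_def by (rule DERIV_imp_deriv)
qed

lemma has_derivative_partials:
  assumes "f differentiable at x"
  shows "(f has_derivative (\<lambda>h. \<Sum>b\<in>Basis. (h \<bullet> b) * partial_deriv b f x)) (at x)"
proof -
  obtain f' where f': "(f has_derivative f') (at x)"
    using assms by (auto simp: differentiable_def)
  have "f' h = (\<Sum>b\<in>Basis. (h \<bullet> b) * partial_deriv b f x)" for h
  proof -
    have l: "linear f'" using f' by (rule has_derivative_linear)
    have "f' h = f' (\<Sum>b\<in>Basis. (h \<bullet> b) *\<^sub>R b)" by (simp add: euclidean_representation)
    also have "\<dots> = (\<Sum>b\<in>Basis. (h \<bullet> b) * partial_deriv b f x)"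
      by (simp add: linear_sum[OF l] linear_cmul[OF l] partial_deriv_eq[OF f'])
    finally show ?thesis .
  qed
  then have "f' = (\<lambda>h. \<Sum>b\<in>Basis. (h \<bullet> b) * partial_deriv b f x)" by blast
  with f' show ?thesis by simp
qed

lemma partial_deriv_const [simp]: "partial_deriv b (\<lambda>_. c) x = 0"
  by (rule partial_deriv_eq) (rule has_derivative_const)

lemma partial_deriv_inner [simp]: "partial_deriv b (\<lambda>x. x \<bullet> c) x = b \<bullet> c"
  by (rule partial_deriv_eq) (auto intro!: derivative_eq_intros)

lemma partial_deriv_add:
  assumes "f differentiable at x" "g differentiable at x"
  shows "partial_deriv b (\<lambda>x. f x + g x) x = partial_deriv b f x + partial_deriv b g x"
proof -
  obtain f' g' where "(f has_derivative f') (at x)" "(g has_derivative g') (at x)"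
    using assms by (auto simp: differentiable_def)
  then show ?thesis
    by (simp add: partial_deriv_eq[OF has_derivative_add] partial_deriv_eq)
qed

lemma partial_deriv_mult:
  assumes "f differentiable at x" "g differentiable at x"
  shows "partial_deriv b (\<lambda>x. f x * g x) x = partial_deriv b f x * g x + f x * partial_deriv b g x"
proof -
  obtain f' g' where "(f has_derivative f') (at x)" "(g has_derivative g') (at x)"
    using assms by (auto simp: differentiable_def)
  then show ?thesis
    by (simp add: partial_deriv_eq[OF has_derivative_mult] partial_deriv_eq)
qed

text \<open>The regularity of the test functions, which are polynomials and exponentials on the
  whole space. Total differentiability of the first partials feeds the Taylor expansion; continuity
  of the pure second partials makes the Laplacian continuous and hence integrable against
  kernels.\<close>

definition twice_differentiable :: "('a::euclidean_space \<Rightarrow> real) \<Rightarrow> bool" where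
  "twice_differentiable f \<longleftrightarrow> (\<forall>x. f differentiable at x) \<and>
     (\<forall>b\<in>Basis. (\<forall>x. partial_deriv b f differentiable at x) \<and>
        continuous_on UNIV (partial_deriv b (partial_deriv b f)))"

lemma twice_differentiable_continuous:
  fixes f :: "'a::euclidean_space \<Rightarrow> real"
  assumes "twice_differentiable f"
  shows "continuous_on UNIV f" "b \<in> Basis \<Longrightarrow> continuous_on UNIV (partial_deriv b f)"
    "continuous_on UNIV (laplacian f)"
proof -
  have c: "continuous_on UNIV g" if "\<And>x. g differentiable at x" for g :: "'a \<Rightarrow> real"
    using that by (intro differentiable_imp_continuous_on) (simp add: differentiable_on_def)
  show "continuous_on UNIV f" "b \<in> Basis \<Longrightarrow> continuous_on UNIV (partial_deriv b f)"
    using assms by (auto simp: twice_differentiable_def intro: c)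
  show "continuous_on UNIV (laplacian f)"
    using assms unfolding twice_differentiable_def laplacian_def by (auto intro: continuous_on_sum)
qed

lemma twice_differentiable_add:
  assumes "twice_differentiable f" "twice_differentiable g"
  shows "twice_differentiable (\<lambda>x. f x + g x)"
    and "laplacian (\<lambda>x. f x + g x) x = laplacian f x + laplacian g x"
proof -
  have 1: "partial_deriv b (\<lambda>x. f x + g x) = (\<lambda>x. partial_deriv b f x + partial_deriv b g x)" for b
    using assms by (auto simp: twice_differentiable_def partial_deriv_add)
  have 2: "partial_deriv b (partial_deriv b (\<lambda>x. f x + g x)) =
      (\<lambda>x. partial_deriv b (partial_deriv b f) x + partial_deriv b (partial_deriv b g) x)" if "b \<in> Basis" for b
    using assms that unfolding 1 by (auto simp: twice_differentiable_def partial_deriv_add)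
  show "twice_differentiable (\<lambda>x. f x + g x)"
    using assms unfolding twice_differentiable_def by (auto simp: 2) (auto simp: 1 intro!: continuous_intros)
  show "laplacian (\<lambda>x. f x + g x) x = laplacian f x + laplacian g x"
    unfolding laplacian_def by (simp add: 2 sum.distrib)
qed

lemma twice_differentiable_cmult:
  assumes "twice_differentiable f"
  shows "twice_differentiable (\<lambda>x. c * f x)"
    and "laplacian (\<lambda>x. c * f x) x = c * laplacian f x"
proof -
  have 1: "partial_deriv b (\<lambda>x. c * f x) = (\<lambda>x. c * partial_deriv b f x)" for b
    using assms by (auto simp: twice_differentiable_def partial_deriv_mult)
  have 2: "partial_deriv b (partial_deriv b (\<lambda>x. c * f x)) = (\<lambda>x. c * partial_deriv b (partial_deriv b f) x)"
    if "b \<in> Basis" for b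
    using assms that unfolding 1 by (auto simp: twice_differentiable_def partial_deriv_mult)
  show "twice_differentiable (\<lambda>x. c * f x)"
    using assms unfolding twice_differentiable_def by (auto simp: 2) (auto simp: 1 intro!: continuous_intros)
  show "laplacian (\<lambda>x. c * f x) x = c * laplacian f x"
    unfolding laplacian_def by (simp add: 2 sum_distrib_left)
qed

lemma has_mean_laplacian_laplacian:
  fixes f :: "'a::euclidean_space \<Rightarrow> real"
  assumes "twice_differentiable f"
  shows "has_mean_laplacian f x (laplacian f x)"
  unfolding laplacian_def
  using assms twice_differentiable_continuous(1)[OF assms]
  by (intro has_mean_laplacian_smooth[where S=UNIV and G="\<lambda>b. partial_deriv b f"
        and H="\<lambda>b a. partial_deriv a (partial_deriv b f) x"])
    (auto simp: twice_differentiable_def intro: has_derivative_partials)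

lemma real_polynomial_function_partial_deriv:
  assumes "real_polynomial_function f"
  shows "real_polynomial_function (partial_deriv b f)"
  using assms
proof induction
  case (linear f)
  then have "partial_deriv b f = (\<lambda>_. f b)"
    by (auto intro: partial_deriv_eq bounded_linear_imp_has_derivative)
  then show ?case by auto
next
  case (const c)
  have "partial_deriv b (\<lambda>_::'a. c) = (\<lambda>_. 0)" by auto
  then show ?case by auto
next
  case (add f g)
  then have "partial_deriv b (\<lambda>x. f x + g x) = (\<lambda>x. partial_deriv b f x + partial_deriv b g x)"
    by (auto simp: partial_deriv_add differentiable_at_real_polynomial_function)
  with add show ?case by auto
next
  case (mult f g)
  then have "partial_deriv b (\<lambda>x. f x * g x) = (\<lambda>x. partial_deriv b f x * g x + f x * partial_deriv b g x)"
    by (auto simp: partial_deriv_mult differentiable_at_real_polynomial_function)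
  with mult show ?case by auto
qed

lemma real_polynomial_function_twice_differentiable:
  fixes f :: "'a::euclidean_space \<Rightarrow> real"
  assumes "real_polynomial_function f"
  shows "twice_differentiable f"
proof -
  have c: "continuous_on UNIV g" if "real_polynomial_function g" for g :: "'a \<Rightarrow> real"
    using differentiable_on_real_polynomial_function[OF that] by (rule differentiable_imp_continuous_on)
  show ?thesis
    unfolding twice_differentiable_def
    by (intro conjI allI ballI c differentiable_at_real_polynomial_function
        real_polynomial_function_partial_deriv assms)
qed

section \<open>Homogeneous polynomials and multiplication by the squared norm\<close>

lemma real_polynomial_function_norm_sq: "real_polynomial_function (\<lambda>x::'a::euclidean_space. (norm x)\<^sup>2)"
proof -
  have "real_polynomial_function (\<lambda>x::'a. \<Sum>b\<in>Basis. (x \<bullet> b) * (x \<bullet> b))"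
    by (intro real_polynomial_function_sum real_polynomial_function.intros(4) real_polynomial_function.intros(1)
        bounded_linear_inner_left) auto
  then show ?thesis by (simp add: power2_norm_eq_inner euclidean_inner[symmetric])
qed

text \<open>Generation by linear factors makes the degree part of the induction, so Euler's identity
  and the drop of degree under differentiation follow by rule induction. The zero polynomial belongs
  to every degree.\<close>

inductive homogeneous_polynomial :: "nat \<Rightarrow> ('a::euclidean_space \<Rightarrow> real) \<Rightarrow> bool" where
  const: "homogeneous_polynomial 0 (\<lambda>_. c)"
| inner: "homogeneous_polynomial d p \<Longrightarrow> homogeneous_polynomial (Suc d) (\<lambda>x. (x \<bullet> c) * p x)"
| add: "homogeneous_polynomial d p \<Longrightarrow> homogeneous_polynomial d q \<Longrightarrow> homogeneous_polynomial d (\<lambda>x. p x + q x)"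

lemma homogeneous_polynomial_zero: "homogeneous_polynomial d (\<lambda>_. 0)"
proof (induction d)
  case (Suc d)
  from homogeneous_polynomial.inner[OF this, of 0] show ?case by simp
qed (rule homogeneous_polynomial.const)

lemma homogeneous_polynomial_cmult:
  assumes "homogeneous_polynomial d p"
  shows "homogeneous_polynomial d (\<lambda>x. k * p x)"
  using assms
proof induction
  case (inner d p c)
  from homogeneous_polynomial.inner[OF inner.IH, of c] show ?case by (simp add: mult_ac)
qed (auto simp: distrib_left intro: homogeneous_polynomial.intros)

lemma homogeneous_polynomial_sum:
  assumes "finite I" "\<And>i. i \<in> I \<Longrightarrow> homogeneous_polynomial d (p i)"
  shows "homogeneous_polynomial d (\<lambda>x. \<Sum>i\<in>I. p i x)"
  using assms
  by induction (auto intro: homogeneous_polynomial_zero homogeneous_polynomial.add)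

lemma homogeneous_polynomial_mult:
  assumes "homogeneous_polynomial d p" "homogeneous_polynomial e q"
  shows "homogeneous_polynomial (d + e) (\<lambda>x. p x * q x)"
  using assms
proof induction
  case (inner d p c)
  from homogeneous_polynomial.inner[OF inner.IH[OF inner.prems], of c] show ?case by (simp add: mult_ac)
qed (auto simp: distrib_right intro: homogeneous_polynomial_cmult homogeneous_polynomial.add)

lemma homogeneous_polynomial_norm_sq: "homogeneous_polynomial 2 (\<lambda>x. (norm x)\<^sup>2)"
proof -
  have "homogeneous_polynomial (Suc (Suc 0)) (\<lambda>x. \<Sum>b\<in>Basis. (x \<bullet> b) * ((x \<bullet> b) * 1))"
    by (intro homogeneous_polynomial_sum homogeneous_polynomial.inner homogeneous_polynomial.const finite_Basis)
  then have "homogeneous_polynomial 2 (\<lambda>x. \<Sum>b\<in>Basis. (x \<bullet> b) * ((x \<bullet> b) * 1))"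
    by (simp only: numeral_2_eq_2)
  then show ?thesis by (simp add: power2_norm_eq_inner euclidean_inner[symmetric])
qed

lemma homogeneous_polynomial_norm_power: "homogeneous_polynomial (2 * j) (\<lambda>x. ((norm x)\<^sup>2) ^ j)"
proof (induction j)
  case (Suc j)
  from homogeneous_polynomial_mult[OF homogeneous_polynomial_norm_sq this] show ?case by simp
qed (auto intro: homogeneous_polynomial.const)

lemma homogeneous_imp_real_polynomial:
  assumes "homogeneous_polynomial d p"
  shows "real_polynomial_function p"
  using assms
proof induction
  case (inner d p c)
  then show ?case
    by (intro real_polynomial_function.intros(4) real_polynomial_function.intros(1)[OF bounded_linear_inner_left])
qed auto

text \<open>Truncated subtraction would leave degree 0 at degree 0. The second conjunct records that
  the derivative is then zero; the product case uses it when the cofactor is constant.\<close>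

lemma homogeneous_polynomial_partial_deriv:
  assumes "homogeneous_polynomial d p"
  shows "homogeneous_polynomial (d - 1) (partial_deriv b p) \<and> (d = 0 \<longrightarrow> partial_deriv b p = (\<lambda>_. 0))"
  using assms
proof induction
  case (const c)
  have "partial_deriv b (\<lambda>_::'a. c) = (\<lambda>_. 0)" by auto
  then show ?case by (auto intro: homogeneous_polynomial_zero)
next
  case (inner d p c)
  have eq: "partial_deriv b (\<lambda>x. (x \<bullet> c) * p x) = (\<lambda>x. (b \<bullet> c) * p x + (x \<bullet> c) * partial_deriv b p x)"
    using homogeneous_imp_real_polynomial[OF inner.hyps]
    by (auto simp: partial_deriv_mult differentiable_at_real_polynomial_function)
  have "homogeneous_polynomial d (\<lambda>x. (x \<bullet> c) * partial_deriv b p x)"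
  proof (cases d)
    case 0
    with inner.IH show ?thesis by (auto intro: homogeneous_polynomial_zero)
  next
    case (Suc d')
    with inner.IH show ?thesis by (auto intro: homogeneous_polynomial.inner)
  qed
  with inner.hyps show ?case
    unfolding eq by (auto intro!: homogeneous_polynomial.add homogeneous_polynomial_cmult)
next
  case (add d p q)
  have eq: "partial_deriv b (\<lambda>x. p x + q x) = (\<lambda>x. partial_deriv b p x + partial_deriv b q x)"
    using add.hyps[THEN homogeneous_imp_real_polynomial]
    by (auto simp: partial_deriv_add differentiable_at_real_polynomial_function)
  show ?case using add.IH unfolding eq by (auto intro: homogeneous_polynomial.add)
qed

lemma homogeneous_polynomial_euler:
  assumes "homogeneous_polynomial d p"
  shows "(\<Sum>b\<in>Basis. (x \<bullet> b) * partial_deriv b p x) = real d * p x"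
  using assms
proof induction
  case (inner d p c)
  have "(\<Sum>b\<in>Basis. (x \<bullet> b) * partial_deriv b (\<lambda>x. (x \<bullet> c) * p x) x)
     = (\<Sum>b\<in>Basis. (x \<bullet> b) * (b \<bullet> c)) * p x + (x \<bullet> c) * (\<Sum>b\<in>Basis. (x \<bullet> b) * partial_deriv b p x)"
    using homogeneous_imp_real_polynomial[OF inner.hyps]
    by (simp add: partial_deriv_mult differentiable_at_real_polynomial_function sum_distrib_left sum_distrib_right
        distrib_left sum.distrib mult_ac)
  also have "(\<Sum>b\<in>Basis. (x \<bullet> b) * (b \<bullet> c)) = x \<bullet> c"
    by (subst euclidean_inner[of x c]) (simp add: inner_commute)
  finally show ?case using inner.IH by (simp add: algebra_simps)
next
  case (add d p q)
  then show ?case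
    using add.hyps[THEN homogeneous_imp_real_polynomial]
    by (simp add: partial_deriv_add differentiable_at_real_polynomial_function distrib_left sum.distrib)
qed auto

lemma homogeneous_polynomial_laplacian:
  assumes "homogeneous_polynomial d p"
  shows "homogeneous_polynomial (d - 2) (laplacian p)" "d < 2 \<Longrightarrow> laplacian p = (\<lambda>_. 0)"
proof -
  have 1: "homogeneous_polynomial (d - 1 - 1) (partial_deriv b (partial_deriv b p))"
    "d - 1 = 0 \<Longrightarrow> partial_deriv b (partial_deriv b p) = (\<lambda>_. 0)" for b
    using homogeneous_polynomial_partial_deriv[of "d - 1" "partial_deriv b p" b]
      homogeneous_polynomial_partial_deriv[OF assms, of b] by auto
  have eq: "laplacian p = (\<lambda>x. \<Sum>b\<in>Basis. partial_deriv b (partial_deriv b p) x)"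
    by (auto simp: laplacian_def)
  show "homogeneous_polynomial (d - 2) (laplacian p)"
    unfolding eq using 1(1) by (intro homogeneous_polynomial_sum) (auto simp: numeral_2_eq_2)
  show "laplacian p = (\<lambda>_. 0)" if "d < 2"
    using that unfolding eq by (simp add: 1(2))
qed

lemma laplacian_norm_sq_mult:
  fixes p :: "'a::euclidean_space \<Rightarrow> real"
  assumes "real_polynomial_function p"
  shows "laplacian (\<lambda>x. (norm x)\<^sup>2 * p x) x =
    2 * DIM('a) * p x + 4 * (\<Sum>b\<in>Basis. (x \<bullet> b) * partial_deriv b p x) + (norm x)\<^sup>2 * laplacian p x"
proof -
  have d: "f differentiable at x" if "real_polynomial_function f" for f :: "'a \<Rightarrow> real" and x
    using that by (rule differentiable_at_real_polynomial_function)
  have N: "partial_deriv b (\<lambda>x. (norm x)\<^sup>2) x = 2 * (x \<bullet> b)" for b x :: 'a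
    unfolding power2_norm_eq_inner
    by (rule partial_deriv_eq[THEN trans]) (auto intro!: derivative_eq_intros simp: inner_commute)
  have 1: "partial_deriv b (\<lambda>x. (norm x)\<^sup>2 * p x) = (\<lambda>x. 2 * ((x \<bullet> b) * p x) + (norm x)\<^sup>2 * partial_deriv b p x)" for b
    by (auto simp: partial_deriv_mult d assms real_polynomial_function_norm_sq N)
  have l: "real_polynomial_function (\<lambda>x. x \<bullet> b)" for b :: 'a
    by (intro real_polynomial_function.intros(1) bounded_linear_inner_left)
  have 2: "partial_deriv b (partial_deriv b (\<lambda>x. (norm x)\<^sup>2 * p x)) x
      = 2 * p x + 4 * ((x \<bullet> b) * partial_deriv b p x) + (norm x)\<^sup>2 * partial_deriv b (partial_deriv b p) x"
    if "b \<in> Basis" for b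
  proof -
    note rp = real_polynomial_function.intros(2) real_polynomial_function.intros(4) assms l
      real_polynomial_function_norm_sq real_polynomial_function_partial_deriv
    show ?thesis
      unfolding 1 using that
      by (simp add: partial_deriv_add partial_deriv_mult d rp N inner_Basis algebra_simps)
  qed
  show ?thesis
    unfolding laplacian_def by (simp add: 2 sum.distrib sum_distrib_left)
qed

text \<open>Each factor of the squared norm contributes 2 m + 4 (degree of the cofactor), by the
  product rule and Euler's identity. The constant \<open>c\<close> is the sum of these
  contributions; its positivity will allow division by it.\<close>

lemma laplacian_norm_power_mult:
  fixes h :: "'a::euclidean_space \<Rightarrow> real"
  assumes h: "homogeneous_polynomial e h"
  obtains c where "c > 0"
    "\<And>x. laplacian (\<lambda>x. (norm x)\<^sup>2 * (((norm x)\<^sup>2) ^ j * h x)) x =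
      c * (((norm x)\<^sup>2) ^ j * h x) + ((norm x)\<^sup>2) ^ Suc j * laplacian h x"
proof -
  have base: "laplacian (\<lambda>x. (norm x)\<^sup>2 * f x) x = (2 * DIM('a) + 4 * d) * f x + (norm x)\<^sup>2 * laplacian f x"
    if f: "homogeneous_polynomial d f" for f :: "'a \<Rightarrow> real" and d :: nat and x :: 'a
    using laplacian_norm_sq_mult[OF homogeneous_imp_real_polynomial[OF f]] homogeneous_polynomial_euler[OF f]
    by (simp add: algebra_simps)
  have "\<exists>c>0. \<forall>x. laplacian (\<lambda>x. (norm x)\<^sup>2 * (((norm x)\<^sup>2) ^ j * h x)) x =
      c * (((norm x)\<^sup>2) ^ j * h x) + ((norm x)\<^sup>2) ^ Suc j * laplacian h x"
  proof (induction j)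
    case 0
    show ?case
      by (intro exI[of _ "real (2 * DIM('a) + 4 * e)"]) (use base[OF h] in \<open>auto simp: add_pos_nonneg\<close>)
  next
    case (Suc j)
    then obtain c where c: "c > 0" "\<And>x. laplacian (\<lambda>x. (norm x)\<^sup>2 * (((norm x)\<^sup>2) ^ j * h x)) x =
      c * (((norm x)\<^sup>2) ^ j * h x) + ((norm x)\<^sup>2) ^ Suc j * laplacian h x" by auto
    have "homogeneous_polynomial (2 * Suc j + e) (\<lambda>x. ((norm x)\<^sup>2) ^ Suc j * h x)"
      by (intro homogeneous_polynomial_mult homogeneous_polynomial_norm_power h)
    note base' = base[OF this]
    show ?case
    proof (intro exI[of _ "real (2 * DIM('a) + 4 * (2 * Suc j + e)) + c"] conjI allI)
      fix x :: 'a
      have "laplacian (\<lambda>x. (norm x)\<^sup>2 * (((norm x)\<^sup>2) ^ Suc j * h x)) x =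
          real (2 * DIM('a) + 4 * (2 * Suc j + e)) * (((norm x)\<^sup>2) ^ Suc j * h x)
          + (norm x)\<^sup>2 * laplacian (\<lambda>x. (norm x)\<^sup>2 * (((norm x)\<^sup>2) ^ j * h x)) x"
        unfolding base' by (simp only: power_Suc mult.assoc)
      then show "laplacian (\<lambda>x. (norm x)\<^sup>2 * (((norm x)\<^sup>2) ^ Suc j * h x)) x =
          (real (2 * DIM('a) + 4 * (2 * Suc j + e)) + c) * (((norm x)\<^sup>2) ^ Suc j * h x)
          + ((norm x)\<^sup>2) ^ Suc (Suc j) * laplacian h x"
        unfolding c(2) by (simp add: algebra_simps)
    qed (use c(1) in auto)
  qed
  with that show thesis by auto
qed

text \<open>Fischer decomposition: multiplication by the squared norm followed by the Laplacian is onto in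
  each degree; the induction trades two degrees of \<open>h\<close> for one more factor of the squared norm.\<close>

lemma laplacian_norm_sq_mult_surj:
  fixes h :: "'a::euclidean_space \<Rightarrow> real"
  assumes "homogeneous_polynomial e h"
  shows "\<exists>q. homogeneous_polynomial (2 * j + e) q \<and>
    (\<forall>x. laplacian (\<lambda>x. (norm x)\<^sup>2 * q x) x = ((norm x)\<^sup>2) ^ j * h x)"
  using assms
proof (induction e arbitrary: j h rule: less_induct)
  case (less e)
  obtain c where c: "c > 0" "\<And>x. laplacian (\<lambda>x. (norm x)\<^sup>2 * (((norm x)\<^sup>2) ^ j * h x)) x =
      c * (((norm x)\<^sup>2) ^ j * h x) + ((norm x)\<^sup>2) ^ Suc j * laplacian h x"
    by (rule laplacian_norm_power_mult[OF less.prems, of j]) blast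
  obtain q where q: "homogeneous_polynomial (2 * j + e) q"
    "\<And>x. laplacian (\<lambda>x. (norm x)\<^sup>2 * q x) x = ((norm x)\<^sup>2) ^ Suc j * laplacian h x"
  proof (cases "e < 2")
    case True
    have "laplacian (\<lambda>x::'a. (norm x)\<^sup>2 * 0) x = 0" for x
      using laplacian_norm_sq_mult[OF real_polynomial_function.intros(2)[of 0], of x]
      by (simp add: homogeneous_polynomial_laplacian(2)[OF homogeneous_polynomial.const])
    with that[of "\<lambda>_. 0"] True show ?thesis
      by (simp add: homogeneous_polynomial_zero homogeneous_polynomial_laplacian(2)[OF less.prems])
  next
    case False
    then have "\<exists>q. homogeneous_polynomial (2 * Suc j + (e - 2)) q \<and>
        (\<forall>x. laplacian (\<lambda>x. (norm x)\<^sup>2 * q x) x = ((norm x)\<^sup>2) ^ Suc j * laplacian h x)"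
      by (intro less.IH homogeneous_polynomial_laplacian less.prems) auto
    moreover have "2 * Suc j + (e - 2) = 2 * j + e" using False by simp
    ultimately have "\<exists>q. homogeneous_polynomial (2 * j + e) q \<and>
        (\<forall>x. laplacian (\<lambda>x. (norm x)\<^sup>2 * q x) x = ((norm x)\<^sup>2) ^ Suc j * laplacian h x)"
      by (simp only:)
    with that show ?thesis by blast
  qed
  let ?f = "\<lambda>x. ((norm x)\<^sup>2) ^ j * h x"
  \<comment> \<open>By the identity for \<open>c\<close>, the squared norm times \<open>?f\<close>
    has Laplacian \<open>c * ?f\<close> plus a term in \<open>laplacian h\<close>; the inductive
    \<open>q\<close> produces exactly that second term. Subtract, then divide by
    \<open>c\<close>.\<close>
  let ?q = "\<lambda>x. (1 / c) * ?f x + (- 1 / c) * q x"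
  have f: "homogeneous_polynomial (2 * j + e) ?f"
    by (intro homogeneous_polynomial_mult homogeneous_polynomial_norm_power less.prems)
  have td: "twice_differentiable (\<lambda>x. (norm x)\<^sup>2 * g x)" if "homogeneous_polynomial d g" for d and g :: "'a \<Rightarrow> real"
    using that by (intro real_polynomial_function_twice_differentiable real_polynomial_function.intros(4)
        real_polynomial_function_norm_sq homogeneous_imp_real_polynomial)
  have "laplacian (\<lambda>x. (norm x)\<^sup>2 * ?q x) x = ?f x" for x
  proof -
    have "(\<lambda>x. (norm x)\<^sup>2 * ?q x) = (\<lambda>x. (1 / c) * ((norm x)\<^sup>2 * ?f x) + (- 1 / c) * ((norm x)\<^sup>2 * q x))"
      by (auto simp: algebra_simps)
    then have "laplacian (\<lambda>x. (norm x)\<^sup>2 * ?q x) x =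
        (1 / c) * laplacian (\<lambda>x. (norm x)\<^sup>2 * ?f x) x + (- 1 / c) * laplacian (\<lambda>x. (norm x)\<^sup>2 * q x) x"
      by (simp only: twice_differentiable_add(2)[OF twice_differentiable_cmult(1) twice_differentiable_cmult(1)]
          twice_differentiable_cmult(2) td[OF f] td[OF q(1)])
    also have "\<dots> = (1 / c) * (c * ?f x + ((norm x)\<^sup>2) ^ Suc j * laplacian h x) +
        (- 1 / c) * (((norm x)\<^sup>2) ^ Suc j * laplacian h x)"
      by (simp only: c(2) q(2))
    also have "\<dots> = ?f x"
      using c(1) by (simp add: distrib_left)
    finally show ?thesis .
  qed
  moreover have "homogeneous_polynomial (2 * j + e) ?q"
    by (intro homogeneous_polynomial.add homogeneous_polynomial_cmult f q)
  ultimately show ?case by blast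
qed

text \<open>First solve with |x|^2 q0. Replacing |x|^2 by |x|^2 - R creates the error -R Lap q0,
  which is two degrees lower than \<open>p\<close> and is removed by induction. The parameter
  \<open>R\<close> will be the square of a radius.\<close>

lemma laplacian_dirichlet_homogeneous:
  fixes p :: "'a::euclidean_space \<Rightarrow> real"
  assumes "homogeneous_polynomial d p"
  shows "\<exists>q. real_polynomial_function q \<and> (\<forall>x. laplacian (\<lambda>x. ((norm x)\<^sup>2 - R) * q x) x = p x)"
  using assms
proof (induction d arbitrary: p rule: less_induct)
  case (less d)
  obtain q0 where q0: "homogeneous_polynomial d q0" "\<And>x. laplacian (\<lambda>x. (norm x)\<^sup>2 * q0 x) x = p x"
    using laplacian_norm_sq_mult_surj[OF less.prems, of 0] unfolding mult_0_right add_0 power_0 mult_1 by blast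
  obtain q1 where q1: "real_polynomial_function q1"
    "\<And>x. laplacian (\<lambda>x. ((norm x)\<^sup>2 - R) * q1 x) x = R * laplacian q0 x"
  proof (cases "d < 2")
    case True
    show ?thesis
    proof (rule that[of "\<lambda>_. 0"])
      show "laplacian (\<lambda>x. ((norm x)\<^sup>2 - R) * 0) x = R * laplacian q0 x" for x
        unfolding mult_zero_right
        by (simp only: homogeneous_polynomial_laplacian(2)[OF q0(1) True]
            homogeneous_polynomial_laplacian(2)[OF homogeneous_polynomial.const zero_less_numeral] mult_zero_right)
    qed (rule real_polynomial_function.intros(2))
  next
    case False
    then have "\<exists>q. real_polynomial_function q \<and> (\<forall>x. laplacian (\<lambda>x. ((norm x)\<^sup>2 - R) * q x) x = R * laplacian q0 x)"
      by (intro less.IH[of "d - 2"] homogeneous_polynomial_cmult homogeneous_polynomial_laplacian q0) auto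
    with that show ?thesis by blast
  qed
  have rq0: "real_polynomial_function q0" using q0(1) by (rule homogeneous_imp_real_polynomial)
  have rN: "real_polynomial_function (\<lambda>x::'a. (norm x)\<^sup>2 - R)"
    by (intro real_polynomial_function_diff real_polynomial_function_norm_sq real_polynomial_function.intros(2))
  have "(\<lambda>x. ((norm x)\<^sup>2 - R) * (q0 x + q1 x)) =
      (\<lambda>x. ((norm x)\<^sup>2 * q0 x + (- R) * q0 x) + ((norm x)\<^sup>2 - R) * q1 x)"
    by (auto simp: algebra_simps)
  moreover have td: "twice_differentiable (\<lambda>x. (norm x)\<^sup>2 * q0 x)" "twice_differentiable q0"
      "twice_differentiable (\<lambda>x. ((norm x)\<^sup>2 - R) * q1 x)"
    by (intro real_polynomial_function_twice_differentiable real_polynomial_function.intros(4)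
        real_polynomial_function_norm_sq rq0 rN q1(1))+
  ultimately have "laplacian (\<lambda>x. ((norm x)\<^sup>2 - R) * (q0 x + q1 x)) x =
      (laplacian (\<lambda>x. (norm x)\<^sup>2 * q0 x) x + (- R) * laplacian q0 x) + laplacian (\<lambda>x. ((norm x)\<^sup>2 - R) * q1 x) x" for x
    by (simp only: twice_differentiable_cmult(2)[OF td(2)]
        twice_differentiable_add(2)[OF td(1) twice_differentiable_cmult(1)[OF td(2)]]
        twice_differentiable_add(2)[OF twice_differentiable_add(1)[OF td(1) twice_differentiable_cmult(1)[OF td(2)]] td(3)])
  then have "laplacian (\<lambda>x. ((norm x)\<^sup>2 - R) * (q0 x + q1 x)) x = p x" for x
    unfolding q0(2) q1(2) by simp
  moreover have "real_polynomial_function (\<lambda>x. q0 x + q1 x)"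
    by (intro real_polynomial_function.intros(3) rq0 q1(1))
  ultimately show ?case by blast
qed

text \<open>A bridge: the induction rule of \<open>real_polynomial_function\<close> carries no
  degree, while the Dirichlet problem is solved degree by degree and then extended by
  linearity.\<close>

inductive homogeneous_sum :: "('a::euclidean_space \<Rightarrow> real) \<Rightarrow> bool" where
  hom: "homogeneous_polynomial d p \<Longrightarrow> homogeneous_sum p"
| add: "homogeneous_sum p \<Longrightarrow> homogeneous_sum q \<Longrightarrow> homogeneous_sum (\<lambda>x. p x + q x)"

lemma homogeneous_sum_mult:
  assumes "homogeneous_sum p" "homogeneous_sum q"
  shows "homogeneous_sum (\<lambda>x. p x * q x)"
  using assms
proof (induction arbitrary: q)
  case (hom d p)
  from hom.prems hom.hyps show ?case
  proof induction
    case (hom e q)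
    show ?case
      by (rule homogeneous_sum.hom[OF homogeneous_polynomial_mult[OF hom.prems hom.hyps]])
  next
    case (add q r)
    then have "homogeneous_sum (\<lambda>x. p x * q x + p x * r x)"
      by (intro homogeneous_sum.add)
    then show ?case by (simp only: distrib_left)
  qed
next
  case (add p r)
  then have "homogeneous_sum (\<lambda>x. p x * q x + r x * q x)"
    by (intro homogeneous_sum.add)
  then show ?case by (simp only: distrib_right)
qed

lemma real_polynomial_imp_homogeneous_sum:
  assumes "real_polynomial_function p"
  shows "homogeneous_sum p"
  using assms
proof induction
  case (linear f)
  interpret bounded_linear f by fact
  have "f x = (\<Sum>b\<in>Basis. f b * ((x \<bullet> b) * 1))" for x
    using sum[of "\<lambda>b. (x \<bullet> b) *\<^sub>R b" Basis] by (simp add: euclidean_representation scale mult.commute)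
  then have "f = (\<lambda>x. \<Sum>b\<in>Basis. f b * ((x \<bullet> b) * 1))" by (rule ext)
  moreover have "homogeneous_polynomial (Suc 0) (\<lambda>x. \<Sum>b\<in>Basis. f b * ((x \<bullet> b) * 1))"
    by (intro homogeneous_polynomial_sum homogeneous_polynomial_cmult
        homogeneous_polynomial.inner[OF homogeneous_polynomial.const] finite_Basis)
  ultimately have "homogeneous_polynomial (Suc 0) f" by metis
  then show ?case by (rule homogeneous_sum.hom)
next
  case (const c)
  show ?case by (rule homogeneous_sum.hom[OF homogeneous_polynomial.const])
next
  case (add f g)
  from add.IH show ?case by (rule homogeneous_sum.add)
next
  case (mult f g)
  from mult.IH show ?case by (rule homogeneous_sum_mult)
qed

lemma laplacian_dirichlet_polynomial:
  fixes p :: "'a::euclidean_space \<Rightarrow> real"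
  assumes "real_polynomial_function p"
  obtains u where "real_polynomial_function u" "\<And>x. laplacian u x = p x" "\<And>x. (norm x)\<^sup>2 = R \<Longrightarrow> u x = 0"
proof -
  have "\<exists>q. real_polynomial_function q \<and> (\<forall>x. laplacian (\<lambda>x. ((norm x)\<^sup>2 - R) * q x) x = p x)"
    using real_polynomial_imp_homogeneous_sum[OF assms]
  proof induction
    case (hom d p)
    then show ?case by (rule laplacian_dirichlet_homogeneous)
  next
    case (add p1 p2)
    then obtain q1 q2 where q: "real_polynomial_function q1" "real_polynomial_function q2"
      "\<And>x. laplacian (\<lambda>x. ((norm x)\<^sup>2 - R) * q1 x) x = p1 x" "\<And>x. laplacian (\<lambda>x. ((norm x)\<^sup>2 - R) * q2 x) x = p2 x"
      by blast
    have "(\<lambda>x. ((norm x)\<^sup>2 - R) * (q1 x + q2 x)) = (\<lambda>x. ((norm x)\<^sup>2 - R) * q1 x + ((norm x)\<^sup>2 - R) * q2 x)"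
      by (auto simp: algebra_simps)
    moreover have rN: "real_polynomial_function (\<lambda>x::'a. (norm x)\<^sup>2 - R)"
      by (intro real_polynomial_function_diff real_polynomial_function_norm_sq real_polynomial_function.intros(2))
    moreover have td: "twice_differentiable (\<lambda>x. ((norm x)\<^sup>2 - R) * q1 x)" "twice_differentiable (\<lambda>x. ((norm x)\<^sup>2 - R) * q2 x)"
      by (intro real_polynomial_function_twice_differentiable real_polynomial_function.intros(4) rN q(1,2))+
    ultimately have "laplacian (\<lambda>x. ((norm x)\<^sup>2 - R) * (q1 x + q2 x)) x = p1 x + p2 x" for x
      by (simp only: twice_differentiable_add(2)[OF td] q(3,4))
    moreover have "real_polynomial_function (\<lambda>x. q1 x + q2 x)"
      by (intro real_polynomial_function.intros(3) q(1,2))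
    ultimately show ?case by blast
  qed
  then obtain q where q: "real_polynomial_function q" "\<And>x. laplacian (\<lambda>x. ((norm x)\<^sup>2 - R) * q x) x = p x" by blast
  show thesis
  proof
    show "real_polynomial_function (\<lambda>x. ((norm x)\<^sup>2 - R) * q x)"
      by (intro real_polynomial_function.intros(4) real_polynomial_function_diff real_polynomial_function_norm_sq
          real_polynomial_function.intros(2) q)
  qed (use q in auto)
qed

section \<open>Approximate solutions of the Dirichlet problem\<close>

lemma partial_deriv_translate: "partial_deriv b (\<lambda>y. f (c + y)) = (\<lambda>y. partial_deriv b f (c + y))"
  by (simp add: partial_deriv_def add.assoc fun_eq_iff)

lemma laplacian_translate: "laplacian (\<lambda>y. f (c + y)) y = laplacian f (c + y)"
  by (simp add: laplacian_def partial_deriv_translate)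

lemma twice_differentiable_translate:
  fixes f :: "'a::euclidean_space \<Rightarrow> real"
  assumes "twice_differentiable f"
  shows "twice_differentiable (\<lambda>y. f (c + y))"
proof -
  have 1: "(\<lambda>y. g (c + y)) differentiable at x" if "g differentiable at (c + x)" for g :: "'a \<Rightarrow> real" and x
    using differentiable_chain_at[of "\<lambda>y. c + y" x g] that by (simp add: comp_def)
  have 2: "continuous_on UNIV (\<lambda>y. g (c + y))" if "continuous_on UNIV g" for g :: "'a \<Rightarrow> real"
    by (rule continuous_on_compose2[OF that]) (auto intro: continuous_intros)
  show ?thesis
    using assms unfolding twice_differentiable_def partial_deriv_translate by (auto intro: 1 2)
qed

lemma laplacian_norm_sq: "laplacian (\<lambda>x::'a::euclidean_space. (norm x)\<^sup>2 * 1) x = 2 * DIM('a)"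
proof -
  have "laplacian (\<lambda>_::'a. 1) x = 0"
    by (simp add: laplacian_def partial_deriv_def)
  then show ?thesis
    by (subst laplacian_norm_sq_mult[OF real_polynomial_function.intros(2)]) simp
qed

text \<open>Adding (C / m) |x|^2, whose Laplacian is 2 C, to +-u gives a function with Laplacian at
  least C > 0. Its maximum is therefore on the sphere, where it equals C R^2 / m.\<close>

lemma dirichlet_bound:
  fixes u :: "'a::euclidean_space \<Rightarrow> real"
  assumes u: "twice_differentiable u" and bd: "\<And>x. norm x = R \<Longrightarrow> u x = 0"
    and C: "C > 0" "\<And>x. norm x \<le> R \<Longrightarrow> \<bar>laplacian u x\<bar> \<le> C"
    and x: "norm x \<le> R"
  shows "\<bar>u x\<bar> \<le> C * R\<^sup>2 / DIM('a)"
proof -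
  let ?m = "real DIM('a)"
  have half: "\<sigma> * u x \<le> C * R\<^sup>2 / ?m" if \<sigma>: "\<bar>\<sigma>\<bar> = 1" for \<sigma>
  proof -
    let ?q = "\<lambda>x::'a. (C / ?m) * ((norm x)\<^sup>2 * 1)"
    let ?f = "\<lambda>x. \<sigma> * u x + ?q x"
    have td: "twice_differentiable (\<lambda>x. \<sigma> * u x)" "twice_differentiable ?q"
      by (intro twice_differentiable_cmult u real_polynomial_function_twice_differentiable
          real_polynomial_function.intros(4) real_polynomial_function_norm_sq real_polynomial_function.intros(2))+
    have lq: "laplacian ?q x = 2 * C" for x
      using twice_differentiable_cmult(2)[OF real_polynomial_function_twice_differentiable[OF
            real_polynomial_function.intros(4)[OF real_polynomial_function_norm_sq real_polynomial_function.intros(2)[of 1]]],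
          of "C / ?m" x] by (simp only: laplacian_norm_sq) simp
    have "?f x \<le> C / ?m * R\<^sup>2"
    proof (rule mean_laplacian_comparison[where z=0 and R=R and l="\<lambda>y. \<sigma> * laplacian u y + 2 * C"])
      show "continuous_on UNIV ?f"
        by (intro twice_differentiable_continuous twice_differentiable_add td)
      show "has_mean_laplacian ?f y (\<sigma> * laplacian u y + 2 * C)" for y
        using has_mean_laplacian_laplacian[OF twice_differentiable_add(1)[OF td], of y]
        by (simp only: twice_differentiable_add(2)[OF td] lq twice_differentiable_cmult(2)[OF u])
      show "\<sigma> * laplacian u y + 2 * C > 0" if "y \<in> ball 0 R" for y
      proof -
        have "\<bar>\<sigma> * laplacian u y\<bar> \<le> C" using C(2)[of y] that \<sigma> by (simp add: abs_mult)
        with C(1) show ?thesis by linarith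
      qed
      show "?f y \<le> C / ?m * R\<^sup>2" if "y \<in> sphere 0 R" for y
        using that bd[of y] by simp
    qed (use x in auto)
    moreover have "?q x \<ge> 0" using C(1) by simp
    ultimately show ?thesis by simp
  qed
  from half[of 1] half[of "-1"] show ?thesis by (simp add: abs_le_iff)
qed

text \<open>Weierstrass approximation settles the boundary values but says nothing about the
  Laplacian inside. The corrections vanish on the sphere, so they repair the equation without
  disturbing the boundary values.\<close>

lemma approximate_dirichlet:
  fixes v :: "'a::euclidean_space \<Rightarrow> real"
  assumes R: "R > 0" and small: "\<mu>\<^sup>2 * R\<^sup>2 / DIM('a) \<le> 1 / 2"
    and v: "continuous_on UNIV v" and e: "e > 0"
  obtains U where "real_polynomial_function U" "\<And>x. norm x = R \<Longrightarrow> \<bar>U x - v x\<bar> \<le> e"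
    "\<And>x. norm x \<le> R \<Longrightarrow> \<bar>laplacian U x - \<mu>\<^sup>2 * U x\<bar> \<le> e"
proof -
  have rl: "real_polynomial_function (\<lambda>x. laplacian U x - \<mu>\<^sup>2 * U x)"
    if "real_polynomial_function U" for U :: "'a \<Rightarrow> real"
    unfolding laplacian_def
    by (intro real_polynomial_function_diff real_polynomial_function_sum real_polynomial_function.intros(4)
        real_polynomial_function.intros(2) that real_polynomial_function_partial_deriv finite_Basis)
  obtain p where "real_polynomial_function p" "\<And>x. x \<in> sphere 0 R \<Longrightarrow> \<bar>v x - p x\<bar> < e"
    by (rule Stone_Weierstrass_real_polynomial_function[of "sphere 0 R" v e])
      (use e continuous_on_subset[OF v] in auto)
  then have p: "real_polynomial_function p" "\<And>x. norm x = R \<Longrightarrow> \<bar>p x - v x\<bar> \<le> e"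
    by (auto simp: abs_minus_commute less_imp_le)
  have "bounded ((\<lambda>x. laplacian p x - \<mu>\<^sup>2 * p x) ` cball 0 R)"
    by (intro compact_imp_bounded compact_continuous_image differentiable_imp_continuous_on
        differentiable_on_real_polynomial_function rl p(1)) auto
  then obtain C where "C > 0" "\<forall>y\<in>(\<lambda>x. laplacian p x - \<mu>\<^sup>2 * p x) ` cball 0 R. norm y \<le> C"
    unfolding bounded_pos by blast
  then have C: "C > 0" "\<And>x. norm x \<le> R \<Longrightarrow> \<bar>laplacian p x - \<mu>\<^sup>2 * p x\<bar> \<le> C"
    by auto
  text \<open>Each correction by the solution of a Poisson problem halves the residual.\<close>
  have "\<exists>U. real_polynomial_function U \<and> (\<forall>x. norm x = R \<longrightarrow> U x = p x) \<and>
      (\<forall>x. norm x \<le> R \<longrightarrow> \<bar>laplacian U x - \<mu>\<^sup>2 * U x\<bar> \<le> C / 2 ^ n)" for n :: nat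
  proof (induction n)
    case 0
    show ?case using p(1) C(2) by auto
  next
    case (Suc n)
    then obtain U where U: "real_polynomial_function U" "\<And>x. norm x = R \<Longrightarrow> U x = p x"
      "\<And>x. norm x \<le> R \<Longrightarrow> \<bar>laplacian U x - \<mu>\<^sup>2 * U x\<bar> \<le> C / 2 ^ n" by blast
    obtain w where w: "real_polynomial_function w"
      "\<And>x. laplacian w x = - (laplacian U x - \<mu>\<^sup>2 * U x)" "\<And>x. (norm x)\<^sup>2 = R\<^sup>2 \<Longrightarrow> w x = 0"
      by (rule laplacian_dirichlet_polynomial[OF real_polynomial_function_minus[OF rl[OF U(1)]], where R="R\<^sup>2"])
        (rule that)
    have td: "twice_differentiable U" "twice_differentiable w"
      using U(1) w(1) by (simp_all add: real_polynomial_function_twice_differentiable)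
    show ?case
    proof (intro exI[of _ "\<lambda>x. U x + w x"] conjI allI impI)
      show "real_polynomial_function (\<lambda>x. U x + w x)" by (intro real_polynomial_function.intros(3) U w)
      show "U x + w x = p x" if "norm x = R" for x using U(2) w(3) that by simp
      fix x :: 'a assume x: "norm x \<le> R"
      \<comment> \<open>The Laplacian of \<open>w\<close> cancels the old residual, so the new one
        is just -mu^2 w, and \<open>w\<close> is small because the old residual was.\<close>
      have "laplacian (\<lambda>x. U x + w x) x - \<mu>\<^sup>2 * (U x + w x) = - (\<mu>\<^sup>2 * w x)"
        unfolding twice_differentiable_add(2)[OF td] w(2) by (simp add: algebra_simps)
      then have "\<bar>laplacian (\<lambda>x. U x + w x) x - \<mu>\<^sup>2 * (U x + w x)\<bar> = \<mu>\<^sup>2 * \<bar>w x\<bar>"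
        by (simp add: abs_mult)
      also have "\<dots> \<le> \<mu>\<^sup>2 * ((C / 2 ^ n) * R\<^sup>2 / DIM('a))"
      proof (intro mult_left_mono dirichlet_bound[OF td(2) _ _ _ x])
        show "\<bar>laplacian w y\<bar> \<le> C / 2 ^ n" if "norm y \<le> R" for y
          using U(3)[OF that] by (simp only: w(2) abs_minus_cancel)
      qed (use C(1) w(3) in auto)
      also have "\<dots> = (C / 2 ^ n) * (\<mu>\<^sup>2 * R\<^sup>2 / DIM('a))" by simp
      also have "\<dots> \<le> (C / 2 ^ n) * (1 / 2)"
        using small C(1) by (intro mult_left_mono) auto
      finally show "\<bar>laplacian (\<lambda>x. U x + w x) x - \<mu>\<^sup>2 * (U x + w x)\<bar> \<le> C / 2 ^ Suc n" by simp
    qed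
  qed
  note refine = this
  obtain n :: nat where "(1 / 2) ^ n < e / C"
    using real_arch_pow_inv[of "e / C" "1 / 2"] e C(1) by auto
  then have n: "C / 2 ^ n \<le> e" using C(1) by (simp add: field_simps power_divide)
  obtain U where U: "real_polynomial_function U" "\<And>x. norm x = R \<Longrightarrow> U x = p x"
    "\<And>x. norm x \<le> R \<Longrightarrow> \<bar>laplacian U x - \<mu>\<^sup>2 * U x\<bar> \<le> C / 2 ^ n"
    using refine[of n] by blast
  show thesis
  proof (rule that[OF U(1)])
    show "\<bar>U x - v x\<bar> \<le> e" if "norm x = R" for x
      using p(2)[OF that] U(2)[OF that] by simp
    show "\<bar>laplacian U x - \<mu>\<^sup>2 * U x\<bar> \<le> e" if "norm x \<le> R" for x
      using U(3)[OF that] n by (rule order_trans)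
  qed
qed

text \<open>Although \<open>v\<close> is merely continuous, the mean Laplacian is linear and defined
  for \<open>U\<close> and \<open>v\<close> alike, so +-(U - v) satisfies a perturbed equation and
  the comparison carries the boundary estimate into the whole ball.\<close>

lemma helmholtz_approximation:
  fixes v :: "'a::euclidean_space \<Rightarrow> real"
  assumes R: "R > 0" and small: "\<mu>\<^sup>2 * R\<^sup>2 / DIM('a) \<le> 1 / 2" and mu: "\<mu> \<noteq> 0"
    and v: "continuous_on UNIV v" and l: "\<And>x. x \<in> ball z R \<Longrightarrow> has_mean_laplacian v x (\<mu>\<^sup>2 * v x)"
    and e: "e > 0"
  obtains U where "twice_differentiable U" "\<And>x. x \<in> cball z R \<Longrightarrow> \<bar>U x - v x\<bar> \<le> e"
    "\<And>x. x \<in> cball z R \<Longrightarrow> \<bar>laplacian U x - \<mu>\<^sup>2 * U x\<bar> \<le> e"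
proof -
  \<comment> \<open>The bound by \<open>\<mu>\<^sup>2 * e\<close> is for the comparison: where the
    difference exceeds \<open>e\<close>, its mean Laplacian exceeds mu^2 e minus the residual, which
    must not be negative.\<close>
  define e' where "e' = min e (\<mu>\<^sup>2 * e)"
  have e': "e' > 0" "e' \<le> e" "e' \<le> \<mu>\<^sup>2 * e" using e mu by (auto simp: e'_def)
  obtain U0 where U0: "real_polynomial_function U0" "\<And>x. norm x = R \<Longrightarrow> \<bar>U0 x - v (z + x)\<bar> \<le> e'"
    "\<And>x. norm x \<le> R \<Longrightarrow> \<bar>laplacian U0 x - \<mu>\<^sup>2 * U0 x\<bar> \<le> e'"
    by (rule approximate_dirichlet[OF R small _ e'(1), of "\<lambda>x. v (z + x)"])
      (auto intro!: continuous_on_compose2[OF v] continuous_intros)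
  define U where "U = (\<lambda>x. U0 (- z + x))"
  have td: "twice_differentiable U"
    unfolding U_def by (intro twice_differentiable_translate real_polynomial_function_twice_differentiable U0)
  have lU: "laplacian U x = laplacian U0 (- z + x)" for x
    unfolding U_def by (rule laplacian_translate)
  have bd: "\<bar>U x - v x\<bar> \<le> e'" if "x \<in> sphere z R" for x
    using U0(2)[of "- z + x"] that by (simp add: U_def dist_norm norm_minus_commute)
  have res: "\<bar>laplacian U x - \<mu>\<^sup>2 * U x\<bar> \<le> e'" if "x \<in> cball z R" for x
    using U0(3)[of "- z + x"] that unfolding lU unfolding U_def by (simp add: dist_norm norm_minus_commute)
  have half: "\<sigma> * (U x - v x) \<le> e" if \<sigma>: "\<bar>\<sigma>\<bar> = 1" and x: "x \<in> cball z R" for \<sigma> x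
  proof -
    let ?f = "\<lambda>x. \<sigma> * U x + (- \<sigma>) * v x"
    have cU: "continuous_on UNIV U" using td by (rule twice_differentiable_continuous)
    have "?f x \<le> e"
    proof (rule mean_laplacian_comparison[where z=z and R=R and
          l="\<lambda>y. \<sigma> * laplacian U y + (- \<sigma>) * (\<mu>\<^sup>2 * v y)"])
      show "continuous_on UNIV ?f" by (intro continuous_intros cU v)
      show "has_mean_laplacian ?f y (\<sigma> * laplacian U y + (- \<sigma>) * (\<mu>\<^sup>2 * v y))" if "y \<in> ball z R" for y
        by (intro has_mean_laplacian_add has_mean_laplacian_cmult has_mean_laplacian_laplacian td l that
            continuous_intros cU v)
      show "\<sigma> * laplacian U y + (- \<sigma>) * (\<mu>\<^sup>2 * v y) > 0" if y: "y \<in> ball z R" "?f y > e" for y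
      proof -
        have "\<sigma> * laplacian U y + (- \<sigma>) * (\<mu>\<^sup>2 * v y) = \<mu>\<^sup>2 * ?f y + \<sigma> * (laplacian U y - \<mu>\<^sup>2 * U y)"
          by (simp add: algebra_simps)
        moreover have "\<bar>\<sigma> * (laplacian U y - \<mu>\<^sup>2 * U y)\<bar> \<le> \<mu>\<^sup>2 * e"
          using res[of y] y(1) \<sigma> e'(3) by (simp add: abs_mult)
        moreover have "\<mu>\<^sup>2 * e < \<mu>\<^sup>2 * ?f y" using y(2) mu by (intro mult_strict_left_mono) auto
        ultimately show ?thesis by linarith
      qed
      show "?f y \<le> e" if "y \<in> sphere z R" for y
      proof -
        have "\<bar>\<sigma> * (U y - v y)\<bar> \<le> e" using bd[OF that] \<sigma> e'(2) by (simp add: abs_mult)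
        then show ?thesis by (simp add: algebra_simps abs_le_iff)
      qed
    qed (use x in auto)
    then show ?thesis by (simp add: algebra_simps)
  qed
  show thesis
  proof
    show "\<bar>U x - v x\<bar> \<le> e" if "x \<in> cball z R" for x
      using half[of 1, OF _ that] half[of "-1", OF _ that] by (simp add: abs_le_iff)
    show "\<bar>laplacian U x - \<mu>\<^sup>2 * U x\<bar> \<le> e" if "x \<in> cball z R" for x
      using res[OF that] e'(2) by simp
  qed fact
qed

section \<open>Averages of smooth functions weighted with powers of the bump\<close>

lemma bump_power_indicator: "bump y ^ Suc j * indicator (ball 0 1) y = bump y ^ Suc j"
  by (auto simp: indicator_def bump_eq_0)

lemma differentiable_real_derivative:
  assumes "f differentiable at (p + s *\<^sub>R q)"
  shows "((\<lambda>s. f (p + s *\<^sub>R q)) has_real_derivative (\<Sum>b\<in>Basis. (q \<bullet> b) * partial_deriv b f (p + s *\<^sub>R q))) (at s)"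
proof -
  have "((f \<circ> (\<lambda>s. p + s *\<^sub>R q)) has_derivative
      ((\<lambda>h. \<Sum>b\<in>Basis. (h \<bullet> b) * partial_deriv b f (p + s *\<^sub>R q)) \<circ> (\<lambda>h. h *\<^sub>R q))) (at s)"
    by (rule diff_chain_at[where f="\<lambda>s. p + s *\<^sub>R q" and x=s, OF _ has_derivative_partials[OF assms]])
      (auto intro!: derivative_eq_intros)
  then show ?thesis
    unfolding comp_def
    by (rule has_derivative_imp_has_field_derivative) (simp add: sum_distrib_left mult_ac)
qed

text \<open>Differentiating in \<open>t\<close> produces the radial factor y . grad f. Each y_b
  times a power of \<open>bump\<close> is, up to a constant, a partial derivative of the next power,
  so an integration by parts trades the factor for a second derivative of f and one more power of
  \<open>bump\<close>.\<close>

lemma bump_integral_derivative: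
  fixes f :: "'a::euclidean_space \<Rightarrow> real"
  assumes f: "twice_differentiable f" and t: "t > 0"
  shows "((\<lambda>t. LINT y|lborel. f (t *\<^sub>R y) * bump y ^ Suc j) has_real_derivative
     t / (2 * real (Suc (Suc j))) * (LINT y|lborel. laplacian f (t *\<^sub>R y) * bump y ^ Suc (Suc j))) (at t)"
proof -
  have fd: "f differentiable at x" for x using f by (simp add: twice_differentiable_def)
  have pd: "partial_deriv b f differentiable at x" if "b \<in> Basis" for b x
    using f that by (simp add: twice_differentiable_def)
  have cf: "continuous_on UNIV f" using f by (rule twice_differentiable_continuous)
  have cp: "continuous_on UNIV (partial_deriv b f)" if "b \<in> Basis" for b
    using twice_differentiable_continuous(2)[OF f that] .
  have cpp: "continuous_on UNIV (partial_deriv b (partial_deriv b f))" if "b \<in> Basis" for b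
    using f that by (simp add: twice_differentiable_def)
  note cc = continuous_on_compose2[where t=UNIV]
  \<comment> \<open>The translated average of a first partial is differentiated in two ways, once
    under the integral sign and once on the kernel; equating the results is the integration by
    parts.\<close>
  have parts: "(LINT y|lborel. partial_deriv b f (t *\<^sub>R y) * ((y \<bullet> b) * bump y ^ Suc j))
      = t / (2 * real (Suc (Suc j))) * (LINT y|lborel. partial_deriv b (partial_deriv b f) (t *\<^sub>R y) * bump y ^ Suc (Suc j))"
    if b: "b \<in> Basis" for b
  proof -
    have "((\<lambda>s. LINT y|lborel. partial_deriv b f (0 + s *\<^sub>R b + t *\<^sub>R y) * bump y ^ Suc (Suc j)) has_real_derivative
       (LINT y|lborel. partial_deriv b (partial_deriv b f) (0 + 0 *\<^sub>R b + t *\<^sub>R y) * bump y ^ Suc (Suc j))) (at 0)"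
    proof (rule has_derivative_kernel_integral[where F'="\<lambda>s y. partial_deriv b (partial_deriv b f) (0 + s *\<^sub>R b + t *\<^sub>R y)"])
      show "continuous_on UNIV (\<lambda>y. partial_deriv b f (0 + s *\<^sub>R b + t *\<^sub>R y))" for s
        by (rule cc[OF cp[OF b]]) (auto intro!: continuous_intros)
      show "continuous_on UNIV (\<lambda>(s, y). partial_deriv b (partial_deriv b f) (0 + s *\<^sub>R b + t *\<^sub>R y))"
        unfolding case_prod_beta by (rule cc[OF cpp[OF b]]) (auto intro!: continuous_intros)
      show "((\<lambda>s. partial_deriv b f (0 + s *\<^sub>R b + t *\<^sub>R y)) has_real_derivative
          partial_deriv b (partial_deriv b f) (0 + s *\<^sub>R b + t *\<^sub>R y)) (at s)" for s y
      proof -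
        have "(\<Sum>a\<in>Basis. (b \<bullet> a) * partial_deriv a (partial_deriv b f) (t *\<^sub>R y + s *\<^sub>R b))
            = (\<Sum>a\<in>Basis. if a = b then partial_deriv b (partial_deriv b f) (t *\<^sub>R y + s *\<^sub>R b) else 0)"
          using b by (intro sum.cong) (auto simp: inner_Basis)
        then show ?thesis
          using differentiable_real_derivative[OF pd[OF b], where p="t *\<^sub>R y" and q=b and s=s] b by (simp add: add.commute)
      qed
    qed (rule ball_kernel_bump_power, simp)
    from DERIV_unique[OF this bump_kernel_derivative[OF cp[OF b] t]]
    show ?thesis using t unfolding bump_power_indicator by (simp add: field_simps)
  qed
  have int: "integrable lborel (\<lambda>y. g (t *\<^sub>R y) * (h y * bump y ^ Suc j))"
    if "continuous_on UNIV g" "continuous_on UNIV h" for g h :: "'a \<Rightarrow> real" and j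
  proof -
    have "integrable lborel (\<lambda>y. (g (t *\<^sub>R y) * h y) * bump y ^ Suc j)"
      by (intro kernel_integrable ball_kernel_bump_power continuous_on_mult that cc[OF that(1)] continuous_intros) auto
    then show ?thesis by (simp only: mult.assoc)
  qed
  have ipp: "integrable lborel (\<lambda>y. partial_deriv b (partial_deriv b f) (t *\<^sub>R y) * bump y ^ Suc (Suc j))"
    if "b \<in> Basis" for b
    using int[OF cpp[OF that] continuous_on_const[of _ 1], of "Suc j"] by (simp only: mult_1)
  have "((\<lambda>t. LINT y|lborel. f (t *\<^sub>R y) * bump y ^ Suc j) has_real_derivative
     (LINT y|lborel. (\<Sum>b\<in>Basis. (y \<bullet> b) * partial_deriv b f (t *\<^sub>R y)) * bump y ^ Suc j)) (at t)"
  proof (rule has_derivative_kernel_integral[where F'="\<lambda>t y. \<Sum>b\<in>Basis. (y \<bullet> b) * partial_deriv b f (t *\<^sub>R y)"])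
    show "continuous_on UNIV (\<lambda>y. f (s *\<^sub>R y))" for s
      by (rule cc[OF cf]) (auto intro!: continuous_intros)
    show "continuous_on UNIV (\<lambda>(s, y). \<Sum>b\<in>Basis. (y \<bullet> b) * partial_deriv b f (s *\<^sub>R y))"
      unfolding case_prod_beta
      by (intro continuous_on_sum continuous_on_mult cc[OF cp]) (auto intro!: continuous_intros)
    show "((\<lambda>s. f (s *\<^sub>R y)) has_real_derivative (\<Sum>b\<in>Basis. (y \<bullet> b) * partial_deriv b f (s *\<^sub>R y))) (at s)" for s y
      using differentiable_real_derivative[OF fd, where p=0] by simp
  qed (rule ball_kernel_bump_power, simp)
  also have "(LINT y|lborel. (\<Sum>b\<in>Basis. (y \<bullet> b) * partial_deriv b f (t *\<^sub>R y)) * bump y ^ Suc j)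
      = (LINT y|lborel. (\<Sum>b\<in>Basis. partial_deriv b f (t *\<^sub>R y) * ((y \<bullet> b) * bump y ^ Suc j)))"
    by (simp add: sum_distrib_left sum_distrib_right mult_ac del: power_Suc)
  also have "\<dots> = (\<Sum>b\<in>Basis. LINT y|lborel. partial_deriv b f (t *\<^sub>R y) * ((y \<bullet> b) * bump y ^ Suc j))"
    by (intro Bochner_Integration.integral_sum int cp continuous_intros)
  also have "\<dots> = (\<Sum>b\<in>Basis. t / (2 * real (Suc (Suc j))) *
      (LINT y|lborel. partial_deriv b (partial_deriv b f) (t *\<^sub>R y) * bump y ^ Suc (Suc j)))"
    by (intro sum.cong refl parts)
  also have "\<dots> = t / (2 * real (Suc (Suc j))) *
      (LINT y|lborel. (\<Sum>b\<in>Basis. partial_deriv b (partial_deriv b f) (t *\<^sub>R y) * bump y ^ Suc (Suc j)))"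
    by (subst Bochner_Integration.integral_sum) (simp_all only: ipp sum_distrib_left)
  also have "(LINT y|lborel. (\<Sum>b\<in>Basis. partial_deriv b (partial_deriv b f) (t *\<^sub>R y) * bump y ^ Suc (Suc j)))
      = (LINT y|lborel. laplacian f (t *\<^sub>R y) * bump y ^ Suc (Suc j))"
    by (simp add: laplacian_def sum_distrib_right)
  finally show ?thesis .
qed

text \<open>Since \<open>bump \<le> 1\<close>, the first power dominates all higher ones. The
  constant is thus the same for every exponent, as an iteration that raises the exponent
  requires.\<close>

lemma bump_integral_bound:
  fixes g :: "'a::euclidean_space \<Rightarrow> real"
  assumes "continuous_on UNIV g" "\<And>y. norm y \<le> 1 \<Longrightarrow> \<bar>g y\<bar> \<le> M"
  shows "\<bar>LINT y|lborel. g y * bump y ^ Suc j\<bar> \<le> M * (LINT y|lborel. bump (y::'a))"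
proof -
  have "norm (LINT y|lborel. g y * bump y ^ Suc j) \<le> (LINT y|lborel. M * bump (y::'a) ^ 1)"
  proof (rule Bochner_Integration.integral_norm_bound_integral)
    show "integrable lborel (\<lambda>y. g y * bump y ^ Suc j)"
      by (intro kernel_integrable ball_kernel_bump_power assms) auto
    show "integrable lborel (\<lambda>y::'a. M * bump y ^ 1)"
      by (intro kernel_integrable ball_kernel_bump_power continuous_intros) auto
    show "norm (g y * bump y ^ Suc j) \<le> M * bump y ^ 1" for y
    proof (cases "norm y \<le> 1")
      case True
      have "bump y ^ Suc j \<le> bump y ^ 1" using bump_bounds[of y] by (intro power_decreasing) auto
      then have "\<bar>g y\<bar> * \<bar>bump y ^ Suc j\<bar> \<le> M * bump y ^ 1"
        using assms(2)[OF True] bump_bounds[of y] by (intro mult_mono) auto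
      then show ?thesis by (simp only: real_norm_def abs_mult)
    qed (simp add: bump_eq_0)
  qed
  then show ?thesis by simp
qed

lemma bump_integral_nonneg: "0 \<le> (LINT y|lborel. bump (y::'a::euclidean_space))"
  by (intro Bochner_Integration.integral_nonneg) (simp add: bump_bounds)

text \<open>The integrals against the powers of \<open>bump\<close> are controlled by each other through
  the derivative formula; iterating gains a factor 2 each time.\<close>

lemma bump_integral_small:
  fixes f :: "'a::euclidean_space \<Rightarrow> real"
  assumes f: "twice_differentiable f" and d: "\<delta> > 0" "\<delta> \<le> 1" "\<mu>\<^sup>2 * \<delta>\<^sup>2 \<le> 1"
    and f0: "\<bar>f 0\<bar> \<le> e" and res: "\<And>x. norm x \<le> \<delta> \<Longrightarrow> \<bar>laplacian f x - \<mu>\<^sup>2 * f x\<bar> \<le> e"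
  shows "\<bar>LINT y|lborel. f (\<delta> *\<^sub>R y) * bump y ^ Suc j\<bar> \<le> 2 * e * (LINT y|lborel. bump (y::'a))"
proof -
  let ?K = "LINT y|lborel. bump (y::'a)"
  let ?A = "\<lambda>j t. LINT y|lborel. f (t *\<^sub>R y) * bump y ^ Suc j"
  have cf: "continuous_on UNIV f" and cl: "continuous_on UNIV (laplacian f)"
    using f by (rule twice_differentiable_continuous)+
  have e: "e \<ge> 0" using f0 by simp
  have K: "?K \<ge> 0" by (rule bump_integral_nonneg)
  have "bounded (f ` cball 0 \<delta>)"
    by (intro compact_imp_bounded compact_continuous_image continuous_on_subset[OF cf]) auto
  then obtain M where "M > 0" "\<forall>x\<in>f ` cball 0 \<delta>. norm x \<le> M"
    unfolding bounded_pos by blast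
  then have M: "\<And>y. norm y \<le> \<delta> \<Longrightarrow> \<bar>f y\<bar> \<le> M" "M > 0"
    by auto
  have small: "norm (t *\<^sub>R y) \<le> \<delta>" if "t \<in> {0..\<delta>}" "norm y \<le> 1" for t and y :: 'a
    using mult_mono[of t \<delta> "norm y" 1] that by simp
  have comp: "continuous_on UNIV (\<lambda>y. g (t *\<^sub>R y))" if "continuous_on UNIV g" for g :: "'a \<Rightarrow> real" and t
    by (rule continuous_on_compose2[OF that]) (auto intro!: continuous_intros)
  \<comment> \<open>Exponent and radius must be general: the induction step passes from
    \<open>j\<close> to \<open>Suc j\<close> and from \<open>t\<close> to a smaller radius.\<close>
  have ind: "\<bar>?A j t\<bar> \<le> ?K * (M / 2 ^ n + 2 * e)" if "t \<in> {0..\<delta>}" for j n t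
    using that
  proof (induction n arbitrary: j t)
    case 0
    have "\<bar>?A j t\<bar> \<le> M * ?K"
      by (rule bump_integral_bound[OF comp[OF cf]]) (use small[OF 0] M in auto)
    also have "\<dots> \<le> ?K * (M / 2 ^ 0 + 2 * e)" using K e by (simp add: algebra_simps)
    finally show ?case .
  next
    case (Suc n)
    define B where "B = ?K * (M / 2 ^ n + 2 * e)"
    let ?D = "\<lambda>s. s / (2 * real (Suc (Suc j))) * (LINT y|lborel. laplacian f (s *\<^sub>R y) * bump y ^ Suc (Suc j))"
    \<comment> \<open>The 4 is a lower bound for \<open>2 * real (Suc (Suc j))\<close>, uniform in
      \<open>j\<close>.\<close>
    have D: "\<bar>?D s\<bar> \<le> s / 4 * (\<mu>\<^sup>2 * B + e * ?K)" if s: "s \<in> {0<..<t}" for s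
    proof -
      have s': "s \<in> {0..\<delta>}" using s Suc.prems by auto
      have "(LINT y|lborel. laplacian f (s *\<^sub>R y) * bump y ^ Suc (Suc j))
          = (LINT y|lborel. \<mu>\<^sup>2 * (f (s *\<^sub>R y) * bump y ^ Suc (Suc j)) + (laplacian f (s *\<^sub>R y) - \<mu>\<^sup>2 * f (s *\<^sub>R y)) * bump y ^ Suc (Suc j))"
        by (simp add: left_diff_distrib mult.assoc)
      also have "\<dots> = \<mu>\<^sup>2 * ?A (Suc j) s + (LINT y|lborel. (laplacian f (s *\<^sub>R y) - \<mu>\<^sup>2 * f (s *\<^sub>R y)) * bump y ^ Suc (Suc j))"
        unfolding integral_mult_right_zero[symmetric]
        by (intro Bochner_Integration.integral_add integrable_mult_right kernel_integrable ball_kernel_bump_power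
            continuous_intros comp cf cl) auto
      finally have "\<bar>LINT y|lborel. laplacian f (s *\<^sub>R y) * bump y ^ Suc (Suc j)\<bar>
          \<le> \<bar>\<mu>\<^sup>2 * ?A (Suc j) s\<bar> + \<bar>LINT y|lborel. (laplacian f (s *\<^sub>R y) - \<mu>\<^sup>2 * f (s *\<^sub>R y)) * bump y ^ Suc (Suc j)\<bar>"
        by linarith
      also have "\<dots> \<le> \<mu>\<^sup>2 * B + e * ?K"
      proof (rule add_mono)
        show "\<bar>\<mu>\<^sup>2 * ?A (Suc j) s\<bar> \<le> \<mu>\<^sup>2 * B"
          unfolding abs_mult abs_of_nonneg[OF zero_le_power2] B_def by (intro mult_left_mono Suc.IH s') auto
        show "\<bar>LINT y|lborel. (laplacian f (s *\<^sub>R y) - \<mu>\<^sup>2 * f (s *\<^sub>R y)) * bump y ^ Suc (Suc j)\<bar> \<le> e * ?K"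
          by (intro bump_integral_bound continuous_intros comp cf cl res small s')
      qed
      finally have *: "\<bar>LINT y|lborel. laplacian f (s *\<^sub>R y) * bump y ^ Suc (Suc j)\<bar> \<le> \<mu>\<^sup>2 * B + e * ?K" .
      have "\<bar>?D s\<bar> = s / (2 * real (Suc (Suc j))) * \<bar>LINT y|lborel. laplacian f (s *\<^sub>R y) * bump y ^ Suc (Suc j)\<bar>"
        using s by (simp add: abs_mult)
      also have "\<dots> \<le> s / 4 * (\<mu>\<^sup>2 * B + e * ?K)"
        using s * by (intro mult_mono divide_left_mono) auto
      finally show ?thesis .
    qed
    have A0: "\<bar>?A j 0\<bar> \<le> e * ?K"
      by (intro bump_integral_bound) (use f0 in auto)
    have BK: "B \<ge> 0" using K e M(2) by (simp add: B_def)
    have "\<bar>?A j t - ?A j 0\<bar> \<le> (B + e * ?K) / 4"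
    proof (cases "t = 0")
      case True
      then show ?thesis using BK e K by simp
    next
      case False
      then have t: "t > 0" "t \<le> \<delta>" using Suc.prems by auto
      have "continuous_on UNIV (?A j)"
        by (rule continuous_kernel_integral[where F="\<lambda>t y. f (t *\<^sub>R y)"])
          (auto simp: case_prod_beta ball_kernel_bump_power simp del: power_Suc
            intro!: continuous_on_compose2[OF cf] continuous_intros)
      then have cA: "continuous_on {0..t} (?A j)" by (rule continuous_on_subset) auto
      \<comment> \<open>The derivative formula holds for positive radii; the endpoint 0, where the
        integral is known, enters through continuity.\<close>
      obtain s where s: "0 < s" "s < t" "?A j t - ?A j 0 = ?D s * (t - 0)"
      proof (rule mvt[OF t(1) cA, of "\<lambda>s h. ?D s * h"])
        show "(?A j has_derivative (\<lambda>h. ?D s * h)) (at s)" if "0 < s" "s < t" for s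
          using bump_integral_derivative[OF f that(1)] by (simp only: has_field_derivative_def)
      qed blast
      have "\<bar>?A j t - ?A j 0\<bar> = t * \<bar>?D s\<bar>" using t by (simp only: s(3) abs_mult) simp
      also have "\<dots> \<le> t * (s / 4 * (\<mu>\<^sup>2 * B + e * ?K))"
        using D[of s] s t by (intro mult_left_mono) auto
      also have "\<dots> \<le> \<delta> * (\<delta> / 4 * (\<mu>\<^sup>2 * B + e * ?K))"
        using s t BK e K by (intro mult_mono) auto
      also have "\<dots> = (\<mu>\<^sup>2 * \<delta>\<^sup>2 * B + \<delta>\<^sup>2 * (e * ?K)) / 4"
        by (simp add: power2_eq_square algebra_simps)
      also have "\<dots> \<le> (1 * B + 1 * (e * ?K)) / 4"
        using d BK e K by (intro divide_right_mono add_mono mult_right_mono) (auto simp: power_le_one)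
      finally show ?thesis by simp
    qed
    with A0 have "\<bar>?A j t\<bar> \<le> e * ?K + (B + e * ?K) / 4" by linarith
    also have "\<dots> \<le> ?K * (M / 2 ^ Suc n + 2 * e)"
    proof -
      \<comment> \<open>The constant 2 e is stable under the step because e + (2 e + e) / 4 is at
        most 2 e, while the part with \<open>M\<close> is even divided by 4.\<close>
      have "?K * (M / 2 ^ Suc n + 2 * e) - (e * ?K + (B + e * ?K) / 4) = ?K * (M / 2 ^ n) / 4 + e * ?K / 4"
        by (simp add: B_def field_simps)
      moreover have "?K * (M / 2 ^ n) / 4 + e * ?K / 4 \<ge> 0" using K M(2) e by simp
      ultimately show ?thesis by linarith
    qed
    finally show ?case .
  qed
  have "(\<lambda>n. ?K * (M / 2 ^ n + 2 * e)) \<longlonglongrightarrow> ?K * (0 + 2 * e)"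
  proof (intro tendsto_intros)
    show "(\<lambda>n. M / 2 ^ n) \<longlonglongrightarrow> 0"
      using tendsto_mult_right_zero[OF LIMSEQ_realpow_zero[of "1/2"], of M] by (simp add: power_divide)
  qed
  then have "\<bar>?A j \<delta>\<bar> \<le> ?K * (0 + 2 * e)"
    using ind[of \<delta>] d by (intro LIMSEQ_le_const) auto
  then show ?thesis by (simp add: mult_ac)
qed

section \<open>The reproducing formula and regularity\<close>

lemma twice_differentiable_exp_inner:
  fixes c :: "'a::euclidean_space"
  shows "twice_differentiable (\<lambda>y. exp (\<mu> * (y \<bullet> c)))"
    and "laplacian (\<lambda>y. exp (\<mu> * (y \<bullet> c))) x = \<mu>\<^sup>2 * (norm c)\<^sup>2 * exp (\<mu> * (x \<bullet> c))"
proof -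
  let ?E = "\<lambda>y. exp (\<mu> * (y \<bullet> c))"
  have D: "((\<lambda>y. k * ?E y) has_derivative (\<lambda>h. k * (?E x * (\<mu> * (h \<bullet> c))))) (at x)" for k x
    by (auto intro!: derivative_eq_intros)
  have diff: "(\<lambda>y. k * ?E y) differentiable at x" for k x
    using D by (auto simp: differentiable_def)
  have p: "partial_deriv b (\<lambda>y. k * ?E y) = (\<lambda>y. (k * (\<mu> * (b \<bullet> c))) * ?E y)" for b k
    by (rule ext, subst partial_deriv_eq[OF D]) simp
  have p1: "partial_deriv b ?E = (\<lambda>y. (\<mu> * (b \<bullet> c)) * ?E y)" for b
    using p[of b 1] by simp
  show "twice_differentiable ?E"
    unfolding twice_differentiable_def p1 p using diff[of 1] diff
    by (auto intro!: continuous_intros)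
  have "laplacian ?E x = (\<Sum>b\<in>Basis. (\<mu> * (b \<bullet> c) * (\<mu> * (b \<bullet> c))) * ?E x)"
    unfolding laplacian_def p1 p ..
  also have "\<dots> = \<mu>\<^sup>2 * (\<Sum>b\<in>Basis. (c \<bullet> b) * (c \<bullet> b)) * ?E x"
    by (simp add: sum_distrib_left sum_distrib_right power2_eq_square mult_ac inner_commute)
  also have "(\<Sum>b\<in>Basis. (c \<bullet> b) * (c \<bullet> b)) = (norm c)\<^sup>2"
    by (simp add: power2_norm_eq_inner euclidean_inner[symmetric])
  finally show "laplacian ?E x = \<mu>\<^sup>2 * (norm c)\<^sup>2 * ?E x" .
qed

text \<open>It allows division by the constant of the reproducing formula. A vanishing integral
  would force the nonnegative integrand to be 0 almost everywhere, making the unit ball a null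
  set.\<close>

lemma ball_kernel_integral_pos:
  fixes g :: "'a::euclidean_space \<Rightarrow> real"
  assumes g: "continuous_on UNIV g" "\<And>y. g y > 0"
  shows "(LINT y|lborel. g y * bump y ^ Suc j) > 0"
proof -
  have int: "integrable lborel (\<lambda>y. g y * bump y ^ Suc j)"
    by (intro kernel_integrable ball_kernel_bump_power g) auto
  have nn: "0 \<le> g y * bump y ^ Suc j" for y
    using g(2)[of y] bump_bounds[of y] by simp
  have "(LINT y|lborel. g y * bump y ^ Suc j) \<noteq> 0"
  proof
    assume "(LINT y|lborel. g y * bump y ^ Suc j) = 0"
    then have "AE y in lborel. g y * bump y ^ Suc j = 0"
      using integral_nonneg_eq_0_iff_AE[OF int] nn by simp
    then have "AE y in lborel. y \<notin> ball (0::'a) 1"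
    proof eventually_elim
      fix y :: 'a assume "g y * bump y ^ Suc j = 0"
      then have "bump y = 0" using g(2)[of y] by auto
      then show "y \<notin> ball 0 1" using abs_square_less_1[of "norm y"] by (auto simp: bump_def)
    qed
    then have "ball (0::'a) 1 \<in> null_sets lborel"
      by (subst AE_iff_null_sets) auto
    then have "emeasure lborel (ball (0::'a) 1) = 0" by (rule null_setsD1)
    then show False
      using unit_vol_pos[where ?'a='a] by (simp add: unit_vol_def measure_def)
  qed
  moreover have "(LINT y|lborel. g y * bump y ^ Suc j) \<ge> 0"
    by (intro Bochner_Integration.integral_nonneg nn)
  ultimately show ?thesis by linarith
qed

text \<open>The function U(x + y) - U(x) exp (mu (y . c)) vanishes at 0 and has the same residual as
  U, so its weighted average is at most 2 e K. Replacing U by v costs e K under the integral and e E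
  at the centre. The defect is thus at most e (3 K + E) for every e > 0.\<close>

lemma bump_reproducing:
  fixes v :: "'a::euclidean_space \<Rightarrow> real" and c :: 'a
  assumes R: "R > 0" and small: "\<mu>\<^sup>2 * R\<^sup>2 / DIM('a) \<le> 1 / 2" and mu: "\<mu> \<noteq> 0"
    and v: "continuous_on UNIV v" and l: "\<And>x. x \<in> ball z R \<Longrightarrow> has_mean_laplacian v x (\<mu>\<^sup>2 * v x)"
    and d: "\<delta> > 0" "\<delta> \<le> 1" "\<mu>\<^sup>2 * \<delta>\<^sup>2 \<le> 1" and x: "cball x \<delta> \<subseteq> cball z R"
    and c: "norm c = 1"
  shows "(LINT y|lborel. v (x + \<delta> *\<^sub>R y) * bump y ^ Suc j)
     = v x * (LINT y|lborel. exp (\<mu> * ((\<delta> *\<^sub>R y) \<bullet> c)) * bump y ^ Suc j)"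
proof -
  let ?K = "LINT y|lborel. bump (y::'a)"
  let ?E = "LINT y|lborel. exp (\<mu> * ((\<delta> *\<^sub>R y) \<bullet> c)) * bump y ^ Suc j"
  let ?V = "LINT y|lborel. v (x + \<delta> *\<^sub>R y) * bump y ^ Suc j"
  have K: "?K \<ge> 0" by (rule bump_integral_nonneg)
  have E: "?E > 0" by (intro ball_kernel_integral_pos continuous_intros) auto
  have comp: "continuous_on UNIV (\<lambda>y. g (x + \<delta> *\<^sub>R y))" if "continuous_on UNIV g" for g :: "'a \<Rightarrow> real"
    by (rule continuous_on_compose2[OF that]) (auto intro!: continuous_intros)
  have bound: "\<bar>?V - v x * ?E\<bar> \<le> e * (3 * ?K + ?E)" if e: "e > 0" for e
  proof -
    obtain U where U: "twice_differentiable U" "\<And>x. x \<in> cball z R \<Longrightarrow> \<bar>U x - v x\<bar> \<le> e"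
      "\<And>x. x \<in> cball z R \<Longrightarrow> \<bar>laplacian U x - \<mu>\<^sup>2 * U x\<bar> \<le> e"
      by (rule helmholtz_approximation[OF R small mu v _ e, where z=z]) (erule l | rule that)+
    have cU: "continuous_on UNIV U" using U(1) by (rule twice_differentiable_continuous)
    let ?f = "\<lambda>y. U (x + y) + (- U x) * exp (\<mu> * (y \<bullet> c))"
    note td = twice_differentiable_translate[OF U(1), of x]
      twice_differentiable_cmult(1)[OF twice_differentiable_exp_inner(1), of "- U x" \<mu> c]
    have lap: "laplacian ?f y - \<mu>\<^sup>2 * ?f y = laplacian U (x + y) - \<mu>\<^sup>2 * U (x + y)" for y
      unfolding twice_differentiable_add(2)[OF td] laplacian_translate
        twice_differentiable_cmult(2)[OF twice_differentiable_exp_inner(1)] twice_differentiable_exp_inner(2) c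
      by (simp add: algebra_simps)
    have "\<bar>LINT y|lborel. ?f (\<delta> *\<^sub>R y) * bump y ^ Suc j\<bar> \<le> 2 * e * ?K"
    proof (rule bump_integral_small[OF twice_differentiable_add(1)[OF td] d])
      show "\<bar>laplacian ?f y - \<mu>\<^sup>2 * ?f y\<bar> \<le> e" if "norm y \<le> \<delta>" for y
      proof -
        have "x + y \<in> cball x \<delta>" using that by (simp add: dist_norm)
        with x have "x + y \<in> cball z R" by blast
        then show ?thesis unfolding lap by (rule U(3))
      qed
    qed (use e in simp)
    also have "(LINT y|lborel. ?f (\<delta> *\<^sub>R y) * bump y ^ Suc j)
        = (LINT y|lborel. U (x + \<delta> *\<^sub>R y) * bump y ^ Suc j + (- U x) * (exp (\<mu> * ((\<delta> *\<^sub>R y) \<bullet> c)) * bump y ^ Suc j))"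
      by (simp only: distrib_right mult.assoc)
    also have "\<dots> = (LINT y|lborel. U (x + \<delta> *\<^sub>R y) * bump y ^ Suc j) + (- U x) * ?E"
      unfolding integral_mult_right_zero[symmetric]
      by (intro Bochner_Integration.integral_add integrable_mult_right kernel_integrable ball_kernel_bump_power
          continuous_intros comp cU) auto
    finally have 1: "\<bar>(LINT y|lborel. U (x + \<delta> *\<^sub>R y) * bump y ^ Suc j) + (- U x) * ?E\<bar> \<le> 2 * e * ?K" .
    have "\<bar>LINT y|lborel. (v (x + \<delta> *\<^sub>R y) - U (x + \<delta> *\<^sub>R y)) * bump y ^ Suc j\<bar> \<le> e * ?K"
    proof (rule bump_integral_bound)
      show "\<bar>v (x + \<delta> *\<^sub>R y) - U (x + \<delta> *\<^sub>R y)\<bar> \<le> e" if "norm y \<le> 1" for y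
      proof -
        have "x + \<delta> *\<^sub>R y \<in> cball x \<delta>" using that d by (simp add: dist_norm mult_left_le)
        with x have "x + \<delta> *\<^sub>R y \<in> cball z R" by blast
        from U(2)[OF this] show ?thesis by (simp add: abs_minus_commute)
      qed
    qed (intro continuous_intros comp v cU)
    also have "(LINT y|lborel. (v (x + \<delta> *\<^sub>R y) - U (x + \<delta> *\<^sub>R y)) * bump y ^ Suc j)
        = ?V - (LINT y|lborel. U (x + \<delta> *\<^sub>R y) * bump y ^ Suc j)"
      unfolding left_diff_distrib
      by (intro Bochner_Integration.integral_diff kernel_integrable ball_kernel_bump_power comp v cU) auto
    finally have 2: "\<bar>?V - (LINT y|lborel. U (x + \<delta> *\<^sub>R y) * bump y ^ Suc j)\<bar> \<le> e * ?K" .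
    have "x \<in> cball x \<delta>" using d by simp
    with x have "x \<in> cball z R" by blast
    then have "\<bar>U x - v x\<bar> * ?E \<le> e * ?E" using E by (intro mult_right_mono U(2)) auto
    then have 3: "\<bar>U x * ?E - v x * ?E\<bar> \<le> e * ?E"
      using E by (simp only: left_diff_distrib[symmetric] abs_mult abs_of_pos)
    from 1 2 3 show ?thesis by (simp add: algebra_simps)
  qed
  show ?thesis
  proof (rule ccontr)
    assume "?V \<noteq> v x * ?E"
    then have pos: "\<bar>?V - v x * ?E\<bar> > 0" by simp
    have half: "a / 2 < a" if "a > 0" for a :: real using that by simp
    have q: "3 * ?K + ?E > 0" using K E by linarith
    \<comment> \<open>This tolerance makes the bound equal to half the defect itself.\<close>
    have "\<bar>?V - v x * ?E\<bar> \<le> (\<bar>?V - v x * ?E\<bar> / (2 * (3 * ?K + ?E))) * (3 * ?K + ?E)"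
      using pos q by (intro bound) auto
    also have "\<dots> = \<bar>?V - v x * ?E\<bar> / 2" using q by (simp add: field_simps)
    also have "\<dots> < \<bar>?V - v x * ?E\<bar>"
      using half[OF pos] .
    finally show False by (rule notE[OF less_irrefl])
  qed
qed

section \<open>From kernel derivatives to total derivatives\<close>

lemma inner_bump_lipschitz:
  fixes y z e :: "'a::euclidean_space"
  assumes "j > 0"
  shows "\<bar>(y \<bullet> e) * bump y ^ j - (z \<bullet> e) * bump z ^ j\<bar> \<le> (norm e * (1 + 2 * real j)) * norm (y - z)"
proof -
  \<comment> \<open>The factor \<open>z \<bullet> e\<close> is bounded only inside the ball, so the
    difference is expanded around whichever point lies there. If neither does, both terms
    vanish.\<close>
  have *: "\<bar>(y \<bullet> e) * bump y ^ j - (z \<bullet> e) * bump z ^ j\<bar> \<le> (norm e * (1 + 2 * real j)) * norm (y - z)"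
    if z: "norm z \<le> 1" for y z :: 'a
  proof -
    have "(y \<bullet> e) * bump y ^ j - (z \<bullet> e) * bump z ^ j = ((y - z) \<bullet> e) * bump y ^ j + (z \<bullet> e) * (bump y ^ j - bump z ^ j)"
      by (simp add: algebra_simps inner_diff_left)
    also have "\<bar>\<dots>\<bar> \<le> \<bar>(y - z) \<bullet> e\<bar> * \<bar>bump y ^ j\<bar> + \<bar>z \<bullet> e\<bar> * \<bar>bump y ^ j - bump z ^ j\<bar>"
      by (metis abs_mult abs_triangle_ineq)
    also have "\<dots> \<le> (norm (y - z) * norm e) * 1 + (1 * norm e) * ((2 * real j) * norm (y - z))"
    proof (intro add_mono mult_mono bump_power_lipschitz Cauchy_Schwarz_ineq2)
      show "\<bar>bump y ^ j\<bar> \<le> 1" using bump_bounds[of y] by (simp add: power_le_one)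
      show "\<bar>z \<bullet> e\<bar> \<le> 1 * norm e"
        using Cauchy_Schwarz_ineq2[of z e] mult_right_mono[OF z, of "norm e"] by auto
    qed auto
    finally show ?thesis by (simp add: algebra_simps)
  qed
  consider "norm z \<le> 1" | "norm y \<le> 1" | "norm y > 1" "norm z > 1" by linarith
  then show ?thesis
  proof cases
    case 1
    then show ?thesis by (rule *)
  next
    case 2
    from *[OF this, of z] show ?thesis by (simp add: norm_minus_commute abs_minus_commute)
  next
    case 3
    then show ?thesis using assms by (simp add: bump_eq_0 zero_power)
  qed
qed

lemma inner_bump_deriv:
  fixes y a e :: "'a::euclidean_space"
  assumes "norm y \<noteq> 1"
  shows "((\<lambda>s. ((y + s *\<^sub>R a) \<bullet> e) * bump (y + s *\<^sub>R a) ^ 2) has_real_derivative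
     (a \<bullet> e) * bump y ^ 2 - 4 * (y \<bullet> e) * (y \<bullet> a) * bump y) (at 0)"
proof -
  have 1: "((\<lambda>s. (y + s *\<^sub>R a) \<bullet> e) has_real_derivative a \<bullet> e) (at 0)"
    by (auto intro!: derivative_eq_intros simp: inner_add_left)
  have "((\<lambda>s. bump (y + s *\<^sub>R a) ^ 2) has_real_derivative - 4 * (y \<bullet> a) * bump y) (at 0)"
    using bump_power_deriv[OF assms, of a "Suc 0"] unfolding bump_power_indicator by (simp add: numeral_2_eq_2)
  from DERIV_mult[OF 1 this] show ?thesis by (simp add: algebra_simps)
qed

text \<open>Continuity of the coefficients keeps the directional derivatives almost constant along a
  short segment, and the mean value inequality concludes. It is the link between kernel
  differentiation, which yields derivatives along lines, and Taylor's formula, which starts from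
  total derivatives.\<close>

lemma gateaux_imp_has_derivative:
  fixes f :: "'a::euclidean_space \<Rightarrow> real"
  assumes S: "open S" "x \<in> S"
    and D: "\<And>z h. z \<in> S \<Longrightarrow> ((\<lambda>s. f (z + s *\<^sub>R h)) has_real_derivative (\<Sum>b\<in>Basis. (h \<bullet> b) * G b z)) (at 0)"
    and G: "\<And>b. b \<in> Basis \<Longrightarrow> continuous_on S (G b)"
  shows "(f has_derivative (\<lambda>h. \<Sum>b\<in>Basis. (h \<bullet> b) * G b x)) (at x)"
  unfolding has_derivative_at_alt
proof (intro conjI allI impI)
  show "bounded_linear (\<lambda>h. \<Sum>b\<in>Basis. (h \<bullet> b) * G b x)"
    by (intro bounded_linear_sum bounded_linear_mult_const bounded_linear_inner_left)
  fix e :: real assume e: "e > 0"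
  define e' where "e' = e / DIM('a)"
  have e': "e' > 0" using e by (simp add: e'_def)
  have "\<forall>b\<in>Basis. \<forall>\<^sub>F z in at x. \<bar>G b z - G b x\<bar> < e'"
  proof
    fix b :: 'a assume "b \<in> Basis"
    then have "isCont (G b) x" using G S by (simp add: continuous_on_eq_continuous_at)
    then show "\<forall>\<^sub>F z in at x. \<bar>G b z - G b x\<bar> < e'"
      using e' by (auto simp: isCont_def tendsto_iff dist_real_def)
  qed
  then have "\<forall>\<^sub>F z in at x. \<forall>b\<in>Basis. \<bar>G b z - G b x\<bar> < e'"
    by (intro eventually_ball_finite) auto
  then obtain d1 where d1: "d1 > 0" "\<And>z b. z \<noteq> x \<Longrightarrow> dist z x < d1 \<Longrightarrow> b \<in> Basis \<Longrightarrow> \<bar>G b z - G b x\<bar> < e'"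
    unfolding eventually_at by blast
  obtain d2 where d2: "d2 > 0" "ball x d2 \<subseteq> S" using S by (meson openE)
  show "\<exists>d>0. \<forall>y. norm (y - x) < d \<longrightarrow> norm (f y - f x - (\<Sum>b\<in>Basis. ((y - x) \<bullet> b) * G b x)) \<le> e * norm (y - x)"
  proof (intro exI[of _ "min d1 d2"] conjI allI impI)
    fix y assume y: "norm (y - x) < min d1 d2"
    define h where "h = y - x"
    let ?\<phi> = "\<lambda>s. f (x + s *\<^sub>R h) - s * (\<Sum>b\<in>Basis. (h \<bullet> b) * G b x)"
    let ?\<phi>' = "\<lambda>s. \<Sum>b\<in>Basis. (h \<bullet> b) * (G b (x + s *\<^sub>R h) - G b x)"
    have near: "dist (x + s *\<^sub>R h) x < min d1 d2" if "s \<in> {0..1}" for s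
    proof -
      have "\<bar>s\<bar> * norm h \<le> 1 * norm h" using that by (intro mult_right_mono) auto
      with y show ?thesis by (simp add: dist_norm h_def)
    qed
    have der: "(?\<phi> has_real_derivative ?\<phi>' s) (at s)" if "s \<in> {0..1}" for s
    proof -
      have "x + s *\<^sub>R h \<in> S" using near[OF that] d2 by (auto simp: dist_commute)
      from D[OF this, of h]
      have "((\<lambda>u. f (x + (u + s) *\<^sub>R h)) has_real_derivative (\<Sum>b\<in>Basis. (h \<bullet> b) * G b (x + s *\<^sub>R h))) (at 0)"
        by (simp add: algebra_simps)
      then have "((\<lambda>u. f (x + u *\<^sub>R h)) has_real_derivative (\<Sum>b\<in>Basis. (h \<bullet> b) * G b (x + s *\<^sub>R h))) (at s)"
        using DERIV_shift[of "\<lambda>u. f (x + u *\<^sub>R h)" _ 0 s] by simp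
      then have "(?\<phi> has_real_derivative (\<Sum>b\<in>Basis. (h \<bullet> b) * G b (x + s *\<^sub>R h)) - (\<Sum>b\<in>Basis. (h \<bullet> b) * G b x)) (at s)"
        by (auto intro!: derivative_eq_intros)
      then show ?thesis by (simp add: right_diff_distrib sum_subtractf)
    qed
    have bnd: "norm (?\<phi>' s) \<le> e * norm h" if s: "s \<in> {0..1}" for s
    proof -
      have "norm (?\<phi>' s) \<le> (\<Sum>b\<in>(Basis::'a set). norm h * e')"
        unfolding real_norm_def
      proof (rule order_trans[OF sum_abs sum_mono])
        fix b :: 'a assume b: "b \<in> Basis"
        have "\<bar>G b (x + s *\<^sub>R h) - G b x\<bar> \<le> e'"
          using d1(2)[of "x + s *\<^sub>R h" b] near[OF s] b e' by (cases "x + s *\<^sub>R h = x") auto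
        then show "\<bar>(h \<bullet> b) * (G b (x + s *\<^sub>R h) - G b x)\<bar> \<le> norm h * e'"
          unfolding abs_mult using b by (intro mult_mono Basis_le_norm) auto
      qed
      then show ?thesis by (simp add: e'_def mult_ac)
    qed
    have "norm (?\<phi> 1 - ?\<phi> 0) \<le> e * norm h * norm (1 - 0 :: real)"
    proof (rule field_differentiable_bound[where S="{0..1}" and f'="?\<phi>'"])
      show "(?\<phi> has_real_derivative ?\<phi>' s) (at s within {0..1})" if "s \<in> {0..1}" for s
        using der[OF that] by (rule has_field_derivative_at_within)
      show "norm (?\<phi>' s) \<le> e * norm h" if "s \<in> {0..1}" for s
        using that by (rule bnd)
    qed auto
    then show "norm (f y - f x - (\<Sum>b\<in>Basis. ((y - x) \<bullet> b) * G b x)) \<le> e * norm (y - x)"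
      by (simp add: h_def)
  qed (use d1 d2 in auto)
qed

lemma partial_deriv_eqI:
  "((\<lambda>t. f (x + t *\<^sub>R b)) has_real_derivative l) (at 0) \<Longrightarrow> partial_deriv b f x = l"
  unfolding partial_deriv_def by (rule DERIV_imp_deriv)

lemma helmholtz_local:
  fixes v :: "'a::euclidean_space \<Rightarrow> real"
  assumes R: "R > 0" and mu: "\<mu> \<noteq> 0" and v: "continuous_on UNIV v"
    and l: "\<And>x. x \<in> ball z R \<Longrightarrow> has_mean_laplacian v x (\<mu>\<^sup>2 * v x)"
  obtains r where "r > 0" "C2_on (ball z r) v" "\<And>x. x \<in> ball z r \<Longrightarrow> laplacian v x = \<mu>\<^sup>2 * v x"
proof -
  \<comment> \<open>The bound \<open>R' \<le> 1\<close> together with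
    \<open>\<bar>\<mu>\<bar> * R' \<le> 1 / 2\<close> meets every smallness condition of the
    approximation and of the reproducing formula. Halving gives a \<delta> for which the
    \<delta>-ball about any point of \<open>ball z \<delta>\<close> stays in
    \<open>cball z R'\<close>.\<close>
  define R' where "R' = min (min R 1) (1 / (2 * \<bar>\<mu>\<bar>))"
  define \<delta> where "\<delta> = R' / 2"
  have R': "R' > 0" "R' \<le> R" "R' \<le> 1" using R mu by (auto simp: R'_def)
  have "\<bar>\<mu>\<bar> * R' \<le> \<bar>\<mu>\<bar> * (1 / (2 * \<bar>\<mu>\<bar>))"
    using mu by (intro mult_left_mono) (auto simp: R'_def)
  then have muR: "\<bar>\<mu>\<bar> * R' \<le> 1 / 2" using mu by simp
  have "(\<bar>\<mu>\<bar> * R')\<^sup>2 \<le> (1 / 2)\<^sup>2" using muR R' by (intro power_mono) auto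
  then have muR2: "\<mu>\<^sup>2 * R'\<^sup>2 \<le> 1 / 4" by (simp add: power_mult_distrib power_divide)
  have d: "\<delta> > 0" "\<delta> \<le> 1" using R' by (auto simp: \<delta>_def)
  have "\<mu>\<^sup>2 * \<delta>\<^sup>2 = \<mu>\<^sup>2 * R'\<^sup>2 / 4" by (simp add: \<delta>_def power_divide)
  then have d3: "\<mu>\<^sup>2 * \<delta>\<^sup>2 \<le> 1" using muR2 by linarith
  have "\<mu>\<^sup>2 * R'\<^sup>2 / DIM('a) \<le> (1 / 4) / 1"
    using muR2 DIM_positive[where 'a='a] by (intro frac_le) auto
  then have small: "\<mu>\<^sup>2 * R'\<^sup>2 / DIM('a) \<le> 1 / 2" by simp
  obtain c :: 'a where c: "c \<in> Basis" using nonempty_Basis by blast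
  define E where "E = (LINT y|lborel. exp (\<mu> * ((\<delta> *\<^sub>R y) \<bullet> c)) * bump (y::'a) ^ Suc 2)"
  have E: "E > 0" unfolding E_def by (intro ball_kernel_integral_pos continuous_intros) auto
  let ?S = "ball z \<delta>"
  have rep: "v x = (1 / E) * (LINT y|lborel. v (x + \<delta> *\<^sub>R y) * bump y ^ Suc 2)" if x: "x \<in> ?S" for x
  proof -
    have "cball x \<delta> \<subseteq> cball z R'"
    proof
      fix w assume "w \<in> cball x \<delta>"
      then show "w \<in> cball z R'" using x dist_triangle[of z w x] by (simp add: \<delta>_def)
    qed
    then show ?thesis
      using bump_reproducing[OF R'(1) small mu v _ d d3 _ norm_Basis[OF c], of z x 2] l R'(2) E
      by (auto simp: E_def)
  qed
  have cv: "continuous_on UNIV (\<lambda>(x, y). v (x + \<delta> *\<^sub>R y))"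
    unfolding case_prod_beta by (rule continuous_on_compose2[OF v]) (auto intro!: continuous_intros)
  \<comment> \<open>Every kernel below is a continuous factor times a positive power of
    \<open>bump\<close>; the power confines it to the unit ball, where compactness bounds
    it.\<close>
  have kk: "ball_kernel (\<lambda>y. p y * bump y ^ Suc j)" if p: "continuous_on UNIV p" for p :: "'a \<Rightarrow> real" and j
    unfolding ball_kernel_def
  proof (intro conjI)
    show "(\<lambda>y. p y * bump y ^ Suc j) \<in> borel_measurable borel"
      by (intro borel_measurable_continuous_onI continuous_intros p)
    have "bounded ((\<lambda>y. p y * bump y ^ Suc j) ` cball 0 1)"
      by (intro compact_imp_bounded compact_continuous_image continuous_intros continuous_on_subset[OF p]) auto
    then obtain C where "C > 0" "\<forall>w\<in>(\<lambda>y. p y * bump y ^ Suc j) ` cball 0 1. norm w \<le> C"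
      unfolding bounded_pos by blast
    then have "\<bar>p y * bump y ^ Suc j\<bar> \<le> C" for y
      by (cases "norm y \<le> 1") (auto simp: bump_eq_0)
    then show "\<exists>C. \<forall>y. \<bar>p y * bump y ^ Suc j\<bar> \<le> C" by blast
  qed (auto simp: bump_eq_0)
  \<comment> \<open>\<open>G e\<close> and \<open>H e a\<close> are the derivatives read off the
    formula for \<open>v\<close>. The 6 is 2 times the exponent 3; each differentiation contributes
    1 / \<delta> from the scaling, and the minus sign in \<open>H\<close> comes from moving the
    shift onto the kernel.\<close>
  define G where "G e x = (6 / (\<delta> * E)) * (LINT y|lborel. v (x + \<delta> *\<^sub>R y) * ((y \<bullet> e) * bump y ^ Suc 1))" for e x
  define H where "H e a x = - (6 / (\<delta>\<^sup>2 * E)) * (LINT y|lborel. v (x + \<delta> *\<^sub>R y) *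
      (((a \<bullet> e) * bump y - 4 * (y \<bullet> e) * (y \<bullet> a)) * bump y ^ Suc 0))" for e a x
  have cG: "continuous_on UNIV (G e)" for e
    unfolding G_def by (intro continuous_on_mult_left continuous_kernel_integral[OF cv] kk continuous_intros)
  have cH: "continuous_on UNIV (H e a)" for e a
    unfolding H_def by (intro continuous_on_mult_left continuous_kernel_integral[OF cv] kk continuous_intros)
  have near: "\<forall>\<^sub>F s in nhds 0. x + s *\<^sub>R e \<in> ?S" if "x \<in> ?S" for x e
  proof -
    have "((\<lambda>s. x + s *\<^sub>R e) \<longlongrightarrow> x + 0 *\<^sub>R e) (nhds 0)"
      by (intro tendsto_intros) (auto simp: filterlim_ident)
    from topological_tendstoD[OF this open_ball, of z \<delta>] show ?thesis using that by simp
  qed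
  have Dv: "((\<lambda>s. v (x + s *\<^sub>R e)) has_real_derivative G e x) (at 0)" if x: "x \<in> ?S" for x e
  proof -
    have "((\<lambda>s. (1 / E) * (LINT y|lborel. v (x + s *\<^sub>R e + \<delta> *\<^sub>R y) * bump y ^ Suc 2)) has_real_derivative
        (1 / E) * ((2 * real (Suc 2) / \<delta>) * (LINT y|lborel. v (x + \<delta> *\<^sub>R y) * ((y \<bullet> e) * (bump y ^ 2 * indicator (ball 0 1) y))))) (at 0)"
      by (intro DERIV_cmult bump_kernel_derivative v d)
    also have "(1 / E) * ((2 * real (Suc 2) / \<delta>) * (LINT y|lborel. v (x + \<delta> *\<^sub>R y) * ((y \<bullet> e) * (bump y ^ 2 * indicator (ball 0 1) y)))) = G e x"
      unfolding numeral_2_eq_2 bump_power_indicator G_def by (simp add: mult.commute del: power_Suc)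
    finally have D: "((\<lambda>s. (1 / E) * (LINT y|lborel. v (x + s *\<^sub>R e + \<delta> *\<^sub>R y) * bump y ^ Suc 2)) has_real_derivative G e x) (at 0)" .
    have "\<forall>\<^sub>F s in nhds 0. v (x + s *\<^sub>R e) = (1 / E) * (LINT y|lborel. v (x + s *\<^sub>R e + \<delta> *\<^sub>R y) * bump y ^ Suc 2)"
      using near[OF x] by eventually_elim (rule rep)
    from DERIV_cong_ev[OF refl this refl, THEN iffD2, OF D] show ?thesis .
  qed
  have DG: "((\<lambda>s. G e (x + s *\<^sub>R a)) has_real_derivative H e a x) (at 0)" for x e a
  proof -
    let ?k' = "\<lambda>y. (a \<bullet> e) * bump y ^ 2 - 4 * (y \<bullet> e) * (y \<bullet> a) * bump y"
    have "((\<lambda>s. LINT y|lborel. v (x + s *\<^sub>R a + \<delta> *\<^sub>R y) * ((y \<bullet> e) * bump y ^ 2)) has_real_derivative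
        - (1 / \<delta>) * (LINT y|lborel. v (x + \<delta> *\<^sub>R y) * ?k' y)) (at 0)"
    proof (rule kernel_convolution_derivative[OF v d(1)])
      show "\<bar>(y \<bullet> e) * bump y ^ 2 - (z \<bullet> e) * bump z ^ 2\<bar> \<le> (norm e * (1 + 2 * real 2)) * norm (y - z)" for y z
        by (rule inner_bump_lipschitz) simp
      show "?k' \<in> borel_measurable borel"
        by (intro borel_measurable_continuous_onI continuous_intros)
    qed (auto simp: bump_eq_0 intro!: inner_bump_deriv)
    then have "((\<lambda>s. (6 / (\<delta> * E)) * (LINT y|lborel. v (x + s *\<^sub>R a + \<delta> *\<^sub>R y) * ((y \<bullet> e) * bump y ^ 2))) has_real_derivative
        (6 / (\<delta> * E)) * (- (1 / \<delta>) * (LINT y|lborel. v (x + \<delta> *\<^sub>R y) * ?k' y))) (at 0)"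
      by (rule DERIV_cmult)
    moreover have "?k' y = ((a \<bullet> e) * bump y - 4 * (y \<bullet> e) * (y \<bullet> a)) * bump y ^ Suc 0" for y
      by (simp add: power2_eq_square algebra_simps)
    moreover have "(6 / (\<delta> * E)) * (- (1 / \<delta>) * I) = - (6 / (\<delta>\<^sup>2 * E)) * I" for I
      by (simp add: power2_eq_square)
    ultimately show ?thesis
      unfolding G_def H_def by (simp only: numeral_2_eq_2 One_nat_def)
  qed
  have pv: "partial_deriv b v x = G b x" if "x \<in> ?S" for b x
    using Dv[OF that] by (rule partial_deriv_eqI)
  have DpG: "((\<lambda>t. partial_deriv b v (x + t *\<^sub>R a)) has_real_derivative H b a x) (at 0)" if "x \<in> ?S" for a b x
  proof -
    have "\<forall>\<^sub>F s in nhds 0. partial_deriv b v (x + s *\<^sub>R a) = G b (x + s *\<^sub>R a)"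
      using near[OF that] by eventually_elim (rule pv)
    from DERIV_cong_ev[OF refl this refl, THEN iffD2, OF DG] show ?thesis .
  qed
  have ppv: "partial_deriv a (partial_deriv b v) x = H b a x" if "x \<in> ?S" for a b x
    using DpG[OF that] by (rule partial_deriv_eqI)
  have dif: "f differentiable at 0" if "(f has_real_derivative D) (at 0)" for f :: "real \<Rightarrow> real" and D
    using that by (auto simp: differentiable_def has_field_derivative_def)
  have cpv: "continuous_on ?S (partial_deriv b v)" for b
    using continuous_on_subset[OF cG[of b], of ?S] by (subst continuous_on_cong[OF refl pv]) auto
  have cppv: "continuous_on ?S (partial_deriv a (partial_deriv b v))" for a b
    using continuous_on_subset[OF cH[of b a], of ?S] by (subst continuous_on_cong[OF refl ppv]) auto
  have C2: "C2_on ?S v"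
    unfolding C2_on_def C1_on_def
  proof (intro conjI ballI)
    show "continuous_on ?S v" by (rule continuous_on_subset[OF v]) simp
    show "(\<lambda>t. v (x + t *\<^sub>R b)) differentiable (at 0)" if "x \<in> ?S" for b x
      using dif[OF Dv[OF that]] .
    show "(\<lambda>t. partial_deriv b v (x + t *\<^sub>R a)) differentiable (at 0)" if "x \<in> ?S" for a b x
      using dif[OF DpG[OF that]] .
  qed (rule cpv cppv)+
  have int: "integrable lborel (\<lambda>y. v (x + \<delta> *\<^sub>R y) * (p y * bump y ^ Suc j))"
    if "continuous_on UNIV p" for p :: "'a \<Rightarrow> real" and x j
    using continuous_on_section[OF cv] kk[OF that] by (rule kernel_integrable)
  \<comment> \<open>The kernels are linear in the direction; this writes a directional derivative as
    a combination of coordinate ones, the form in which total differentiability is derived.\<close>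
  have Glin: "G h x = (\<Sum>b\<in>Basis. (h \<bullet> b) * G b x)" for h x
  proof -
    have "(y \<bullet> h) = (\<Sum>b\<in>Basis. (h \<bullet> b) * (y \<bullet> b))" for y :: 'a
      by (subst euclidean_inner) (simp add: mult.commute)
    then have "(LINT y|lborel. v (x + \<delta> *\<^sub>R y) * ((y \<bullet> h) * bump y ^ Suc 1))
        = (LINT y|lborel. (\<Sum>b\<in>Basis. (h \<bullet> b) * (v (x + \<delta> *\<^sub>R y) * ((y \<bullet> b) * bump y ^ Suc 1))))"
      by (simp add: sum_distrib_left sum_distrib_right mult_ac del: power_Suc)
    also have "\<dots> = (\<Sum>b\<in>Basis. (h \<bullet> b) * (LINT y|lborel. v (x + \<delta> *\<^sub>R y) * ((y \<bullet> b) * bump y ^ Suc 1)))"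
      unfolding integral_mult_right_zero[symmetric]
      by (intro Bochner_Integration.integral_sum integrable_mult_right int continuous_intros)
    finally show ?thesis by (simp add: G_def sum_distrib_left mult_ac del: power_Suc)
  qed
  have Hlin: "H e h x = (\<Sum>a\<in>Basis. (h \<bullet> a) * H e a x)" for e h x
  proof -
    have h1: "(h \<bullet> e) = (\<Sum>b\<in>Basis. (h \<bullet> b) * (b \<bullet> e))"
      by (subst euclidean_inner) (simp add: inner_commute)
    have h2: "(y \<bullet> h) = (\<Sum>b\<in>Basis. (h \<bullet> b) * (y \<bullet> b))" for y :: 'a
      by (subst euclidean_inner) (simp add: mult.commute)
    have "(h \<bullet> e) * bump y - 4 * (y \<bullet> e) * (y \<bullet> h) = (\<Sum>b\<in>Basis. (h \<bullet> b) * ((b \<bullet> e) * bump y - 4 * (y \<bullet> e) * (y \<bullet> b)))" for y :: 'a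
      unfolding h1 h2[of y] by (simp add: sum_distrib_left sum_distrib_right sum_subtractf right_diff_distrib mult_ac)
    then have "(LINT y|lborel. v (x + \<delta> *\<^sub>R y) * (((h \<bullet> e) * bump y - 4 * (y \<bullet> e) * (y \<bullet> h)) * bump y ^ Suc 0))
        = (LINT y|lborel. (\<Sum>b\<in>Basis. (h \<bullet> b) * (v (x + \<delta> *\<^sub>R y) * (((b \<bullet> e) * bump y - 4 * (y \<bullet> e) * (y \<bullet> b)) * bump y ^ Suc 0))))"
      by (simp only: sum_distrib_left sum_distrib_right mult.left_commute mult.assoc)
    also have "\<dots> = (\<Sum>b\<in>Basis. (h \<bullet> b) * (LINT y|lborel. v (x + \<delta> *\<^sub>R y) * (((b \<bullet> e) * bump y - 4 * (y \<bullet> e) * (y \<bullet> b)) * bump y ^ Suc 0)))"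
      unfolding integral_mult_right_zero[symmetric]
      by (intro Bochner_Integration.integral_sum integrable_mult_right int continuous_intros)
    finally show ?thesis unfolding H_def by (simp only: sum_distrib_left mult.left_commute mult.assoc)
  qed
  have "laplacian v x = \<mu>\<^sup>2 * v x" if x: "x \<in> ?S" for x
  proof (rule has_mean_laplacian_unique)
    have "has_mean_laplacian v x (\<Sum>b\<in>Basis. H b b x)"
    proof (rule has_mean_laplacian_smooth[OF v open_ball x, where G=G and H="\<lambda>b a. H b a x"])
      show "(v has_derivative (\<lambda>h. \<Sum>b\<in>Basis. (h \<bullet> b) * G b y)) (at y)" if "y \<in> ?S" for y
      proof (rule gateaux_imp_has_derivative[OF open_ball that])
        show "((\<lambda>s. v (w + s *\<^sub>R h)) has_real_derivative (\<Sum>b\<in>Basis. (h \<bullet> b) * G b w)) (at 0)"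
          if "w \<in> ?S" for w h
          using Dv[OF that, of h] by (simp only: Glin[of h])
        show "continuous_on ?S (G b)" for b
          by (rule continuous_on_subset[OF cG]) simp
      qed
      show "(G b has_derivative (\<lambda>h. \<Sum>a\<in>Basis. (h \<bullet> a) * H b a x)) (at x)" for b
      proof (rule gateaux_imp_has_derivative[OF open_UNIV UNIV_I])
        show "((\<lambda>s. G b (w + s *\<^sub>R h)) has_real_derivative (\<Sum>a\<in>Basis. (h \<bullet> a) * H b a w)) (at 0)" for w h
          using DG[of b w h] by (simp only: Hlin[of b h])
      qed (rule cH)
    qed
    then show "has_mean_laplacian v x (laplacian v x)"
      using ppv[OF x] by (simp add: laplacian_def)
    show "has_mean_laplacian v x (\<mu>\<^sup>2 * v x)"
      using x R' by (intro l) (auto simp: \<delta>_def)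
  qed
  with that[OF d(1) C2] show thesis by blast
qed

section \<open>Bessel functions and the mean value identity\<close>

definition bessel_coeff :: "real \<Rightarrow> nat \<Rightarrow> real" where
  "bessel_coeff \<nu> k = rGamma (\<nu> + real k + 1) / fact k"

text \<open>The entire factor of the Bessel function in the variable s = (z / 2)^2. Working with it
  separates the limit at 0 and the recurrence from the real power.\<close>

definition bessel_series :: "real \<Rightarrow> real \<Rightarrow> real" where
  "bessel_series \<nu> s = (\<Sum>k. bessel_coeff \<nu> k * s ^ k)"

lemma bessel_I_eq: "bessel_I \<nu> z = (z / 2) powr \<nu> * bessel_series \<nu> ((z / 2)\<^sup>2)"
proof -
  have "(z / 2) ^ (2 * k) * rGamma (\<nu> + real k + 1) / fact k = bessel_coeff \<nu> k * ((z / 2)\<^sup>2) ^ k" for k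
    unfolding bessel_coeff_def power_mult by simp
  then show ?thesis by (simp only: bessel_I_def bessel_series_def)
qed

lemma rGamma_real_pos: "x > 0 \<Longrightarrow> rGamma (x::real) > 0"
  by (simp add: rGamma_inverse_Gamma Gamma_real_pos)

text \<open>The values \<open>rGamma (\<nu> + real k + 1)\<close> decrease in \<open>k\<close>,
  because the functional equation relates neighbours by a factor at least 1. The exponential series
  then dominates.\<close>

lemma bessel_series_summable:
  assumes "\<nu> \<ge> 0"
  shows "summable (\<lambda>k. bessel_coeff \<nu> k * s ^ k)"
proof (rule summable_comparison_test')
  show "summable (\<lambda>k. rGamma (\<nu> + 1) * (\<bar>s\<bar> ^ k /\<^sub>R fact k))"
    by (intro summable_mult summable_exp_generic)
  have *: "rGamma (\<nu> + real k + 1) \<le> rGamma (\<nu> + 1)" for k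
  proof (induction k)
    case (Suc k)
    have "rGamma (\<nu> + real (Suc k) + 1) = 1 * rGamma (\<nu> + real k + 1 + 1)" by (simp add: add_ac)
    also have "\<dots> \<le> (\<nu> + real k + 1) * rGamma (\<nu> + real k + 1 + 1)"
      using assms by (intro mult_right_mono less_imp_le[OF rGamma_real_pos]) auto
    also have "\<dots> = rGamma (\<nu> + real k + 1)" by (rule rGamma_plus1)
    finally show ?case using Suc.IH by linarith
  qed simp
  show "norm (bessel_coeff \<nu> k * s ^ k) \<le> rGamma (\<nu> + 1) * (\<bar>s\<bar> ^ k /\<^sub>R fact k)" for k
  proof -
    have "rGamma (\<nu> + real k + 1) > 0" using assms by (intro rGamma_real_pos) auto
    then have "norm (bessel_coeff \<nu> k * s ^ k) = rGamma (\<nu> + real k + 1) * (\<bar>s\<bar> ^ k /\<^sub>R fact k)"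
      by (simp add: bessel_coeff_def abs_mult power_abs divide_inverse)
    also have "\<dots> \<le> rGamma (\<nu> + 1) * (\<bar>s\<bar> ^ k /\<^sub>R fact k)"
      by (intro mult_right_mono *) auto
    finally show ?thesis .
  qed
qed

text \<open>This is I_(nu-1)(z) - I_(nu+1)(z) = (2 nu / z) I_nu(z) without the powers.
  Coefficientwise the factor nu + k from the functional equation splits: nu gives the first series,
  and k cancels against the factorial and shifts the index. Convergence of the series of order nu -
  1 comes out of the same computation.\<close>

lemma bessel_series_recurrence:
  assumes "\<nu> \<ge> 0"
  shows "bessel_series (\<nu> - 1) s = \<nu> * bessel_series \<nu> s + s * bessel_series (\<nu> + 1) s"
proof -
  let ?f = "\<lambda>k. real k * bessel_coeff \<nu> k * s ^ k"
  have f: "?f (Suc k) = s * (bessel_coeff (\<nu> + 1) k * s ^ k)" for k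
  proof -
    have "real (Suc k) * bessel_coeff \<nu> (Suc k) = bessel_coeff (\<nu> + 1) k"
    proof -
      have eq: "\<nu> + real (Suc k) + 1 = \<nu> + 1 + real k + 1" by simp
      show ?thesis unfolding bessel_coeff_def fact_Suc eq by (simp del: of_nat_Suc)
    qed
    then show ?thesis by (simp add: mult_ac del: of_nat_Suc)
  qed
  have "(\<lambda>k. ?f (Suc k)) sums (s * bessel_series (\<nu> + 1) s)"
    unfolding f bessel_series_def using assms by (intro sums_mult summable_sums bessel_series_summable) auto
  then have "?f sums (s * bessel_series (\<nu> + 1) s)"
    using sums_Suc_iff[of ?f] by simp
  moreover have "(\<lambda>k. \<nu> * (bessel_coeff \<nu> k * s ^ k)) sums (\<nu> * bessel_series \<nu> s)"
    unfolding bessel_series_def using assms by (intro sums_mult summable_sums bessel_series_summable)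
  ultimately have "(\<lambda>k. \<nu> * (bessel_coeff \<nu> k * s ^ k) + ?f k) sums (\<nu> * bessel_series \<nu> s + s * bessel_series (\<nu> + 1) s)"
    by (intro sums_add)
  moreover have "\<nu> * (bessel_coeff \<nu> k * s ^ k) + ?f k = bessel_coeff (\<nu> - 1) k * s ^ k" for k
  proof -
    have "\<nu> * rGamma (\<nu> + real k + 1) + real k * rGamma (\<nu> + real k + 1) = rGamma (\<nu> - 1 + real k + 1)"
      using rGamma_plus1[of "\<nu> + real k"] by (simp add: distrib_right)
    then show ?thesis
      unfolding bessel_coeff_def
      by (simp only: times_divide_eq_right times_divide_eq_left mult.assoc[symmetric] add_divide_distrib[symmetric]
          distrib_right[symmetric])
  qed
  ultimately show ?thesis
    unfolding bessel_series_def[of "\<nu> - 1"] by (simp add: sums_iff)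
qed

lemma bessel_series_tendsto:
  assumes "\<nu> \<ge> 0" "(g \<longlongrightarrow> 0) F"
  shows "((\<lambda>r. bessel_series \<nu> (g r)) \<longlongrightarrow> rGamma (\<nu> + 1)) F"
proof -
  have "isCont (bessel_series \<nu>) 0"
    unfolding bessel_series_def using bessel_series_summable[OF assms(1), of 1]
    by (intro isCont_powser[of _ 1]) auto
  then have "((\<lambda>r. bessel_series \<nu> (g r)) \<longlongrightarrow> bessel_series \<nu> 0) F"
    using assms(2) by (rule isCont_tendsto_compose)
  moreover have "bessel_series \<nu> 0 = rGamma (\<nu> + 1)"
    unfolding bessel_series_def by (subst powser_zero) (simp add: bessel_coeff_def)
  ultimately show ?thesis by simp
qed

section \<open>Sphere and ball means as integrals over the unit ball\<close>

lemma lborel_integral_affine: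
  fixes g :: "'a::euclidean_space \<Rightarrow> real"
  assumes [measurable]: "g \<in> borel_measurable borel" and r: "r > 0"
  shows "(LINT y|lborel. g y) = r ^ DIM('a) * (LINT y|lborel. g (x + r *\<^sub>R y))"
proof -
  have "(LINT y|lborel. g y) = (LINT y|density (distr lborel borel (\<lambda>y. x + r *\<^sub>R y)) (\<lambda>_. ennreal (\<bar>r\<bar> ^ DIM('a))). g y)"
    using r by (subst lborel_affine[of r x]) (auto simp: ennreal_power)
  also have "\<dots> = (LINT y|distr lborel borel (\<lambda>y. x + r *\<^sub>R y). \<bar>r\<bar> ^ DIM('a) * g y)"
    by (subst integral_density) auto
  also have "\<dots> = (LINT y|lborel. \<bar>r\<bar> ^ DIM('a) * g (x + r *\<^sub>R y))"
    by (rule integral_distr) measurable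
  finally show ?thesis using r by simp
qed

lemma measure_ball_unit_vol:
  assumes "r \<ge> 0"
  shows "measure lborel (ball (x::'a::euclidean_space) r) = unit_vol TYPE('a) * r ^ DIM('a)"
  using assms by (simp add: unit_vol_def content_ball)

lemma ball_mean_eq_ball_avg:
  fixes v :: "'a::euclidean_space \<Rightarrow> real"
  assumes v: "continuous_on UNIV v" and r: "r > 0"
  shows "ball_mean v x r = ball_avg v x r"
proof -
  have [measurable]: "v \<in> borel_measurable borel" using v by (rule borel_measurable_continuous_onI)
  have "(LINT y:ball x r|lborel. v y) = (LINT y|lborel. indicator (ball x r) y * v y)"
    by (simp add: set_lebesgue_integral_def)
  also have "\<dots> = r ^ DIM('a) * (LINT y|lborel. indicator (ball x r) (x + r *\<^sub>R y) * v (x + r *\<^sub>R y))"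
    using r by (intro lborel_integral_affine borel_measurable_times borel_measurable_indicator) auto
  also have "(\<lambda>y. indicator (ball x r) (x + r *\<^sub>R y) * v (x + r *\<^sub>R y)) = (\<lambda>y. v (x + r *\<^sub>R y) * indicator (ball 0 1) y)"
    using r by (auto simp: indicator_def dist_norm fun_eq_iff)
  finally show ?thesis
    using r unit_vol_pos[where ?'a='a] by (simp add: ball_mean_def ball_avg_def measure_ball_unit_vol)
qed

text \<open>Averages over the sphere, written as averages over the unit ball of the radial projection; the
  value at the origin is immaterial.\<close>

definition sphere_avg :: "('a::euclidean_space \<Rightarrow> real) \<Rightarrow> 'a \<Rightarrow> real \<Rightarrow> real" where
  "sphere_avg f x r = (LINT y|lborel. f (x + (r / norm y) *\<^sub>R y) * indicator (ball 0 1) y) / unit_vol TYPE('a)"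

lemma sphere_mean_eq_sphere_avg:
  fixes v :: "'a::euclidean_space \<Rightarrow> real"
  assumes v: "continuous_on UNIV v" and r: "r > 0"
  shows "sphere_mean v x r = sphere_avg v x r"
proof -
  have [measurable]: "v \<in> borel_measurable borel" using v by (rule borel_measurable_continuous_onI)
  let ?p = "\<lambda>y::'a. x + (r / norm (y - x)) *\<^sub>R (y - x)"
  let ?B = "ball x r - {x}"
  let ?D = "distr (restrict_space lborel ?B) borel ?p"
  let ?c = "real DIM('a) / r"
  have c: "?c > 0" using r by simp
  have pm: "?p \<in> measurable (restrict_space lborel ?B) borel"
    by (rule measurable_restrict_space1) measurable
  have pm': "?p \<in> borel_measurable borel" by measurable
  \<comment> \<open>A scaled measure is a density with constant weight, a form for which an
    integration rule exists. The weight m / r later cancels against the same factor in the area of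
    the sphere.\<close>
  have sm: "sphere_measure x r = density ?D (\<lambda>_. ennreal ?c)"
    unfolding sphere_measure_def
    by (rule measure_eqI) (auto simp: emeasure_density_const mult.commute)
  have Bs: "?B \<in> sets lborel" by simp
  have [measurable]: "(\<lambda>y. indicator (sphere x r) y * v y) \<in> borel_measurable borel"
    by (intro borel_measurable_times borel_measurable_indicator) auto
  have gm: "(\<lambda>y. v (?p y)) \<in> borel_measurable borel"
    using pm' by measurable
  have "(LINT y:sphere x r|sphere_measure x r. v y) = (LINT y|density ?D (\<lambda>_. ennreal ?c). indicator (sphere x r) y * v y)"
    by (simp add: set_lebesgue_integral_def sm)
  also have "\<dots> = (LINT y|?D. ?c * (indicator (sphere x r) y * v y))"
    using c by (subst integral_density) auto
  also have "\<dots> = ?c * (LINT y|?D. indicator (sphere x r) y * v y)"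
    by simp
  also have "(LINT y|?D. indicator (sphere x r) y * v y) = (LINT y|restrict_space lborel ?B. indicator (sphere x r) (?p y) * v (?p y))"
    by (rule integral_distr[OF pm]) measurable
  also have "\<dots> = (LINT y:?B|lborel. indicator (sphere x r) (?p y) * v (?p y))"
    using Bs by (subst integral_restrict_space) (auto simp: set_lebesgue_integral_def)
  also have "\<dots> = (LINT y|lborel. indicator ?B y * v (?p y))"
    unfolding set_lebesgue_integral_def using r
    by (intro Bochner_Integration.integral_cong) (auto simp: indicator_def dist_norm)
  also have "\<dots> = (LINT y|lborel. indicator (ball x r) y * v (?p y))"
  proof (rule integral_cong_AE)
    have "AE y in lborel. y \<noteq> x" by (rule AE_lborel_singleton)
    then show "AE y in lborel. indicator ?B y * v (?p y) = indicator (ball x r) y * v (?p y)"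
      by eventually_elim (auto simp: indicator_def)
  qed (auto intro!: borel_measurable_times borel_measurable_indicator gm)
  also have "\<dots> = r ^ DIM('a) * (LINT y|lborel. indicator (ball x r) (x + r *\<^sub>R y) * v (?p (x + r *\<^sub>R y)))"
    using r by (intro lborel_integral_affine borel_measurable_times borel_measurable_indicator gm) auto
  also have "(\<lambda>y. indicator (ball x r) (x + r *\<^sub>R y) * v (?p (x + r *\<^sub>R y))) = (\<lambda>y. v (x + (r / norm y) *\<^sub>R y) * indicator (ball 0 1) y)"
    using r by (auto simp: indicator_def dist_norm fun_eq_iff)
  finally have I: "(LINT y:sphere x r|sphere_measure x r. v y) = ?c * (r ^ DIM('a) * (unit_vol TYPE('a) * sphere_avg v x r))"
    using unit_vol_pos[where ?'a='a] by (simp add: sphere_avg_def)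
  have "measure (sphere_measure x r) (sphere x r) = real DIM('a) * unit_ball_vol (real DIM('a)) * r ^ (DIM('a) - 1)"
    unfolding measure_def emeasure_sphere_measure_sphere[OF r] using r by (intro enn2real_ennreal) auto
  also have "unit_ball_vol (real DIM('a)) = unit_vol TYPE('a)"
    by (simp add: unit_vol_def content_ball)
  also have "real DIM('a) * unit_vol TYPE('a) * r ^ (DIM('a) - 1) = ?c * (r ^ DIM('a) * unit_vol TYPE('a))"
    using r by (cases "DIM('a)") auto
  finally have A: "measure (sphere_measure x r) (sphere x r) = ?c * (r ^ DIM('a) * unit_vol TYPE('a))" .
  show ?thesis
    unfolding sphere_mean_def I A using r unit_vol_pos[where ?'a='a] by simp
qed

text \<open>The polar formula without polar coordinates. \<open>F R\<close> integrates the
  difference between \<open>v\<close> and its value at the radial projection to the sphere of radius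
  \<open>r\<close>. The projected part scales exactly like R^m, so \<open>F\<close> encodes the ball
  average at \<open>R\<close>; near the sphere the two values agree up to o(1), so \<open>F\<close>
  has derivative 0 at \<open>r\<close>. The quotient rule does the rest.\<close>

lemma ball_avg_derivative:
  fixes v :: "'a::euclidean_space \<Rightarrow> real"
  assumes v: "continuous_on UNIV v" and r: "r > 0"
  shows "(ball_avg v x has_real_derivative DIM('a) / r * (sphere_avg v x r - ball_avg v x r)) (at r)"
proof -
  have [measurable]: "v \<in> borel_measurable borel" using v by (rule borel_measurable_continuous_onI)
  let ?w = "unit_vol TYPE('a)" and ?m = "DIM('a)"
  let ?g = "\<lambda>y::'a. v (x + y) - v (x + (r / norm y) *\<^sub>R y)"
  define F where "F R = (LINT y|lborel. ?g y * indicator (ball 0 R) y)" for R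
  have w: "?w > 0" by (rule unit_vol_pos)
  have "bounded (v ` cball x (3 * r))"
    by (intro compact_imp_bounded compact_continuous_image continuous_on_subset[OF v]) auto
  then obtain M where "M > 0" "\<forall>y\<in>v ` cball x (3 * r). norm y \<le> M"
    unfolding bounded_pos by blast
  then have M: "\<bar>v (x + y)\<bar> \<le> M" if "norm y \<le> 3 * r" for y
    using that by (auto simp: dist_norm)
  have proj: "norm ((r / norm y) *\<^sub>R y) \<le> r" for y :: 'a using r by (cases "y = 0") auto
  have int1: "integrable lborel (\<lambda>y. v (x + y) * indicator (ball 0 R) y)" if "R \<le> 3 * r" for R
    by (rule integrable_bounded_ball[where R=R and C=M])
      (use that M \<open>M > 0\<close> in \<open>auto simp: indicator_def intro!: borel_measurable_times borel_measurable_indicator\<close>)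
  have int2: "integrable lborel (\<lambda>y. v (x + (r / norm y) *\<^sub>R y) * indicator (ball 0 R) y)" if "R \<le> 3 * r" for R
  proof (rule integrable_bounded_ball[where R=R and C=M])
    show "(\<lambda>y. v (x + (r / norm y) *\<^sub>R y) * indicator (ball 0 R) y) \<in> borel_measurable borel"
      by (intro borel_measurable_times borel_measurable_indicator) auto
    show "\<bar>v (x + (r / norm y) *\<^sub>R y) * indicator (ball 0 R) y\<bar> \<le> M" for y
      using M[of "(r / norm y) *\<^sub>R y"] proj[of y] r \<open>M > 0\<close> by (auto simp: indicator_def)
  qed (auto simp: indicator_def)
  have F_eq: "F R = R ^ ?m * (?w * (ball_avg v x R - sphere_avg v x r))" if R: "0 < R" "R \<le> 3 * r" for R
  proof -
    have "F R = (LINT y|lborel. v (x + y) * indicator (ball 0 R) y) - (LINT y|lborel. v (x + (r / norm y) *\<^sub>R y) * indicator (ball 0 R) y)"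
      unfolding F_def left_diff_distrib by (rule Bochner_Integration.integral_diff[OF int1[OF R(2)] int2[OF R(2)]])
    also have "(LINT y|lborel. v (x + y) * indicator (ball 0 R) y) = R ^ ?m * (LINT y|lborel. v (x + (0 + R *\<^sub>R y)) * indicator (ball 0 R) (0 + R *\<^sub>R y))"
      using R by (intro lborel_integral_affine borel_measurable_times borel_measurable_indicator) auto
    also have "(\<lambda>y. v (x + (0 + R *\<^sub>R y)) * indicator (ball 0 R) (0 + R *\<^sub>R y)) = (\<lambda>y. v (x + R *\<^sub>R y) * indicator (ball 0 1) y)"
      using R by (auto simp: indicator_def fun_eq_iff)
    also have "(LINT y|lborel. v (x + (r / norm y) *\<^sub>R y) * indicator (ball 0 R) y)
        = R ^ ?m * (LINT y|lborel. v (x + (r / norm (0 + R *\<^sub>R y)) *\<^sub>R (0 + R *\<^sub>R y)) * indicator (ball 0 R) (0 + R *\<^sub>R y))"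
      using R by (intro lborel_integral_affine borel_measurable_times borel_measurable_indicator) auto
    also have "(\<lambda>y. v (x + (r / norm (0 + R *\<^sub>R y)) *\<^sub>R (0 + R *\<^sub>R y)) * indicator (ball 0 R) (0 + R *\<^sub>R y))
        = (\<lambda>y. v (x + (r / norm y) *\<^sub>R y) * indicator (ball 0 1) y)"
      using R by (auto simp: indicator_def fun_eq_iff)
    finally show ?thesis using w by (simp add: ball_avg_def sphere_avg_def right_diff_distrib)
  qed
  have "(F has_real_derivative 0) (at r)"
    unfolding has_field_derivative_def has_derivative_at_alt
  proof (intro conjI allI impI)
    fix e :: real assume e: "e > 0"
    define L where "L = real ?m * (3 * r) ^ (?m - 1)"
    have L: "L > 0" using r by (simp add: L_def)
    have powL: "\<bar>R ^ ?m - r ^ ?m\<bar> \<le> L * \<bar>R - r\<bar>" if "0 < R" "R \<le> 3 * r" for R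
    proof -
      have "norm (R ^ ?m - r ^ ?m) \<le> L * norm (R - r)"
      proof (rule field_differentiable_bound[where S="{0..3 * r}" and f'="\<lambda>u. real ?m * u ^ (?m - 1)"])
        show "((\<lambda>u. u ^ ?m) has_real_derivative real ?m * u ^ (?m - 1)) (at u within {0..3 * r})" for u
          by (auto intro!: derivative_eq_intros)
        show "norm (real ?m * u ^ (?m - 1)) \<le> L" if "u \<in> {0..3 * r}" for u
        proof -
          have "u ^ (?m - 1) \<le> (3 * r) ^ (?m - 1)" using that by (intro power_mono) auto
          then show ?thesis using that unfolding L_def by (simp add: abs_mult del: power_mult_distrib)
        qed
      qed (use that r in auto)
      then show ?thesis by simp
    qed
    \<comment> \<open>The shell between the radii has volume at most
      \<open>?w * L * \<bar>R - r\<bar>\<close>; an integrand below this \<open>e'\<close> therefore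
      contributes at most \<open>e * \<bar>R - r\<bar>\<close>.\<close>
    define e' where "e' = e / (?w * L)"
    have e': "e' > 0" using e w L by (simp add: e'_def)
    have "uniformly_continuous_on (cball x (3 * r)) v"
      by (intro compact_uniformly_continuous continuous_on_subset[OF v]) auto
    then obtain d0 where d0: "d0 > 0" "\<And>y z. y \<in> cball x (3 * r) \<Longrightarrow> z \<in> cball x (3 * r) \<Longrightarrow> dist z y < d0 \<Longrightarrow> dist (v z) (v y) < e'"
      unfolding uniformly_continuous_on_def using e' by blast
    define d where "d = min d0 r"
    have d: "d > 0" using d0 r by (simp add: d_def)
    show "\<exists>d>0. \<forall>R. norm (R - r) < d \<longrightarrow> norm (F R - F r - 0 * (R - r)) \<le> e * norm (R - r)"
    proof (intro exI[of _ d] conjI allI impI)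
      fix R assume "norm (R - r) < d"
      then have Rd: "\<bar>R - r\<bar> < d0" "\<bar>R - r\<bar> < r" by (auto simp: d_def)
      then have R: "0 < R" "R \<le> 3 * r" by auto
      let ?i = "\<lambda>R. indicator (ball (0::'a) R) :: 'a \<Rightarrow> real"
      have iint: "integrable lborel (?i R)" for R
        by (intro integrable_real_indicator emeasure_lborel_ball_finite) auto
      have gint: "integrable lborel (\<lambda>y. ?g y * ?i R y)" if "R \<le> 3 * r" for R
        unfolding left_diff_distrib using int1[OF that] int2[OF that] by (rule Bochner_Integration.integrable_diff)
      have "\<bar>F R - F r\<bar> = \<bar>LINT y|lborel. ?g y * ?i R y - ?g y * ?i r y\<bar>"
        unfolding F_def using r R
        by (subst Bochner_Integration.integral_diff) (auto intro!: gint)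
      \<comment> \<open>Maximum and minimum of the radii describe the shell for \<open>R\<close> on
        either side of \<open>r\<close>.\<close>
      also have "\<dots> \<le> (LINT y|lborel. e' * (?i (max R r) y - ?i (min R r) y))"
        unfolding real_norm_def[symmetric]
      proof (rule Bochner_Integration.integral_norm_bound_integral)
        show "integrable lborel (\<lambda>y. ?g y * ?i R y - ?g y * ?i r y)"
          using r R by (intro Bochner_Integration.integrable_diff gint) auto
        show "integrable lborel (\<lambda>y. e' * (?i (max R r) y - ?i (min R r) y))"
          by (intro integrable_mult_right Bochner_Integration.integrable_diff iint)
        fix y :: 'a
        show "norm (?g y * ?i R y - ?g y * ?i r y) \<le> e' * (?i (max R r) y - ?i (min R r) y)"
        proof (cases "norm y < max R r \<and> min R r \<le> norm y")
          case True
          then have ny: "\<bar>norm y - r\<bar> \<le> \<bar>R - r\<bar>" "norm y > 0" "norm y \<le> 3 * r" using R r by auto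
          have "y - (r / norm y) *\<^sub>R y = (1 - r / norm y) *\<^sub>R y" by (simp add: scaleR_left_diff_distrib)
          then have "norm (y - (r / norm y) *\<^sub>R y) = \<bar>1 - r / norm y\<bar> * norm y" by simp
          also have "\<dots> = \<bar>norm y - r\<bar>" using ny(2) by (simp add: field_simps abs_if)
          finally have "dist (x + y) (x + (r / norm y) *\<^sub>R y) < d0"
            using ny(1) Rd(1) by (simp add: dist_norm)
          then have "\<bar>?g y\<bar> < e'"
            using d0(2)[of "x + (r / norm y) *\<^sub>R y" "x + y"] ny(3) proj[of y] r by (simp add: dist_norm)
          then show ?thesis using True by (auto simp: indicator_def max_def min_def split: if_splits)
        next
          case False
          then show ?thesis by (auto simp: indicator_def max_def min_def split: if_splits)
        qed
      qed
      also have "\<dots> = e' * ((LINT y|lborel. ?i (max R r) y) - (LINT y|lborel. ?i (min R r) y))"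
        by (subst Bochner_Integration.integral_diff[symmetric, OF iint iint]) simp
      also have "\<dots> = e' * (?w * \<bar>R ^ ?m - r ^ ?m\<bar>)"
      proof -
        have "(LINT y|lborel. ?i R y) = ?w * R ^ ?m" if "R \<ge> 0" for R
          using measure_ball_unit_vol[OF that, of 0] by simp
        moreover have "max R r ^ ?m - min R r ^ ?m = \<bar>R ^ ?m - r ^ ?m\<bar>"
          using R r power_mono[of R r ?m] power_mono[of r R ?m] by (auto simp: max_def min_def)
        ultimately show ?thesis using R r by (simp flip: right_diff_distrib)
      qed
      also have "\<dots> \<le> e' * (?w * (L * \<bar>R - r\<bar>))"
        using e' w by (intro mult_left_mono powL R) auto
      also have "\<dots> = e * \<bar>R - r\<bar>" using w L by (simp add: e'_def)
      finally show "norm (F R - F r - 0 * (R - r)) \<le> e * norm (R - r)" by simp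
    qed (rule d)
  qed (auto intro: bounded_linear_intros)
  then have "((\<lambda>R. F R / (?w * R ^ ?m) + sphere_avg v x r) has_real_derivative
      - (F r * (?w * (real ?m * r ^ (?m - 1)))) / (?w * r ^ ?m * (?w * r ^ ?m))) (at r)"
    using r w by (auto intro!: derivative_eq_intros)
  moreover have "- (F r * (?w * (real ?m * r ^ (?m - 1)))) / (?w * r ^ ?m * (?w * r ^ ?m))
      = ?m / r * (sphere_avg v x r - ball_avg v x r)"
  proof -
    obtain k where k: "?m = Suc k" using DIM_positive[where 'a='a] by (cases ?m) auto
    have Fr: "F r = r ^ ?m * (?w * (ball_avg v x r - sphere_avg v x r))" using r by (intro F_eq) auto
    have "- (r ^ Suc k * (?w * c) * (?w * (real (Suc k) * r ^ k))) / (?w * r ^ Suc k * (?w * r ^ Suc k)) = - (real (Suc k) / r * c)" for c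
      using r w by (simp add: field_simps)
    from this[of "ball_avg v x r - sphere_avg v x r"] show ?thesis
      unfolding Fr k diff_Suc_1 by (simp only: mult_minus_right[symmetric] minus_diff_eq)
  qed
  moreover have "\<forall>\<^sub>F R in nhds r. ball_avg v x R = F R / (?w * R ^ ?m) + sphere_avg v x r"
  proof -
    have "\<forall>\<^sub>F R in nhds r. R \<in> {0<..<3 * r}"
      using r by (intro eventually_nhds_in_open) auto
    then show ?thesis
      by eventually_elim (use w in \<open>auto simp: F_eq\<close>)
  qed
  ultimately show ?thesis
    by (subst DERIV_cong_ev[OF refl _ refl]) simp_all
qed

text \<open>After the recurrence the hypothesis expresses the difference S - B as the ball average B
  times a factor of order r^2. As B' = m (S - B) / r, l'Hopital's rule evaluates (B - v x) /
  r^2.\<close>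

lemma has_mean_laplacian_of_means:
  fixes v :: "'a::euclidean_space \<Rightarrow> real"
  assumes v: "continuous_on UNIV v" and mu: "\<mu> > 0" and \<rho>: "\<rho> > 0"
    and means: "\<And>r. 0 < r \<Longrightarrow> r < \<rho> \<Longrightarrow>
        real DIM('a) * bessel_I (real DIM('a) / 2) (\<mu> * r) * sphere_mean v x r =
        \<mu> * r * bessel_I ((real DIM('a) - 2) / 2) (\<mu> * r) * ball_mean v x r"
  shows "has_mean_laplacian v x (\<mu>\<^sup>2 * v x)"
proof -
  define \<nu> where "\<nu> = real DIM('a) / 2"
  have \<nu>: "\<nu> > 0" by (simp add: \<nu>_def)
  let ?s = "\<lambda>r. (\<mu> * r / 2)\<^sup>2"
  let ?S = "sphere_avg v x" and ?B = "ball_avg v x"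
  have key: "\<nu> * bessel_series \<nu> (?s r) * (?S r - ?B r) = ?s r * bessel_series (\<nu> + 1) (?s r) * ?B r"
    if r: "0 < r" "r < \<rho>" for r
  proof -
    let ?P = "(\<mu> * r / 2) powr \<nu>"
    have P: "?P > 0" using mu r by simp
    \<comment> \<open>The factor \<open>\<mu> * r\<close> on the right raises the lower-order power
      to the one on the left, so the real powers cancel.\<close>
    have pm: "(\<mu> * r / 2) powr (\<nu> - 1) * (\<mu> * r / 2) = ?P"
      using mu r by (simp add: powr_diff)
    have e: "(real DIM('a) - 2) / 2 = \<nu> - 1" "real DIM('a) / 2 = \<nu>" "real DIM('a) = 2 * \<nu>"
      by (auto simp: \<nu>_def field_simps)
    have "2 * (?P * (\<nu> * bessel_series \<nu> (?s r) * ?S r)) = 2 * (((\<mu> * r / 2) powr (\<nu> - 1) * (\<mu> * r / 2)) * (bessel_series (\<nu> - 1) (?s r) * ?B r))"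
      using means[OF r]
      unfolding e(1,2) bessel_I_eq sphere_mean_eq_sphere_avg[OF v r(1)] ball_mean_eq_ball_avg[OF v r(1)]
      unfolding e(3) by (simp add: mult_ac)
    then have "\<nu> * bessel_series \<nu> (?s r) * ?S r = bessel_series (\<nu> - 1) (?s r) * ?B r"
      unfolding pm using P by simp
    then show ?thesis
      unfolding bessel_series_recurrence[OF less_imp_le[OF \<nu>]] by (simp add: algebra_simps)
  qed
  have s0: "(?s \<longlongrightarrow> 0) (at_right 0)"
    by (rule tendsto_eq_intros refl | simp)+
  have T: "((\<lambda>r. bessel_series \<nu> (?s r)) \<longlongrightarrow> rGamma (\<nu> + 1)) (at_right 0)"
    "((\<lambda>r. bessel_series (\<nu> + 1) (?s r)) \<longlongrightarrow> rGamma (\<nu> + 1 + 1)) (at_right 0)"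
    using \<nu> by (intro bessel_series_tendsto s0; simp)+
  have g: "rGamma (\<nu> + 1) > 0" "rGamma (\<nu> + 1) = (\<nu> + 1) * rGamma (\<nu> + 1 + 1)"
    using \<nu> rGamma_plus1[of "\<nu> + 1"] by (simp_all add: rGamma_real_pos)
  have "continuous_on UNIV ?B"
    unfolding ball_avg_def
  proof (intro continuous_on_divide continuous_kernel_integral ball_kernel_indicator)
    show "continuous_on UNIV (\<lambda>(r, y). v (x + r *\<^sub>R y))"
      unfolding case_prod_beta by (rule continuous_on_compose2[OF v]) (auto intro!: continuous_intros)
  qed (use unit_vol_pos[where ?'a='a] in auto)
  then have "isCont ?B 0" by (simp add: continuous_on_eq_continuous_at)
  then have "(?B \<longlongrightarrow> ?B 0) (at_right 0)"
    unfolding isCont_def by (rule filterlim_mono) (auto simp: at_within_le_at)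
  moreover have "?B 0 = v x"
    using unit_vol_pos[where ?'a='a] by (simp add: ball_avg_def unit_vol_def)
  ultimately have B0: "(?B \<longlongrightarrow> v x) (at_right 0)" by simp
  have ev: "\<forall>\<^sub>F r in at_right 0. r \<in> {0<..<\<rho>}"
    using \<rho> by (intro eventually_at_rightI[of 0 \<rho>]) auto
  have ev_pos: "\<forall>\<^sub>F r in at_right 0. bessel_series \<nu> (?s r) > 0"
    using T(1) g(1) by (rule order_tendstoD(1))
  have "((\<lambda>r. (\<mu>\<^sup>2 / 4) * (bessel_series (\<nu> + 1) (?s r) / bessel_series \<nu> (?s r)) * ?B r)
      \<longlongrightarrow> (\<mu>\<^sup>2 / 4) * (rGamma (\<nu> + 1 + 1) / rGamma (\<nu> + 1)) * v x) (at_right 0)"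
    using g(1) by (intro tendsto_intros T B0) auto
  \<comment> \<open>The ratio of the leading coefficients is 1 / (nu + 1) = 2 / (m + 2), which
    produces exactly the normalisation of the mean Laplacian.\<close>
  also have "(\<mu>\<^sup>2 / 4) * (rGamma (\<nu> + 1 + 1) / rGamma (\<nu> + 1)) * v x = \<mu>\<^sup>2 * v x / (2 * (DIM('a) + 2))"
  proof -
    have "rGamma (\<nu> + 1 + 1) / rGamma (\<nu> + 1) = 1 / (\<nu> + 1)"
      using \<nu> rGamma_real_pos[of "\<nu> + 1 + 1"] by (simp add: g(2))
    also have "\<dots> = 2 / (DIM('a) + 2)" by (simp add: \<nu>_def field_simps)
    finally have *: "rGamma (\<nu> + 1 + 1) / rGamma (\<nu> + 1) = 2 / (DIM('a) + 2)" .
    show ?thesis unfolding * by simp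
  qed
  finally have lim: "((\<lambda>r. (real DIM('a) / r * (?S r - ?B r)) / (2 * r)) \<longlongrightarrow> \<mu>\<^sup>2 * v x / (2 * (DIM('a) + 2))) (at_right 0)"
  proof (rule Lim_transform_eventually)
    show "\<forall>\<^sub>F r in at_right 0. (\<mu>\<^sup>2 / 4) * (bessel_series (\<nu> + 1) (?s r) / bessel_series \<nu> (?s r)) * ?B r
        = (real DIM('a) / r * (?S r - ?B r)) / (2 * r)"
      using ev ev_pos
    proof eventually_elim
      fix r assume r: "r \<in> {0<..<\<rho>}" and p: "bessel_series \<nu> (?s r) > 0"
      have "?S r - ?B r = ?s r * bessel_series (\<nu> + 1) (?s r) * ?B r / (\<nu> * bessel_series \<nu> (?s r))"
        using key[of r] r p \<nu> by (simp add: field_simps)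
      moreover have "real DIM('a) = 2 * \<nu>" by (simp add: \<nu>_def)
      moreover have "(2 * \<nu> / r * (?s r * b * c / (\<nu> * a))) / (2 * r) = (\<mu>\<^sup>2 / 4) * (b / a) * c" for a b c :: real
        using r \<nu> by (simp add: power2_eq_square)
      ultimately show "(\<mu>\<^sup>2 / 4) * (bessel_series (\<nu> + 1) (?s r) / bessel_series \<nu> (?s r)) * ?B r
        = (real DIM('a) / r * (?S r - ?B r)) / (2 * r)"
        by simp
    qed
  qed
  have "((\<lambda>r. (?B r - v x) / r\<^sup>2) \<longlongrightarrow> \<mu>\<^sup>2 * v x / (2 * (DIM('a) + 2))) (at_right 0)"
  proof (rule lhopital_right_0[OF _ _ _ _ _ _ lim])
    show "((\<lambda>r. ?B r - v x) \<longlongrightarrow> 0) (at_right 0)"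
      using tendsto_diff[OF B0 tendsto_const[of "v x"]] by simp
    show "((\<lambda>r::real. r\<^sup>2) \<longlongrightarrow> 0) (at_right 0)"
      by (rule tendsto_eq_intros refl | simp)+
    show "\<forall>\<^sub>F r in at_right 0. r\<^sup>2 \<noteq> (0::real)" "\<forall>\<^sub>F r in at_right 0. 2 * r \<noteq> (0::real)"
      using ev by (eventually_elim; auto)+
    show "\<forall>\<^sub>F r in at_right 0. ((\<lambda>r. ?B r - v x) has_real_derivative real DIM('a) / r * (?S r - ?B r)) (at r)"
      using ev by eventually_elim (auto intro!: derivative_eq_intros ball_avg_derivative v)
    show "\<forall>\<^sub>F r in at_right 0. ((\<lambda>r. r\<^sup>2) has_real_derivative 2 * r) (at (r::real))"
      by (intro always_eventually allI) (auto intro!: derivative_eq_intros)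
  qed
  then show ?thesis unfolding has_mean_laplacian_def .
qed

section \<open>Locality of differentiability and passage to the domain\<close>

lemma partial_deriv_cong:
  assumes "open S" "x \<in> S" "\<And>y. y \<in> S \<Longrightarrow> f y = g y"
  shows "partial_deriv b f x = partial_deriv b g x"
    and "(\<lambda>t. f (x + t *\<^sub>R b)) differentiable (at 0) \<longleftrightarrow> (\<lambda>t. g (x + t *\<^sub>R b)) differentiable (at 0)"
proof -
  have "((\<lambda>t. x + t *\<^sub>R b) \<longlongrightarrow> x + 0 *\<^sub>R b) (nhds 0)"
    by (intro tendsto_intros) (auto simp: filterlim_ident)
  then have "((\<lambda>t. x + t *\<^sub>R b) \<longlongrightarrow> x) (nhds 0)" by simp
  from topological_tendstoD[OF this assms(1,2)]
  have ev: "\<forall>\<^sub>F t in nhds 0. f (x + t *\<^sub>R b) = g (x + t *\<^sub>R b)"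
    by eventually_elim (rule assms(3))
  show "partial_deriv b f x = partial_deriv b g x"
    unfolding partial_deriv_def by (rule deriv_cong_ev[OF ev refl])
  show "(\<lambda>t. f (x + t *\<^sub>R b)) differentiable (at 0) \<longleftrightarrow> (\<lambda>t. g (x + t *\<^sub>R b)) differentiable (at 0)"
    unfolding real_differentiable_def using DERIV_cong_ev[OF refl ev refl] by simp
qed

lemma C1_on_cong:
  assumes "open S" "\<And>y. y \<in> S \<Longrightarrow> f y = g y" "C1_on S f"
  shows "C1_on S g"
proof -
  have p: "partial_deriv b f x = partial_deriv b g x"
    "(\<lambda>t. f (x + t *\<^sub>R b)) differentiable (at 0) \<longleftrightarrow> (\<lambda>t. g (x + t *\<^sub>R b)) differentiable (at 0)"
    if "x \<in> S" for b x
    by (rule partial_deriv_cong[OF assms(1) that], erule assms(2))+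
  show ?thesis
    unfolding C1_on_def
  proof (intro conjI ballI)
    show "continuous_on S g"
      using assms(3) by (intro continuous_on_eq[of S f g] assms(2)) (auto simp: C1_on_def)
    show "(\<lambda>t. g (x + t *\<^sub>R b)) differentiable (at 0)" if "b \<in> Basis" "x \<in> S" for b x
      using assms(3) that p(2)[of x b] by (auto simp: C1_on_def)
    show "continuous_on S (partial_deriv b g)" if "b \<in> Basis" for b
      using assms(3) that
      by (intro continuous_on_eq[of S "partial_deriv b f" "partial_deriv b g"] p(1))
        (auto simp: C1_on_def)
  qed
qed

lemma C1_on_local:
  assumes "\<And>x. x \<in> D \<Longrightarrow> \<exists>S. open S \<and> x \<in> S \<and> C1_on S f"
  shows "C1_on D f"
proof -
  have c: "continuous_on D g" if "\<And>x S. open S \<Longrightarrow> x \<in> S \<Longrightarrow> C1_on S f \<Longrightarrow> continuous_on S g" for g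
  proof (rule continuous_at_imp_continuous_on, rule ballI)
    fix x assume "x \<in> D"
    then obtain S where S: "open S" "x \<in> S" "C1_on S f" using assms by blast
    from that[OF S] S show "isCont g x" by (simp add: continuous_on_eq_continuous_at)
  qed
  show ?thesis
    unfolding C1_on_def
  proof (intro conjI ballI)
    show "continuous_on D f" by (rule c) (simp add: C1_on_def)
    show "(\<lambda>t. f (x + t *\<^sub>R b)) differentiable (at 0)" if "b \<in> Basis" "x \<in> D" for b x
      using assms[OF that(2)] that(1) by (auto simp: C1_on_def)
    show "continuous_on D (partial_deriv b f)" if "b \<in> Basis" for b
      by (rule c) (use that in \<open>simp add: C1_on_def\<close>)
  qed
qed

theorem theorem8:
  fixes D :: "'a::euclidean_space set" and v :: "'a \<Rightarrow> real"
    and \<mu> :: real and \<rho> :: "'a \<Rightarrow> real"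
  assumes dim: "DIM('a) \<ge> 2"
    and domain: "open D" "connected D" "bounded D"
    and mu: "\<mu> > 0"
    and cont: "continuous_on D v"
    and admissible: "\<And>x. x \<in> D \<Longrightarrow> \<rho> x > 0 \<and> closure (ball x (\<rho> x)) \<subseteq> D"
    and means: "\<And>x r. x \<in> D \<Longrightarrow> 0 < r \<Longrightarrow> r < \<rho> x \<Longrightarrow>
        real DIM('a) * bessel_I (real DIM('a) / 2) (\<mu> * r) * sphere_mean v x r =
        \<mu> * r * bessel_I ((real DIM('a) - 2) / 2) (\<mu> * r) * ball_mean v x r"
  shows "C2_on D v \<and> (\<forall>x\<in>D. laplacian v x - \<mu>\<^sup>2 * v x = 0)"
proof -
  have loc: "\<exists>S. open S \<and> z \<in> S \<and> C2_on S v \<and> laplacian v z = \<mu>\<^sup>2 * v z" if z: "z \<in> D" for z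
  proof -
    obtain R where R: "R > 0" "cball z R \<subseteq> D"
      using domain(1) z by (meson open_contains_cball)
    \<comment> \<open>Tietze's theorem supplies a continuous function on the whole space. For x in
      the ball and r below \<open>R - dist z x\<close>, its means coincide with those of
      \<open>v\<close>.\<close>
    obtain u where u: "continuous_on UNIV u" "\<And>x. x \<in> cball z R \<Longrightarrow> u x = v x"
      using Tietze_unbounded[of "cball z R" v UNIV] continuous_on_subset[OF cont R(2)] by auto
    have "has_mean_laplacian u x (\<mu>\<^sup>2 * u x)" if x: "x \<in> ball z R" for x
    proof (rule has_mean_laplacian_of_means[OF u(1) mu])
      have xD: "x \<in> D" using x R(2) by auto
      show "min (\<rho> x) (R - dist z x) > 0" using x admissible[OF xD] by simp
      fix r assume r: "0 < r" "r < min (\<rho> x) (R - dist z x)"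
      have sub: "u y = v y" if "dist x y \<le> r" for y
        using u(2)[of y] dist_triangle[of z y x] that r by auto
      have "(LINT y:sphere x r|sphere_measure x r. u y) = (LINT y:sphere x r|sphere_measure x r. v y)"
        unfolding set_lebesgue_integral_def
        by (rule Bochner_Integration.integral_cong) (auto simp: indicator_def sub)
      then have "sphere_mean u x r = sphere_mean v x r" by (simp add: sphere_mean_def)
      moreover have "(LINT y:ball x r|lborel. u y) = (LINT y:ball x r|lborel. v y)"
        unfolding set_lebesgue_integral_def
        by (rule Bochner_Integration.integral_cong) (auto simp: indicator_def sub)
      then have "ball_mean u x r = ball_mean v x r" by (simp add: ball_mean_def)
      ultimately show "real DIM('a) * bessel_I (real DIM('a) / 2) (\<mu> * r) * sphere_mean u x r =
        \<mu> * r * bessel_I ((real DIM('a) - 2) / 2) (\<mu> * r) * ball_mean u x r"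
        using means[OF xD r(1)] r(2) by simp
    qed
    then obtain r where r: "r > 0" "C2_on (ball z r) u" "\<And>x. x \<in> ball z r \<Longrightarrow> laplacian u x = \<mu>\<^sup>2 * u x"
      using helmholtz_local[OF R(1) less_imp_neq[OF mu, symmetric] u(1)] by blast
    \<comment> \<open>Regularity of \<open>u\<close> is known on \<open>ball z r\<close> and
      agreement with \<open>v\<close> on \<open>cball z R\<close>; both hold on the smaller ball,
      which is open, so derivatives carry over.\<close>
    let ?S = "ball z (min r R)"
    have uv: "u y = v y" if "y \<in> ?S" for y using that u(2) by auto
    have sub: "C1_on ?S f" if "C1_on (ball z r) f" for f
      using that unfolding C1_on_def by (auto elim!: continuous_on_subset)
    have "C1_on ?S v"
      using r(2) by (intro C1_on_cong[OF open_ball uv sub]) (auto simp: C2_on_def)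
    moreover have pu: "partial_deriv b u y = partial_deriv b v y" if "y \<in> ?S" for b y
      using partial_deriv_cong(1)[OF open_ball that uv] .
    moreover have "C1_on ?S (partial_deriv b v)" if "b \<in> Basis" for b
      using r(2) that by (intro C1_on_cong[OF open_ball pu sub]) (auto simp: C2_on_def)
    moreover have "laplacian u z = laplacian v z"
      unfolding laplacian_def using r(1) R(1)
      by (intro sum.cong refl partial_deriv_cong(1)[where S="?S", OF open_ball _ pu]) auto
    ultimately show ?thesis
      using r(1,3) R(1) uv[of z] by (intro exI[of _ ?S]) (auto simp: C2_on_def)
  qed
  have "C2_on D v"
    unfolding C2_on_def using loc unfolding C2_on_def
    by (intro conjI ballI C1_on_local) meson+
  with loc show ?thesis by fastforce
qed

end
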